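(* Let $\mathcal{C}$ be a strict braided monoidal category, let $H\colon\mathbb{Z}\to\mathcal{C}$ be a Hopf f-object, and let $(Y,\lambda,\delta)$ be a left (respectively right) Yetter--Drinfel'd f-object over $H$. Let $\tau$ be the braiding of $\mathcal{C}^{\mathbb{Z}}$. Then $$\rho=\rho_L:=(\lambda\otimes\operatorname{id}_Y)(\operatorname{id}_H\otimes\tau_{Y,Y})(\delta\otimes\phi_Y),$$ respectively $$\rho=\rho_R:=(\phi_Y\otimes\lambda)(\tau_{Y,Y}\otimes\operatorname{id}_H)(\operatorname{id}_Y\otimes\delta),$$ is an $R$-matrix, i.e. $\rho$ is an automorphism of $Y\otimes Y$ and the following relation holds in the automorphism group $\operatorname{Aut}(Y\otimes Y\otimes Y)$: $$(\rho\otimes\operatorname{id}_Y)(\operatorname{id}_Y\otimes\rho)(\rho\otimes\operatorname{id}_Y)=(\operatorname{id}_Y\otimes\rho)(\rho\otimes\operatorname{id}_Y)(\operatorname{id}_Y\otimes\rho).$$ Moreover, this $R$-matrix $\rho$ is rigid if the f-object $Y$ is rigid.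
   Context: Conventions: all monoidal categories are strict; composition of morphisms is written by juxtaposition, $fg=f\circ g$, and composition takes precedence over $\otimes$, so $fg\otimes h=(fg)\otimes h$. The category $\mathcal{C}^{\mathbb{Z}}$: the group $\mathbb{Z}$ is viewed as a category with one object $*$ with automorphism group $\mathbb{Z}$; $\mathcal{C}^{\mathbb{Z}}$ is the category of functors $\mathbb{Z}\to\mathcal{C}$ (called f-objects) and natural transformations. Equivalently, an f-object $F$ is a pair $(A,\phi)$ with $A=F( * )$ an object of $\mathcal{C}$ and $\phi=F(1)\in\operatorname{Aut}(A)$; a morphism $(A,\phi)\to(B,\psi)$ is a morphism $f\colon A\to B$ in $\mathcal{C}$ with $\psi f=f\phi$; and $(A,\phi)\otimes(B,\psi)=(A\otimes B,\phi\otimes\psi)$. The unit object is $\mathbb{I}=(I,\operatorname{id}_I)$ with $I$ the unit of $\mathcal{C}$. The category $\mathcal{C}^{\mathbb{Z}}$ is braided monoidal, with braiding $\tau_{F,G}\colon F\otimes G\to G\otimes F$ given by the braiding of $\mathcal{C}$ on the underlying objects. For an f-object $F$, $\phi_F\colon F\to F$ denotes the isomorphism in $\mathcal{C}^{\mathbb{Z}}$ whose value at $*$ is $F(1)$. Hopf f-object: an f-object $H$ with morphisms in $\mathcal{C}^{\mathbb{Z}}$: $\nabla\colon H\otimes H\to H$, $\eta\colon\mathbb{I}\to H$, $\Delta\colon H\to H\otimes H$, $\epsilon\colon H\to\mathbb{I}$, $S\colon H\to H$, such that $(H,\nabla,\eta)$ is an (associative unital) algebra object, $(H,\Delta,\epsilon)$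 is a (coassociative counital) coalgebra object, $$(\nabla\otimes\nabla)(\operatorname{id}_H\otimes\tau_{H,H}\otimes\operatorname{id}_H)(\Delta\otimes\Delta)=\Delta\nabla,\qquad \nabla(S\otimes\operatorname{id}_H)\Delta=\eta\epsilon=\nabla(\operatorname{id}_H\otimes S)\Delta,$$ and $S$ is always assumed invertible. (As usual for a Hopf object, $\eta$ is a coalgebra morphism and $\epsilon$ is an algebra morphism.) Left Yetter--Drinfel'd f-object over $H$: a triple $(Y,\lambda_L,\delta_L)$ with $Y$ an f-object and $\lambda_L\colon H\otimes Y\to Y$, $\delta_L\colon Y\to H\otimes Y$ morphisms of $\mathcal{C}^{\mathbb{Z}}$ such that $(Y,\lambda_L)$ is a left $H$-module, $(Y,\delta_L)$ is a left $H$-comodule, and $$(\nabla\otimes\operatorname{id}_Y)(\operatorname{id}_H\otimes\tau_{Y,H})(\delta_L\lambda_L\otimes\phi_H)(\operatorname{id}_H\otimes\tau_{H,Y})(\Delta\otimes\operatorname{id}_Y)=(\nabla\otimes\lambda_L)(\operatorname{id}_H\otimes\tau_{H,H}\otimes\operatorname{id}_Y)(\Delta\otimes\delta_L).$$ Right Yetter--Drinfel'd f-object over $H$: a triple $(Y,\lambda_R,\delta_R)$ with $Y$ an f-object and $\lambda_R\colon Y\otimes H\to Y$, $\delta_R\colon Y\to Y\otimes H$ morphisms of $\mathcal{C}^{\mathbb{Z}}$ such that $(Y,\lambda_R)$ is a right $H$-module, $(Y,\delta_R)$ is a right $H$-comodule, and $$(\operatorname{id}_Y\otimes\nabla)(\tau_{H,Y}\otimes\operatorname{id}_H)(\phi_H\otimes\delta_R\lambda_R)(\tau_{Y,H}\otimes\operatorname{id}_H)(\operatorname{id}_Y\otimes\Delta)=(\lambda_R\otimes\nabla)(\operatorname{id}_Y\otimes\tau_{H,H}\otimes\operatorname{id}_H)(\delta_R\otimes\Delta).$$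 Rigidity: an f-object $Y$ is rigid if it has a dual $Y^*$ in $\mathcal{C}^{\mathbb{Z}}$, with evaluation $\mathrm{ev}\colon Y^*\otimes Y\to\mathbb{I}$ and coevaluation $\mathrm{coev}\colon\mathbb{I}\to Y\otimes Y^*$ satisfying the usual zig-zag identities. For such $Y$ and $f\in\operatorname{End}(Y\otimes Y)$, the partial transpose $\tilde f\colon Y^*\otimes Y\to Y\otimes Y^*$ is $$\tilde f=(\mathrm{ev}\otimes\operatorname{id}_{Y\otimes Y^*})(\operatorname{id}_{Y^*}\otimes f\otimes\operatorname{id}_{Y^*})(\operatorname{id}_{Y^*\otimes Y}\otimes\mathrm{coev}).$$ An $R$-matrix $\rho$ on $Y$ is rigid if both $\widetilde{\rho}$ and $\widetilde{\rho^{-1}}$ are invertible. *)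

theory Defs
  imports Main
begin

section \<open>Strict braided monoidal categories\<close>

text \<open>
  Composition is written in applicative order and binds tighter than the tensor product, so
  \<open>f \<cdot> g \<otimes> h\<close> means \<open>(f \<cdot> g) \<otimes> h\<close>. The identity of \<open>A\<close> is \<open>\<one> A\<close>, and \<open>\<odot>\<close> is the tensor product
  of objects. The operations are only constrained on objects in \<open>Obj\<close> and on (composable)
  arrows in \<open>Arr\<close>.
\<close>

record ('o, 'm) bm_cat =
  Obj :: "'o set"
  Arr :: "'m set"
  Dom :: "'m \<Rightarrow> 'o"
  Cod :: "'m \<Rightarrow> 'o"
  Id :: "'o \<Rightarrow> 'm"  ("\<one>\<index>")
  Comp :: "'m \<Rightarrow> 'm \<Rightarrow> 'm"  (infixl "\<cdot>\<index>" 75)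
  Tobj :: "'o \<Rightarrow> 'o \<Rightarrow> 'o"  (infixl "\<odot>\<index>" 70)
  Tarr :: "'m \<Rightarrow> 'm \<Rightarrow> 'm"  (infixl "\<otimes>\<index>" 70)
  Unit :: "'o"  ("\<I>\<index>")
  Braid :: "'o \<Rightarrow> 'o \<Rightarrow> 'm"  ("\<tau>\<index>")

definition hom :: "('o, 'm) bm_cat \<Rightarrow> 'o \<Rightarrow> 'o \<Rightarrow> 'm set" where
  "hom C A B = {f \<in> Arr C. Dom C f = A \<and> Cod C f = B}"

definition is_inverse :: "('o, 'm) bm_cat \<Rightarrow> 'm \<Rightarrow> 'm \<Rightarrow> bool" where
  "is_inverse C f g \<longleftrightarrow>
     f \<in> Arr C \<and> g \<in> hom C (Cod C f) (Dom C f) \<and>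
     Comp C g f = Id C (Dom C f) \<and> Comp C f g = Id C (Cod C f)"

definition invertible :: "('o, 'm) bm_cat \<Rightarrow> 'm \<Rightarrow> bool" where
  "invertible C f \<longleftrightarrow> (\<exists>g. is_inverse C f g)"

definition inverse_arr :: "('o, 'm) bm_cat \<Rightarrow> 'm \<Rightarrow> 'm" where
  "inverse_arr C f = (THE g. is_inverse C f g)"

locale small_category =
  fixes C :: "('o, 'm) bm_cat" (structure)
  assumes dom_obj: "f \<in> Arr C \<Longrightarrow> Dom C f \<in> Obj C"
    and cod_obj: "f \<in> Arr C \<Longrightarrow> Cod C f \<in> Obj C"
    and id_hom: "A \<in> Obj C \<Longrightarrow> \<one> A \<in> hom C A A"
    and comp_hom: "\<lbrakk>f \<in> hom C A B; g \<in> hom C B E\<rbrakk> \<Longrightarrow> g \<cdot> f \<in> hom C A E"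
    and comp_id_left: "f \<in> hom C A B \<Longrightarrow> \<one> B \<cdot> f = f"
    and comp_id_right: "f \<in> hom C A B \<Longrightarrow> f \<cdot> \<one> A = f"
    and comp_assoc:
      "\<lbrakk>f \<in> hom C A B; g \<in> hom C B E; h \<in> hom C E F\<rbrakk> \<Longrightarrow> (h \<cdot> g) \<cdot> f = h \<cdot> (g \<cdot> f)"

locale strict_monoidal_category = small_category +
  assumes unit_obj: "\<I> \<in> Obj C"
    and tensor_obj: "\<lbrakk>A \<in> Obj C; B \<in> Obj C\<rbrakk> \<Longrightarrow> A \<odot> B \<in> Obj C"
    and tensor_hom:
      "\<lbrakk>f \<in> hom C A B; g \<in> hom C A' B'\<rbrakk> \<Longrightarrow> f \<otimes> g \<in> hom C (A \<odot> A') (B \<odot> B')"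
    and tensor_id: "\<lbrakk>A \<in> Obj C; B \<in> Obj C\<rbrakk> \<Longrightarrow> \<one> A \<otimes> \<one> B = \<one> (A \<odot> B)"
    and tensor_comp:
      "\<lbrakk>f \<in> hom C A B; g \<in> hom C B E; f' \<in> hom C A' B'; g' \<in> hom C B' E'\<rbrakk>
        \<Longrightarrow> g \<cdot> f \<otimes> g' \<cdot> f' = (g \<otimes> g') \<cdot> (f \<otimes> f')"
    and tensor_assoc_obj:
      "\<lbrakk>A \<in> Obj C; B \<in> Obj C; E \<in> Obj C\<rbrakk> \<Longrightarrow> (A \<odot> B) \<odot> E = A \<odot> (B \<odot> E)"
    and tensor_assoc_arr:
      "\<lbrakk>f \<in> Arr C; g \<in> Arr C; h \<in> Arr C\<rbrakk> \<Longrightarrow> (f \<otimes> g) \<otimes> h = f \<otimes> (g \<otimes> h)"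
    and unit_left_obj: "A \<in> Obj C \<Longrightarrow> \<I> \<odot> A = A"
    and unit_right_obj: "A \<in> Obj C \<Longrightarrow> A \<odot> \<I> = A"
    and unit_left_arr: "f \<in> Arr C \<Longrightarrow> \<one> \<I> \<otimes> f = f"
    and unit_right_arr: "f \<in> Arr C \<Longrightarrow> f \<otimes> \<one> \<I> = f"

locale strict_braided_monoidal_category = strict_monoidal_category +
  assumes braid_hom: "\<lbrakk>A \<in> Obj C; B \<in> Obj C\<rbrakk> \<Longrightarrow> \<tau> A B \<in> hom C (A \<odot> B) (B \<odot> A)"
    and braid_invertible: "\<lbrakk>A \<in> Obj C; B \<in> Obj C\<rbrakk> \<Longrightarrow> invertible C (\<tau> A B)"
    and braid_natural:
      "\<lbrakk>f \<in> hom C A B; g \<in> hom C A' B'\<rbrakk> \<Longrightarrow> \<tau> B B' \<cdot> (f \<otimes> g) = (g \<otimes> f) \<cdot> \<tau> A A'"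
    and hexagon_left:
      "\<lbrakk>A \<in> Obj C; B \<in> Obj C; E \<in> Obj C\<rbrakk>
        \<Longrightarrow> \<tau> (A \<odot> B) E = (\<tau> A E \<otimes> \<one> B) \<cdot> (\<one> A \<otimes> \<tau> B E)"
    and hexagon_right:
      "\<lbrakk>A \<in> Obj C; B \<in> Obj C; E \<in> Obj C\<rbrakk>
        \<Longrightarrow> \<tau> A (B \<odot> E) = (\<one> B \<otimes> \<tau> A E) \<cdot> (\<tau> A B \<otimes> \<one> E)"


section \<open>The category of f-objects\<close>

text \<open>
  A functor from the one-object category \<open>\<int>\<close> to \<open>C\<close> is encoded by the image of the object together
  with the action on the morphisms \<open>n :: int\<close>. An arrow of the functor category carries its
  source and target functor in addition to its single component.
\<close>

type_synonym ('o, 'm) f_obj = "'o \<times> (int \<Rightarrow> 'm)"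
type_synonym ('o, 'm) f_arr = "('o, 'm) f_obj \<times> 'm \<times> ('o, 'm) f_obj"

definition is_f_object :: "('o, 'm) bm_cat \<Rightarrow> ('o, 'm) f_obj \<Rightarrow> bool" where
  "is_f_object C F \<longleftrightarrow>
     fst F \<in> Obj C \<and>
     (\<forall>n. snd F n \<in> hom C (fst F) (fst F)) \<and>
     snd F 0 = Id C (fst F) \<and>
     (\<forall>m n. snd F (m + n) = Comp C (snd F m) (snd F n))"

definition f_category :: "('o, 'm) bm_cat \<Rightarrow> (('o, 'm) f_obj, ('o, 'm) f_arr) bm_cat" where
  "f_category C = \<lparr>
     Obj = {F. is_f_object C F},
     Arr = {(F, f, G) | F f G. is_f_object C F \<and> is_f_object C G \<and> f \<in> hom C (fst F) (fst G) \<and>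
              (\<forall>n. Comp C (snd G n) f = Comp C f (snd F n))},
     Dom = (\<lambda>(F, f, G). F),
     Cod = (\<lambda>(F, f, G). G),
     Id = (\<lambda>F. (F, Id C (fst F), F)),
     Comp = (\<lambda>(G', g, K) (F, f, G). (F, Comp C g f, K)),
     Tobj = (\<lambda>F G. (Tobj C (fst F) (fst G), \<lambda>n. Tarr C (snd F n) (snd G n))),
     Tarr = (\<lambda>(F, f, G) (F', f', G').
       ((Tobj C (fst F) (fst F'), \<lambda>n. Tarr C (snd F n) (snd F' n)),
        Tarr C f f',
        (Tobj C (fst G) (fst G'), \<lambda>n. Tarr C (snd G n) (snd G' n)))),
     Unit = (Unit C, \<lambda>n. Id C (Unit C)),
     Braid = (\<lambda>F G.
       ((Tobj C (fst F) (fst G), \<lambda>n. Tarr C (snd F n) (snd G n)),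
        Braid C (fst F) (fst G),
        (Tobj C (fst G) (fst F), \<lambda>n. Tarr C (snd G n) (snd F n))))\<rparr>"

definition f_phi :: "('o, 'm) f_obj \<Rightarrow> ('o, 'm) f_arr" where
  "f_phi F = (F, snd F 1, F)"


section \<open>Hopf objects and Yetter-Drinfel'd objects\<close>

text \<open>
  The notions below are stated in a strict braided monoidal category \<open>D\<close>; those for f-objects over
  \<open>C\<close> are the instances \<open>D = f_category C\<close>. The Yetter-Drinfel'd condition and the R-matrices
  also depend on a family \<open>\<phi>\<close> of arrows \<open>\<phi> F : F \<rightarrow> F\<close>, which for f-objects is \<open>f_phi\<close>.
  The multiplication of an algebra is written \<open>\<mu>\<close>.
\<close>

definition algebra_object ::
  "('o, 'm) bm_cat \<Rightarrow> 'o \<Rightarrow> 'm \<Rightarrow> 'm \<Rightarrow> bool" where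
  "algebra_object D H \<mu> \<eta> \<longleftrightarrow>
     H \<in> Obj D \<and> \<mu> \<in> hom D (H \<odot> H) H \<and> \<eta> \<in> hom D \<I> H \<and>
     \<mu> \<cdot> (\<mu> \<otimes> \<one> H) = \<mu> \<cdot> (\<one> H \<otimes> \<mu>) \<and>
     \<mu> \<cdot> (\<eta> \<otimes> \<one> H) = \<one> H \<and> \<mu> \<cdot> (\<one> H \<otimes> \<eta>) = \<one> H"
  for D (structure)

definition coalgebra_object ::
  "('o, 'm) bm_cat \<Rightarrow> 'o \<Rightarrow> 'm \<Rightarrow> 'm \<Rightarrow> bool" where
  "coalgebra_object D H \<Delta> \<epsilon> \<longleftrightarrow>
     H \<in> Obj D \<and> \<Delta> \<in> hom D H (H \<odot> H) \<and> \<epsilon> \<in> hom D H \<I> \<and>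
     (\<Delta> \<otimes> \<one> H) \<cdot> \<Delta> = (\<one> H \<otimes> \<Delta>) \<cdot> \<Delta> \<and>
     (\<epsilon> \<otimes> \<one> H) \<cdot> \<Delta> = \<one> H \<and> (\<one> H \<otimes> \<epsilon>) \<cdot> \<Delta> = \<one> H"
  for D (structure)

definition hopf_object ::
  "('o, 'm) bm_cat \<Rightarrow> 'o \<Rightarrow> 'm \<Rightarrow> 'm \<Rightarrow> 'm \<Rightarrow> 'm \<Rightarrow> 'm \<Rightarrow> bool" where
  "hopf_object D H \<mu> \<eta> \<Delta> \<epsilon> S \<longleftrightarrow>
     algebra_object D H \<mu> \<eta> \<and> coalgebra_object D H \<Delta> \<epsilon> \<and>
     (\<mu> \<otimes> \<mu>) \<cdot> (\<one> H \<otimes> \<tau> H H \<otimes> \<one> H) \<cdot> (\<Delta> \<otimes> \<Delta>) = \<Delta> \<cdot> \<mu> \<and>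
     \<Delta> \<cdot> \<eta> = \<eta> \<otimes> \<eta> \<and> \<epsilon> \<cdot> \<mu> = \<epsilon> \<otimes> \<epsilon> \<and> \<epsilon> \<cdot> \<eta> = \<one> \<I> \<and>
     S \<in> hom D H H \<and> invertible D S \<and>
     \<mu> \<cdot> (S \<otimes> \<one> H) \<cdot> \<Delta> = \<eta> \<cdot> \<epsilon> \<and> \<mu> \<cdot> (\<one> H \<otimes> S) \<cdot> \<Delta> = \<eta> \<cdot> \<epsilon>"
  for D (structure)

definition left_module ::
  "('o, 'm) bm_cat \<Rightarrow> 'o \<Rightarrow> 'm \<Rightarrow> 'm \<Rightarrow> 'o \<Rightarrow> 'm \<Rightarrow> bool" where
  "left_module D H \<mu> \<eta> Y act \<longleftrightarrow>
     Y \<in> Obj D \<and> act \<in> hom D (H \<odot> Y) Y \<and>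
     act \<cdot> (\<mu> \<otimes> \<one> Y) = act \<cdot> (\<one> H \<otimes> act) \<and> act \<cdot> (\<eta> \<otimes> \<one> Y) = \<one> Y"
  for D (structure)

definition left_comodule ::
  "('o, 'm) bm_cat \<Rightarrow> 'o \<Rightarrow> 'm \<Rightarrow> 'm \<Rightarrow> 'o \<Rightarrow> 'm \<Rightarrow> bool" where
  "left_comodule D H \<Delta> \<epsilon> Y \<delta> \<longleftrightarrow>
     Y \<in> Obj D \<and> \<delta> \<in> hom D Y (H \<odot> Y) \<and>
     (\<Delta> \<otimes> \<one> Y) \<cdot> \<delta> = (\<one> H \<otimes> \<delta>) \<cdot> \<delta> \<and> (\<epsilon> \<otimes> \<one> Y) \<cdot> \<delta> = \<one> Y"
  for D (structure)

definition right_module ::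
  "('o, 'm) bm_cat \<Rightarrow> 'o \<Rightarrow> 'm \<Rightarrow> 'm \<Rightarrow> 'o \<Rightarrow> 'm \<Rightarrow> bool" where
  "right_module D H \<mu> \<eta> Y act \<longleftrightarrow>
     Y \<in> Obj D \<and> act \<in> hom D (Y \<odot> H) Y \<and>
     act \<cdot> (\<one> Y \<otimes> \<mu>) = act \<cdot> (act \<otimes> \<one> H) \<and> act \<cdot> (\<one> Y \<otimes> \<eta>) = \<one> Y"
  for D (structure)

definition right_comodule ::
  "('o, 'm) bm_cat \<Rightarrow> 'o \<Rightarrow> 'm \<Rightarrow> 'm \<Rightarrow> 'o \<Rightarrow> 'm \<Rightarrow> bool" where
  "right_comodule D H \<Delta> \<epsilon> Y \<delta> \<longleftrightarrow>
     Y \<in> Obj D \<and> \<delta> \<in> hom D Y (Y \<odot> H) \<and>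
     (\<one> Y \<otimes> \<Delta>) \<cdot> \<delta> = (\<delta> \<otimes> \<one> H) \<cdot> \<delta> \<and> (\<one> Y \<otimes> \<epsilon>) \<cdot> \<delta> = \<one> Y"
  for D (structure)

definition left_yetter_drinfeld ::
  "('o, 'm) bm_cat \<Rightarrow> ('o \<Rightarrow> 'm) \<Rightarrow> 'o \<Rightarrow> 'm \<Rightarrow> 'm \<Rightarrow> 'm \<Rightarrow> 'm \<Rightarrow> 'o \<Rightarrow> 'm \<Rightarrow> 'm \<Rightarrow> bool" where
  "left_yetter_drinfeld D \<phi> H \<mu> \<eta> \<Delta> \<epsilon> Y act \<delta> \<longleftrightarrow>
     left_module D H \<mu> \<eta> Y act \<and> left_comodule D H \<Delta> \<epsilon> Y \<delta> \<and>
     (\<mu> \<otimes> \<one> Y) \<cdot> (\<one> H \<otimes> \<tau> Y H) \<cdot> (\<delta> \<cdot> act \<otimes> \<phi> H) \<cdot> (\<one> H \<otimes> \<tau> H Y) \<cdot> (\<Delta> \<otimes> \<one> Y) =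
     (\<mu> \<otimes> act) \<cdot> (\<one> H \<otimes> \<tau> H H \<otimes> \<one> Y) \<cdot> (\<Delta> \<otimes> \<delta>)"
  for D (structure)

definition right_yetter_drinfeld ::
  "('o, 'm) bm_cat \<Rightarrow> ('o \<Rightarrow> 'm) \<Rightarrow> 'o \<Rightarrow> 'm \<Rightarrow> 'm \<Rightarrow> 'm \<Rightarrow> 'm \<Rightarrow> 'o \<Rightarrow> 'm \<Rightarrow> 'm \<Rightarrow> bool" where
  "right_yetter_drinfeld D \<phi> H \<mu> \<eta> \<Delta> \<epsilon> Y act \<delta> \<longleftrightarrow>
     right_module D H \<mu> \<eta> Y act \<and> right_comodule D H \<Delta> \<epsilon> Y \<delta> \<and>
     (\<one> Y \<otimes> \<mu>) \<cdot> (\<tau> H Y \<otimes> \<one> H) \<cdot> (\<phi> H \<otimes> \<delta> \<cdot> act) \<cdot> (\<tau> Y H \<otimes> \<one> H) \<cdot> (\<one> Y \<otimes> \<Delta>) =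
     (act \<otimes> \<mu>) \<cdot> (\<one> Y \<otimes> \<tau> H H \<otimes> \<one> H) \<cdot> (\<delta> \<otimes> \<Delta>)"
  for D (structure)


section \<open>R-matrices and rigidity\<close>

definition r_matrix :: "('o, 'm) bm_cat \<Rightarrow> 'o \<Rightarrow> 'm \<Rightarrow> bool" where
  "r_matrix D Y \<rho> \<longleftrightarrow>
     \<rho> \<in> hom D (Y \<odot> Y) (Y \<odot> Y) \<and> invertible D \<rho> \<and>
     (\<rho> \<otimes> \<one> Y) \<cdot> (\<one> Y \<otimes> \<rho>) \<cdot> (\<rho> \<otimes> \<one> Y) = (\<one> Y \<otimes> \<rho>) \<cdot> (\<rho> \<otimes> \<one> Y) \<cdot> (\<one> Y \<otimes> \<rho>)"
  for D (structure)

definition is_dual :: "('o, 'm) bm_cat \<Rightarrow> 'o \<Rightarrow> 'o \<Rightarrow> 'm \<Rightarrow> 'm \<Rightarrow> bool" where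
  "is_dual D Y Y' ev coev \<longleftrightarrow>
     Y \<in> Obj D \<and> Y' \<in> Obj D \<and> ev \<in> hom D (Y' \<odot> Y) \<I> \<and> coev \<in> hom D \<I> (Y \<odot> Y') \<and>
     (\<one> Y \<otimes> ev) \<cdot> (coev \<otimes> \<one> Y) = \<one> Y \<and> (ev \<otimes> \<one> Y') \<cdot> (\<one> Y' \<otimes> coev) = \<one> Y'"
  for D (structure)

definition rigid_object :: "('o, 'm) bm_cat \<Rightarrow> 'o \<Rightarrow> bool" where
  "rigid_object D Y \<longleftrightarrow> (\<exists>Y' ev coev. is_dual D Y Y' ev coev)"

definition partial_transpose :: "('o, 'm) bm_cat \<Rightarrow> 'o \<Rightarrow> 'o \<Rightarrow> 'm \<Rightarrow> 'm \<Rightarrow> 'm \<Rightarrow> 'm" where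
  "partial_transpose D Y Y' ev coev f =
     (ev \<otimes> \<one> (Y \<odot> Y')) \<cdot> (\<one> Y' \<otimes> f \<otimes> \<one> Y') \<cdot> (\<one> (Y' \<odot> Y) \<otimes> coev)"
  for D (structure)

text \<open>
  Invertibility of the partial transposes does not depend on the choice of the dual, so it is
  required for every dual; the conjunct \<open>rigid_object D Y\<close> makes sure that there is one.
\<close>

definition rigid_r_matrix :: "('o, 'm) bm_cat \<Rightarrow> 'o \<Rightarrow> 'm \<Rightarrow> bool" where
  "rigid_r_matrix D Y \<rho> \<longleftrightarrow>
     r_matrix D Y \<rho> \<and> rigid_object D Y \<and>
     (\<forall>Y' ev coev. is_dual D Y Y' ev coev \<longrightarrow>
        invertible D (partial_transpose D Y Y' ev coev \<rho>) \<and>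
        invertible D (partial_transpose D Y Y' ev coev (inverse_arr D \<rho>)))"

definition rho_L :: "('o, 'm) bm_cat \<Rightarrow> ('o \<Rightarrow> 'm) \<Rightarrow> 'o \<Rightarrow> 'o \<Rightarrow> 'm \<Rightarrow> 'm \<Rightarrow> 'm" where
  "rho_L D \<phi> H Y act \<delta> = (act \<otimes> \<one> Y) \<cdot> (\<one> H \<otimes> \<tau> Y Y) \<cdot> (\<delta> \<otimes> \<phi> Y)"
  for D (structure)

definition rho_R :: "('o, 'm) bm_cat \<Rightarrow> ('o \<Rightarrow> 'm) \<Rightarrow> 'o \<Rightarrow> 'o \<Rightarrow> 'm \<Rightarrow> 'm \<Rightarrow> 'm" where
  "rho_R D \<phi> H Y act \<delta> = (\<phi> Y \<otimes> act) \<cdot> (\<tau> Y Y \<otimes> \<one> H) \<cdot> (\<one> Y \<otimes> \<delta>)"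
  for D (structure)

end

theory Submission
  imports Defs
begin

text \<open>
  The argument takes place in an arbitrary strict braided monoidal category with an endomorphism
  \<open>\<phi> H\<close> and an automorphism \<open>\<phi> Y\<close> that are compatible with the action and the coaction. The \<open>f\<close>-objects are such a
  case, because \<open>f_phi\<close> commutes with every morphism of \<open>f\<close>-objects and is multiplicative.

  \<^emph>\<open>Braid relation.\<close> For a left \<open>H\<close>-module \<open>M\<close> let \<open>c\<close> be the arrow from \<open>Y \<odot> M\<close> to \<open>M \<odot> Y\<close> that splits
  an element of \<open>H\<close> off \<open>Y\<close>, lets \<open>Y\<close> cross over \<open>M\<close>, and lets the element act on \<open>M\<close>; \<open>\<rho>\<close> is this
  arrow for \<open>M = Y\<close> after \<open>\<phi>\<close> has been applied to \<open>M\<close>. Coassociativity of the coaction says that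
  for \<open>M = Y \<odot> Y\<close>, with the diagonal action, the resulting arrow consists of two copies of \<open>\<rho>\<close>
  (\<open>R_hexagon\<close>). It is natural for \<open>H\<close>-linear arrows of \<open>M\<close>, and the twisted Yetter-Drinfel'd
  condition says just enough to make \<open>\<rho>\<close> itself \<open>H\<close>-linear (\<open>R_module_map\<close>). Naturality with
  respect to \<open>\<rho>\<close> is the braid relation (\<open>R_braid_relation\<close>).

  \<^emph>\<open>Invertibility.\<close> Moving the crossing of \<open>Y\<close> and \<open>M\<close> to the end turns the coaction into a right
  coaction of the coopposite coalgebra, and what precedes the crossing is an endomorphism of
  \<open>Y \<odot> M\<close> that depends on the action. Composing two such endomorphisms convolves the two actions
  (\<open>left_convolution\<close>), so that an action and a convolution inverse of it give mutually inverse
  arrows (\<open>crossing_inverse\<close>). For \<open>\<rho>\<close> the convolution is formed with the coopposite coproduct, and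
  the inverse is the action through \<open>S\<close> inverse; that \<open>S\<close> inverse is an antipode for the coopposite
  coproduct rests on antimultiplicativity of \<open>S\<close>.

  \<^emph>\<open>Rigidity.\<close> Both partial transposes have the same shape. In that of \<open>\<rho>\<close> the dual of \<open>Y\<close> is a
  right \<open>H\<close>-module, the relevant convolution uses \<open>\<Delta>\<close> itself, and the inverse is the action through
  \<open>S\<close>. In that of the inverse of \<open>\<rho>\<close> the dual of \<open>Y\<close> is a left comodule of the coopposite
  coalgebra and the element of \<open>H\<close> acts through \<open>S\<close> inverse; \<open>crossing_inverse\<close> applies once more,
  now with a coproduct twisted twice by the inverse braiding, and the inverse is the action
  through the square of \<open>S\<close> inverse.

  \<^emph>\<open>The right-handed case.\<close> Turning all diagrams by a half turn, that is reversing composition and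
  tensor product simultaneously, exchanges \<open>\<mu>\<close> with \<open>\<Delta>\<close>, the action with the coaction, and the
  evaluation with the coevaluation. It preserves braidings and partial transposes, and turns right
  Yetter-Drinfel'd objects into left ones and \<open>rho_R\<close> into \<open>rho_L\<close>.

  The equations between composite arrows are proved by rewriting string diagrams, which are
  encoded as lists of boxes that are read from the source to the target.
\<close>

section \<open>String diagrams in a strict monoidal category\<close>

context small_category
begin

lemma hom_iff: "f \<in> hom C A B \<longleftrightarrow> f \<in> Arr C \<and> Dom C f = A \<and> Cod C f = B"
  by (simp add: hom_def)

lemma arr_id: "A \<in> Obj C \<Longrightarrow> \<one> A \<in> Arr C" "A \<in> Obj C \<Longrightarrow> Dom C (\<one> A) = A"
  "A \<in> Obj C \<Longrightarrow> Cod C (\<one> A) = A"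
  using id_hom[of A] by (auto simp: hom_iff)

lemma arr_comp:
  assumes "f \<in> Arr C" "g \<in> Arr C" "Dom C g = Cod C f"
  shows "g \<cdot> f \<in> Arr C" "Dom C (g \<cdot> f) = Dom C f" "Cod C (g \<cdot> f) = Cod C g"
  using comp_hom[of f "Dom C f" "Cod C f" g "Cod C g"] assms by (auto simp: hom_iff)

lemma comp_assoc_arr:
  assumes "f \<in> Arr C" "g \<in> Arr C" "h \<in> Arr C" "Dom C g = Cod C f" "Dom C h = Cod C g"
  shows "(h \<cdot> g) \<cdot> f = h \<cdot> (g \<cdot> f)"
  using comp_assoc[of f "Dom C f" "Cod C f" g "Cod C g" h "Cod C h"] assms by (auto simp: hom_iff)

lemma comp_id_arr:
  "f \<in> Arr C \<Longrightarrow> Cod C f = A \<Longrightarrow> \<one> A \<cdot> f = f"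
  "f \<in> Arr C \<Longrightarrow> Dom C f = A \<Longrightarrow> f \<cdot> \<one> A = f"
  using comp_id_left[of f "Dom C f" "Cod C f"] comp_id_right[of f "Dom C f" "Cod C f"]
  by (auto simp: hom_iff)

lemma inverse_unique:
  assumes "is_inverse C f g" "is_inverse C f g'"
  shows "g = g'"
proof -
  have "g = g \<cdot> (f \<cdot> g')"
    using assms by (simp add: is_inverse_def hom_iff comp_id_arr)
  also have "\<dots> = (g \<cdot> f) \<cdot> g'"
    by (rule comp_assoc_arr[symmetric]) (use assms in \<open>auto simp: is_inverse_def hom_iff\<close>)
  also have "\<dots> = g'"
    using assms by (simp add: is_inverse_def hom_iff comp_id_arr)
  finally show ?thesis .
qed

lemma inverse_arr_eq: "is_inverse C f g \<Longrightarrow> inverse_arr C f = g"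
  unfolding inverse_arr_def by (blast intro: inverse_unique)

lemma is_inverse_inverse_arr: "invertible C f \<Longrightarrow> is_inverse C f (inverse_arr C f)"
  unfolding invertible_def using inverse_arr_eq by auto

end

text \<open>
  A box is an arrow together with factorisations of its source and target into words of objects,
  the wires. The words are recorded because the number of wires decides where the later boxes of
  a diagram are attached, and an object does not determine a factorisation.

  A diagram lists its boxes in the order in which they are applied, each with the number of wires
  that pass it on the left.
\<close>

type_synonym ('o, 'm) box = "'o list \<times> 'm \<times> 'o list"
type_synonym ('o, 'm) diagram = "(nat \<times> ('o, 'm) box) list"

context strict_monoidal_category
begin

lemma arr_tensor:
  assumes "f \<in> Arr C" "g \<in> Arr C"
  shows "f \<otimes> g \<in> Arr C" "Dom C (f \<otimes> g) = Dom C f \<odot> Dom C g"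
    "Cod C (f \<otimes> g) = Cod C f \<odot> Cod C g"
  using tensor_hom[of f "Dom C f" "Cod C f" g "Dom C g" "Cod C g"] assms by (auto simp: hom_iff)

lemma interchange_arr:
  assumes "f \<in> Arr C" "g \<in> Arr C" "f' \<in> Arr C" "g' \<in> Arr C"
    "Dom C g = Cod C f" "Dom C g' = Cod C f'"
  shows "(g \<otimes> g') \<cdot> (f \<otimes> f') = g \<cdot> f \<otimes> g' \<cdot> f'"
  using tensor_comp[of f "Dom C f" "Cod C f" g "Cod C g" f' "Dom C f'" "Cod C f'" g' "Cod C g'"]
    assms by (auto simp: hom_iff)

lemmas arrow_simps = arr_id arr_comp arr_tensor dom_obj cod_obj unit_obj tensor_obj
  comp_id_arr unit_left_obj unit_right_obj unit_left_arr unit_right_arr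

primrec tens :: "'a list \<Rightarrow> 'a" where
  "tens [] = \<I>"
| "tens (A # w) = A \<odot> tens w"

lemma tens_obj: "set w \<subseteq> Obj C \<Longrightarrow> tens w \<in> Obj C"
  by (induction w) (auto simp: unit_obj tensor_obj)

lemma tens_append:
  "set v \<subseteq> Obj C \<Longrightarrow> set w \<subseteq> Obj C \<Longrightarrow> tens (v @ w) = tens v \<odot> tens w"
  by (induction v) (auto simp: unit_left_obj tens_obj tensor_assoc_obj)

definition is_box :: "('a, 'b) box \<Rightarrow> bool" where
  "is_box = (\<lambda>(us, f, vs). set us \<subseteq> Obj C \<and> set vs \<subseteq> Obj C \<and> f \<in> hom C (tens us) (tens vs))"

fun well_formed :: "'a list \<Rightarrow> ('a, 'b) diagram \<Rightarrow> bool" where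
  "well_formed w [] \<longleftrightarrow> set w \<subseteq> Obj C"
| "well_formed w ((n, us, f, vs) # d) \<longleftrightarrow>
     set w \<subseteq> Obj C \<and> is_box (us, f, vs) \<and> n \<le> length w \<and> take (length us) (drop n w) = us \<and>
     well_formed (take n w @ vs @ drop (n + length us) w) d"

fun tgt :: "'a list \<Rightarrow> ('a, 'b) diagram \<Rightarrow> 'a list" where
  "tgt w [] = w"
| "tgt w ((n, us, f, vs) # d) = tgt (take n w @ vs @ drop (n + length us) w) d"

fun val :: "'a list \<Rightarrow> ('a, 'b) diagram \<Rightarrow> 'b" where
  "val w [] = \<one> (tens w)"
| "val w ((n, us, f, vs) # d) =
     val (take n w @ vs @ drop (n + length us) w) d \<cdot>
     (\<one> (tens (take n w)) \<otimes> (f \<otimes> \<one> (tens (drop (n + length us) w))))"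

fun shift :: "nat \<Rightarrow> (nat \<times> 'c) list \<Rightarrow> (nat \<times> 'c) list" where
  "shift k [] = []"
| "shift k ((n, b) # d) = (k + n, b) # shift k d"

lemma is_boxD:
  assumes "is_box (us, f, vs)"
  shows "set us \<subseteq> Obj C" "set vs \<subseteq> Obj C" "f \<in> Arr C" "Dom C f = tens us" "Cod C f = tens vs"
  using assms by (auto simp: is_box_def hom_iff)

lemma well_obj: "well_formed w d \<Longrightarrow> set w \<subseteq> Obj C"
  by (cases d) auto

lemma well_Cons:
  "well_formed w ((n, us, f, vs) # d) \<longleftrightarrow>
     (\<exists>p q. w = p @ us @ q \<and> length p = n \<and> set p \<subseteq> Obj C \<and> set q \<subseteq> Obj C \<and> is_box (us, f, vs) \<and>
       well_formed (p @ vs @ q) d)" (is "?L \<longleftrightarrow> ?R")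
proof
  assume L: ?L
  have "w = take n w @ take (length us) (drop n w) @ drop (n + length us) w"
    by (metis append_take_drop_id drop_drop add.commute)
  then have "w = take n w @ us @ drop (n + length us) w" using L by simp
  moreover have "set (take n w) \<subseteq> Obj C" "set (drop (n + length us) w) \<subseteq> Obj C"
    using L set_take_subset set_drop_subset by fastforce+
  ultimately show ?R using L by (intro exI[of _ "take n w"] exI[of _ "drop (n + length us) w"]) auto
next
  assume ?R
  then show ?L by (auto simp: is_box_def)
qed

lemma tgt_Cons: "tgt (p @ us @ q) ((length p, us, f, vs) # d) = tgt (p @ vs @ q) d"
  by simp

lemma val_Cons: "val (p @ us @ q) ((length p, us, f, vs) # d) =
    val (p @ vs @ q) d \<cdot> (\<one> (tens p) \<otimes> (f \<otimes> \<one> (tens q)))"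
  by simp

lemma slice_arr:
  assumes "is_box (us, f, vs)" "set p \<subseteq> Obj C" "set q \<subseteq> Obj C"
  shows "\<one> (tens p) \<otimes> (f \<otimes> \<one> (tens q)) \<in> Arr C"
    "Dom C (\<one> (tens p) \<otimes> (f \<otimes> \<one> (tens q))) = tens (p @ us @ q)"
    "Cod C (\<one> (tens p) \<otimes> (f \<otimes> \<one> (tens q))) = tens (p @ vs @ q)"
  using assms is_boxD[OF assms(1)] by (auto simp: arrow_simps tens_append tens_obj)

lemma val_arr:
  "well_formed w d \<Longrightarrow> val w d \<in> Arr C \<and> Dom C (val w d) = tens w \<and> Cod C (val w d) = tens (tgt w d)
     \<and> set (tgt w d) \<subseteq> Obj C"
proof (induction d arbitrary: w)
  case Nil
  then show ?case by (auto simp: arrow_simps tens_obj)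
next
  case (Cons b d)
  obtain n us f vs where b: "b = (n, us, f, vs)" by (cases b)
  from Cons.prems[unfolded b well_Cons] obtain p q where
    *: "w = p @ us @ q" "length p = n" "set p \<subseteq> Obj C" "set q \<subseteq> Obj C" "is_box (us, f, vs)"
      "well_formed (p @ vs @ q) d" by blast
  from Cons.IH[OF *(6)] slice_arr[OF *(5,3,4)] show ?case
    unfolding b *(1) *(2)[symmetric] tgt_Cons val_Cons by (auto simp: arr_comp)
qed

lemma tgt_append: "tgt w (d @ e) = tgt (tgt w d) e"
  by (induction d arbitrary: w) auto

lemma well_append: "well_formed w (d @ e) \<longleftrightarrow> well_formed w d \<and> well_formed (tgt w d) e"
  by (induction d arbitrary: w) (auto dest: well_obj)

lemma val_append:
  "well_formed w (d @ e) \<Longrightarrow> val w (d @ e) = val (tgt w d) e \<cdot> val w d"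
proof (induction d arbitrary: w)
  case Nil
  then show ?case using val_arr[of w e] by (simp add: comp_id_arr)
next
  case (Cons b d)
  obtain n us f vs where b: "b = (n, us, f, vs)" by (cases b)
  from Cons.prems[unfolded b append_Cons well_Cons] obtain p q where
    *: "w = p @ us @ q" "length p = n" "set p \<subseteq> Obj C" "set q \<subseteq> Obj C" "is_box (us, f, vs)"
      "well_formed (p @ vs @ q) (d @ e)" by blast
  from *(6) have "well_formed (p @ vs @ q) d" "well_formed (tgt (p @ vs @ q) d) e" by (auto simp: well_append)
  from val_arr[OF this(1)] val_arr[OF this(2)] Cons.IH[OF *(6)] slice_arr[OF *(5,3,4)]
  show ?case
    unfolding b append_Cons *(1) *(2)[symmetric] tgt_Cons val_Cons by (auto simp: comp_assoc_arr)
qed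

text \<open>
  A diagram may be drawn with further wires on both sides; this is the source of all rewriting
  inside a larger diagram.
\<close>

lemma shift_context:
  assumes "set p \<subseteq> Obj C" "set q \<subseteq> Obj C" "well_formed u d"
  shows "well_formed (p @ u @ q) (shift (length p) d) \<and>
    tgt (p @ u @ q) (shift (length p) d) = p @ tgt u d @ q \<and>
    val (p @ u @ q) (shift (length p) d) = \<one> (tens p) \<otimes> (val u d \<otimes> \<one> (tens q))"
  using assms(3)
proof (induction d arbitrary: u)
  case Nil
  then show ?case using assms by (auto simp: tens_append tens_obj tensor_id tensor_obj)
next
  case (Cons b d)
  obtain n us f vs where b: "b = (n, us, f, vs)" by (cases b)
  from Cons.prems[unfolded b well_Cons] obtain r s where
    *: "u = r @ us @ s" "length r = n" "set r \<subseteq> Obj C" "set s \<subseteq> Obj C" "is_box (us, f, vs)"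
      "well_formed (r @ vs @ s) d" by blast
  note box = is_boxD[OF *(5)] and IH = Cons.IH[OF *(6)] and v = val_arr[OF *(6)]
  have eq: "p @ u @ q = (p @ r) @ us @ (s @ q)" "length p + n = length (p @ r)"
    using * by auto
  have IH': "well_formed ((p @ r) @ vs @ (s @ q)) (shift (length p) d)"
    "tgt ((p @ r) @ vs @ (s @ q)) (shift (length p) d) = p @ tgt (r @ vs @ s) d @ q"
    "val ((p @ r) @ vs @ (s @ q)) (shift (length p) d) =
      \<one> (tens p) \<otimes> (val (r @ vs @ s) d \<otimes> \<one> (tens q))" using IH by auto
  have w: "well_formed (p @ u @ q) (shift (length p) (b # d))"
    unfolding b shift.simps well_Cons eq
    using * assms IH' by (intro exI[of _ "p @ r"] exI[of _ "s @ q"]) auto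
  have t: "tgt (p @ u @ q) (shift (length p) (b # d)) = p @ tgt u (b # d) @ q"
    unfolding b shift.simps eq tgt_Cons IH'
    unfolding *(1) *(2)[symmetric] tgt_Cons ..
  have "\<one> (tens (p @ r)) \<otimes> (f \<otimes> \<one> (tens (s @ q))) =
      (\<one> (tens p) \<otimes> \<one> (tens r)) \<otimes> (f \<otimes> (\<one> (tens s) \<otimes> \<one> (tens q)))"
    using * assms by (simp add: tens_append tens_obj tensor_id)
  also have "\<dots> = \<one> (tens p) \<otimes> ((\<one> (tens r) \<otimes> (f \<otimes> \<one> (tens s))) \<otimes> \<one> (tens q))"
    using * assms box by (simp add: tensor_assoc_arr arrow_simps tens_obj)
  finally have "val (p @ u @ q) (shift (length p) (b # d)) =
     (\<one> (tens p) \<otimes> (val (r @ vs @ s) d \<otimes> \<one> (tens q))) \<cdot>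
     (\<one> (tens p) \<otimes> ((\<one> (tens r) \<otimes> (f \<otimes> \<one> (tens s))) \<otimes> \<one> (tens q)))"
    unfolding b shift.simps eq val_Cons IH' by simp
  also have "\<dots> = \<one> (tens p) \<otimes> (val (r @ vs @ s) d \<cdot> (\<one> (tens r) \<otimes> (f \<otimes> \<one> (tens s))) \<otimes> \<one> (tens q))"
    using v slice_arr[OF *(5,3,4)] assms
    by (simp add: interchange_arr arrow_simps tens_obj)
  also have "val (r @ vs @ s) d \<cdot> (\<one> (tens r) \<otimes> (f \<otimes> \<one> (tens s))) = val u (b # d)"
    unfolding b *(1) *(2)[symmetric] val_Cons ..
  finally show ?case using w t by simp
qed

text \<open>
  The judgement \<open>w \<turnstile> d \<approx> e\<close> contains well-formedness of both diagrams, so that rules can be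
  chained and used for rewriting without further typing conditions.
\<close>

definition deq :: "'a list \<Rightarrow> ('a, 'b) diagram \<Rightarrow>
    ('a, 'b) diagram \<Rightarrow> bool" ("(_/ \<turnstile> _/ \<approx> _)" [51, 51, 51] 50) where
  "w \<turnstile> d \<approx> e \<longleftrightarrow> well_formed w d \<and> well_formed w e \<and> tgt w d = tgt w e \<and> val w d = val w e"

lemma deq_refl: "well_formed w d \<Longrightarrow> w \<turnstile> d \<approx> d"
  by (simp add: deq_def)

lemma deq_sym: "w \<turnstile> d \<approx> e \<Longrightarrow> w \<turnstile> e \<approx> d"
  by (simp add: deq_def)

lemma deq_trans [trans]: "w \<turnstile> d \<approx> e \<Longrightarrow> w \<turnstile> e \<approx> g \<Longrightarrow> w \<turnstile> d \<approx> g"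
  by (simp add: deq_def)

lemma deq_append:
  "w \<turnstile> d \<approx> d' \<Longrightarrow> tgt w d \<turnstile> e \<approx> e' \<Longrightarrow> w \<turnstile> d @ e \<approx> d' @ e'"
  by (simp add: deq_def well_append tgt_append val_append)

lemma deq_shift:
  "u \<turnstile> d \<approx> e \<Longrightarrow> set p \<subseteq> Obj C \<Longrightarrow> set q \<subseteq> Obj C \<Longrightarrow> length p = n \<Longrightarrow>
    p @ u @ q \<turnstile> shift n d \<approx> shift n e"
  using shift_context[of p q u d] shift_context[of p q u e] by (auto simp: deq_def)

text \<open>
  Two diagrams that differ by sliding boxes past each other have the same value. To recognise
  such pairs by evaluation, \<open>nf\<close> moves each box behind all immediately following boxes that are
  attached entirely to its left.
\<close>

fun push :: "nat \<times> ('a, 'b) box \<Rightarrow> ('a, 'b) diagram \<Rightarrow>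
    ('a, 'b) diagram" where
  "push b [] = [b]"
| "push (n, us, f, vs) ((m, us', g, vs') # d) =
    (if m + length us' \<le> n
     then (m, us', g, vs') # push (n - length us' + length vs', us, f, vs) d
     else (n, us, f, vs) # (m, us', g, vs') # d)"

fun nf :: "('a, 'b) diagram \<Rightarrow> ('a, 'b) diagram" where
  "nf [] = []"
| "nf (b # d) = push b (nf d)"

text \<open>
  Both sides are the tensor product of \<open>g\<close> and \<open>f\<close> with identities, by the interchange law.
\<close>

lemma swap_slices_words:
  assumes bx: "is_box (us, f, vs)" "is_box (us', g, vs')"
    and ob: "set r \<subseteq> Obj C" "set t \<subseteq> Obj C" "set q \<subseteq> Obj C"
  shows "r @ us' @ t @ us @ q \<turnstile>
      [(length r + length us' + length t, us, f, vs), (length r, us', g, vs')] \<approx>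
      [(length r, us', g, vs'), (length r + length vs' + length t, us, f, vs)]"
proof -
  note obj = ob is_boxD[OF bx(1)] is_boxD[OF bx(2)]
  have "\<one> (tens (r @ vs' @ t @ vs @ q)) \<cdot> (\<one> (tens r) \<otimes> (g \<otimes> \<one> (tens (t @ vs @ q))))
      \<cdot> (\<one> (tens (r @ us' @ t)) \<otimes> (f \<otimes> \<one> (tens q))) =
     \<one> (tens (r @ vs' @ t @ vs @ q)) \<cdot> (\<one> (tens (r @ vs' @ t)) \<otimes> (f \<otimes> \<one> (tens q)))
      \<cdot> (\<one> (tens r) \<otimes> (g \<otimes> \<one> (tens (t @ us @ q))))"
    using obj
    by (simp add: tens_append tensor_id[symmetric] tens_obj arrow_simps tensor_assoc_arr
      interchange_arr tensor_assoc_obj)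
  then show ?thesis using bx obj by (simp add: deq_def)
qed

lemma swap_slices:
  assumes "well_formed w [(n, us, f, vs), (m, us', g, vs')]" "m + length us' \<le> n"
  shows "w \<turnstile> [(n, us, f, vs), (m, us', g, vs')] \<approx>
    [(m, us', g, vs'), (n - length us' + length vs', us, f, vs)]"
proof -
  from assms(1)[unfolded well_Cons[of w]] obtain p q where
    1: "w = p @ us @ q" "length p = n" "set p \<subseteq> Obj C" "set q \<subseteq> Obj C" "is_box (us, f, vs)"
      "well_formed (p @ vs @ q) [(m, us', g, vs')]" by blast
  from 1(6)[unfolded well_Cons] obtain r s where
    2: "p @ vs @ q = r @ us' @ s" "length r = m" "set r \<subseteq> Obj C" "is_box (us', g, vs')"
    by blast
  define t where "t = drop (m + length us') p"
  have "r @ us' = take (m + length us') (p @ vs @ q)" using 2 by simp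
  also have "\<dots> = take (m + length us') p" using assms(2) 1 by simp
  finally have p: "p = (r @ us') @ t"
    unfolding t_def by (metis append_take_drop_id)
  have "set t \<subseteq> Obj C" using 1 p by auto
  moreover have "n = length r + length us' + length t"
    "n - length us' + length vs' = length r + length vs' + length t"
    "w = r @ us' @ t @ us @ q"
    using 1(1,2) p by auto
  ultimately show ?thesis
    using swap_slices_words[OF 1(5) 2(4) 2(3) _ 1(4), of t] 2(2) by (simp only:)
qed

lemma push_sound: "well_formed w (b # d) \<Longrightarrow> w \<turnstile> b # d \<approx> push b d"
proof (induction d arbitrary: w b)
  case Nil
  then show ?case by (auto intro: deq_refl)
next
  case (Cons c d)
  obtain n us f vs where b: "b = (n, us, f, vs)" by (cases b)
  obtain m us' g vs' where c: "c = (m, us', g, vs')" by (cases c)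
  show ?case
  proof (cases "m + length us' \<le> n")
    case False
    then show ?thesis using Cons.prems unfolding b c by (auto intro: deq_refl)
  next
    case True
    define b' where "b' = (n - length us' + length vs', us, f, vs)"
    have wd: "well_formed w [b, c]" "well_formed (tgt w [b, c]) d"
      using Cons.prems well_append[of w "[b, c]" d] by auto
    have sw: "w \<turnstile> [b, c] \<approx> [c, b']"
      using swap_slices[OF wd(1)[unfolded b c] True] unfolding b c b'_def .
    from deq_append[OF sw deq_refl[OF wd(2)]] have 1: "w \<turnstile> b # c # d \<approx> [c] @ (b' # d)" by simp
    then have "well_formed w ([c] @ (b' # d))" by (simp only: deq_def)
    then have w2: "well_formed w [c]" "well_formed (tgt w [c]) (b' # d)" by (auto simp only: well_append)
    from deq_append[OF deq_refl[OF w2(1)] Cons.IH[OF w2(2)]]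
    have "w \<turnstile> [c] @ (b' # d) \<approx> [c] @ push b' d" .
    with 1 have "w \<turnstile> b # c # d \<approx> c # push b' d" by (auto intro: deq_trans)
    then show ?thesis using True by (simp add: b c b'_def)
  qed
qed

lemma nf_sound: "well_formed w d \<Longrightarrow> w \<turnstile> d \<approx> nf d"
proof (induction d arbitrary: w)
  case Nil
  then show ?case by (auto intro: deq_refl)
next
  case (Cons b d)
  have "well_formed w ([b] @ d)" using Cons.prems by simp
  then have wd: "well_formed w [b]" "well_formed (tgt w [b]) d" by (auto simp only: well_append)
  from deq_append[OF deq_refl[OF wd(1)] Cons.IH[OF wd(2)]]
  have 1: "w \<turnstile> b # d \<approx> b # nf d" by simp
  then have "well_formed w (b # nf d)" by (simp only: deq_def)
  from push_sound[OF this] 1 show ?case by (auto intro: deq_trans)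
qed

lemma interchange:
  assumes "well_formed w d" "well_formed w e" "nf d = nf e"
  shows "w \<turnstile> d \<approx> e"
  using nf_sound[OF assms(1)] nf_sound[OF assms(2)] assms(3) by (metis deq_sym deq_trans)

text \<open>
  A rule \<open>l \<approx> r\<close> is applied to the boxes of \<open>d\<close> from position \<open>i\<close> on, drawn with \<open>n\<close> wires to their
  left. The result is only determined up to sliding boxes, so that the next diagram of a
  calculation can be written in the form that the following rule needs. On concrete diagrams all
  side conditions are decided by evaluation.
\<close>

lemma rewrite:
  assumes rule: "u \<turnstile> l \<approx> r"
    and d: "well_formed w d" "take (length l) (drop i d) = shift n l"
    and u: "n \<le> length (tgt w (take i d))" "take (length u) (drop n (tgt w (take i d))) = u"
    and e: "well_formed w e" "nf (take i d @ shift n r @ drop (i + length l) d) = nf e"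
  shows "w \<turnstile> d \<approx> e"
proof -
  have sp: "d = take i d @ shift n l @ drop (i + length l) d"
    by (metis append_take_drop_id drop_drop add.commute d(2))
  let ?v = "tgt w (take i d)"
  have v: "?v = take n ?v @ u @ drop (n + length u) ?v"
    by (metis append_take_drop_id drop_drop add.commute u(2))
  have wd: "well_formed w (take i d)" "well_formed ?v (shift n l @ drop (i + length l) d)"
    using d(1) by (subst (asm) sp, simp only: well_append)+
  have "set ?v \<subseteq> Obj C" using wd(2) by (rule well_obj)
  then have "set (take n ?v) \<subseteq> Obj C" "set (drop (n + length u) ?v) \<subseteq> Obj C"
    using set_take_subset set_drop_subset by fastforce+
  from deq_shift[OF rule this] u(1) v have 1: "?v \<turnstile> shift n l \<approx> shift n r" by simp
  have "well_formed (tgt ?v (shift n l)) (drop (i + length l) d)" using wd(2) by (simp only: well_append)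
  from deq_append[OF deq_refl[OF wd(1)] deq_append[OF 1 deq_refl[OF this]]]
  have "w \<turnstile> d \<approx> take i d @ shift n r @ drop (i + length l) d" using sp by simp
  moreover from this interchange[OF _ e(1) e(2)]
  have "w \<turnstile> take i d @ shift n r @ drop (i + length l) d \<approx> e" by (simp only: deq_def)
  ultimately show ?thesis by (rule deq_trans)
qed

text \<open>
  Contracting a diagram to a single box makes naturality of the braiding and the other lemmas
  about single boxes applicable to composites.
\<close>

lemma box_of_diagram:
  assumes "well_formed w d"
  shows "is_box (w, val w d, tgt w d)" "w \<turnstile> [(0, w, val w d, tgt w d)] \<approx> d"
proof -
  show bx: "is_box (w, val w d, tgt w d)"
    using val_arr[OF assms] well_obj[OF assms] by (auto simp: is_box_def hom_iff)
  show "w \<turnstile> [(0, w, val w d, tgt w d)] \<approx> d"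
    using bx assms val_arr[OF assms] well_obj[OF assms]
    by (auto simp: deq_def arrow_simps)
qed

lemma is_inverse_val:
  assumes "w \<turnstile> d @ e \<approx> []" "tgt w d \<turnstile> e @ d \<approx> []"
  shows "is_inverse C (val w d) (val (tgt w d) e)"
  using assms val_arr[of w d] val_arr[of "tgt w d" e]
  by (auto simp: deq_def is_inverse_def hom_iff well_append val_append tgt_append)

section \<open>Braidings\<close>

text \<open>
  A predicate on families of arrows, because it is applied both to the given braiding and to its
  inverse.
\<close>

definition is_braiding :: "('a \<Rightarrow> 'a \<Rightarrow> 'b) \<Rightarrow> bool" where
  "is_braiding \<beta> \<longleftrightarrow>
     (\<forall>A \<in> Obj C. \<forall>B \<in> Obj C. \<beta> A B \<in> hom C (A \<odot> B) (B \<odot> A)) \<and>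
     (\<forall>A \<in> Obj C. \<beta> A \<I> = \<one> A \<and> \<beta> \<I> A = \<one> A) \<and>
     (\<forall>A B A' B' f g. f \<in> hom C A B \<longrightarrow> g \<in> hom C A' B' \<longrightarrow>
        \<beta> B B' \<cdot> (f \<otimes> g) = (g \<otimes> f) \<cdot> \<beta> A A') \<and>
     (\<forall>A \<in> Obj C. \<forall>B \<in> Obj C. \<forall>E \<in> Obj C.
        \<beta> (A \<odot> B) E = (\<beta> A E \<otimes> \<one> B) \<cdot> (\<one> A \<otimes> \<beta> B E) \<and>
        \<beta> A (B \<odot> E) = (\<one> B \<otimes> \<beta> A E) \<cdot> (\<beta> A B \<otimes> \<one> E))"

text \<open>
  In \<open>over\<close> the wire \<open>E\<close> crosses the wires of a word from right to left, in \<open>under\<close> from left to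
  right. By the hexagon identities the values are the components of the braiding at the tensor
  product of the word.
\<close>

primrec over :: "('a \<Rightarrow> 'a \<Rightarrow> 'b) \<Rightarrow> 'a list \<Rightarrow> 'a \<Rightarrow> ('a, 'b) diagram" where
  "over \<beta> [] E = []"
| "over \<beta> (A # w) E = shift 1 (over \<beta> w E) @ [(0, [A, E], \<beta> A E, [E, A])]"

primrec under :: "('a \<Rightarrow> 'a \<Rightarrow> 'b) \<Rightarrow> 'a \<Rightarrow> 'a list \<Rightarrow> ('a, 'b) diagram" where
  "under \<beta> E [] = []"
| "under \<beta> E (A # w) = (0, [E, A], \<beta> E A, [A, E]) # shift 1 (under \<beta> E w)"

lemma is_box_braiding:
  "is_braiding \<beta> \<Longrightarrow> A \<in> Obj C \<Longrightarrow> B \<in> Obj C \<Longrightarrow> is_box ([A, B], \<beta> A B, [B, A])"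
  by (simp add: is_braiding_def is_box_def unit_right_obj)

lemma over_val:
  assumes "is_braiding \<beta>" "set w \<subseteq> Obj C" "E \<in> Obj C"
  shows "well_formed (w @ [E]) (over \<beta> w E) \<and> tgt (w @ [E]) (over \<beta> w E) = E # w \<and>
    val (w @ [E]) (over \<beta> w E) = \<beta> (tens w) E"
  using assms(2)
proof (induction w)
  case Nil
  then show ?case using assms by (auto simp: is_braiding_def unit_right_obj)
next
  case (Cons A w)
  then have obj: "A \<in> Obj C" "set w \<subseteq> Obj C" "E \<in> Obj C" using assms by auto
  note IH = Cons.IH[OF obj(2)]
  note b = is_box_braiding[OF assms(1) obj(1) obj(3)]
  from shift_context[of "[A]" "[]" "w @ [E]" "over \<beta> w E"] IH obj
  have 1: "well_formed ((A # w) @ [E]) (shift 1 (over \<beta> w E))"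
    "tgt ((A # w) @ [E]) (shift 1 (over \<beta> w E)) = A # E # w"
    "val ((A # w) @ [E]) (shift 1 (over \<beta> w E)) = \<one> A \<otimes> (\<beta> (tens w) E \<otimes> \<one> \<I>)"
    by (simp_all add: unit_right_obj)
  have 2: "well_formed (A # E # w) [(0, [A, E], \<beta> A E, [E, A])]"
    "val (A # E # w) [(0, [A, E], \<beta> A E, [E, A])] = \<beta> A E \<otimes> \<one> (tens w)"
    using b is_boxD[OF b] obj by (auto simp: tens_obj arrow_simps tensor_assoc_obj)
  have 3: "\<beta> (tens w) E \<in> hom C (tens w \<odot> E) (E \<odot> tens w)"
    "\<beta> (A \<odot> tens w) E = (\<beta> A E \<otimes> \<one> (tens w)) \<cdot> (\<one> A \<otimes> \<beta> (tens w) E)"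
    using assms(1) obj by (auto simp: is_braiding_def tens_obj)
  have w: "well_formed ((A # w) @ [E]) (shift 1 (over \<beta> w E) @ [(0, [A, E], \<beta> A E, [E, A])])"
    using 1 2 by (simp only: well_append)
  show ?case
    unfolding over.simps val_append[OF w] tgt_append 1 2 using w 3
    by (simp add: hom_iff unit_right_arr)
qed

lemma under_val:
  assumes "is_braiding \<beta>" "set w \<subseteq> Obj C" "E \<in> Obj C"
  shows "well_formed (E # w) (under \<beta> E w) \<and> tgt (E # w) (under \<beta> E w) = w @ [E] \<and>
    val (E # w) (under \<beta> E w) = \<beta> E (tens w)"
  using assms(2)
proof (induction w)
  case Nil
  then show ?case using assms by (auto simp: is_braiding_def unit_right_obj)
next
  case (Cons A w)
  then have obj: "A \<in> Obj C" "set w \<subseteq> Obj C" "E \<in> Obj C" using assms by auto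
  note IH = Cons.IH[OF obj(2)]
  note b = is_box_braiding[OF assms(1) obj(3) obj(1)]
  from shift_context[of "[A]" "[]" "E # w" "under \<beta> E w"] IH obj
  have 1: "well_formed (A # E # w) (shift 1 (under \<beta> E w))"
    "tgt (A # E # w) (shift 1 (under \<beta> E w)) = A # w @ [E]"
    "val (A # E # w) (shift 1 (under \<beta> E w)) = \<one> A \<otimes> (\<beta> E (tens w) \<otimes> \<one> \<I>)"
    by (simp_all add: unit_right_obj)
  have 2: "well_formed (E # A # w) [(0, [E, A], \<beta> E A, [A, E])]"
    "tgt (E # A # w) [(0, [E, A], \<beta> E A, [A, E])] = A # E # w"
    "val (E # A # w) [(0, [E, A], \<beta> E A, [A, E])] = \<beta> E A \<otimes> \<one> (tens w)"
    using b is_boxD[OF b] obj by (auto simp: tens_obj arrow_simps tensor_assoc_obj)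
  have 3: "\<beta> E (tens w) \<in> hom C (E \<odot> tens w) (tens w \<odot> E)"
    "\<beta> E (A \<odot> tens w) = (\<one> A \<otimes> \<beta> E (tens w)) \<cdot> (\<beta> E A \<otimes> \<one> (tens w))"
    using assms(1) obj by (auto simp: is_braiding_def tens_obj)
  have w: "well_formed (E # A # w) ([(0, [E, A], \<beta> E A, [A, E])] @ shift 1 (under \<beta> E w))"
    using 1 2 by (simp only: well_append)
  have split: "under \<beta> E (A # w) = [(0, [E, A], \<beta> E A, [A, E])] @ shift 1 (under \<beta> E w)" by simp
  show ?case
    unfolding split val_append[OF w] tgt_append 1 2 using w 3
    by (simp add: hom_iff unit_right_arr)
qed

text \<open>
  Naturality of the braiding: a box slides through a wire that crosses all of its inputs.
\<close>

lemma slide_over: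
  assumes "is_braiding \<beta>" "is_box (us, f, vs)" "E \<in> Obj C"
  shows "us @ [E] \<turnstile> [(0, us, f, vs)] @ over \<beta> vs E \<approx> over \<beta> us E @ [(1, us, f, vs)]"
proof -
  note b = is_boxD[OF assms(2)]
  note u = over_val[OF assms(1) b(1) assms(3)] and v = over_val[OF assms(1) b(2) assms(3)]
  have wl: "well_formed (us @ [E]) ([(0, us, f, vs)] @ over \<beta> vs E)"
    "well_formed (us @ [E]) (over \<beta> us E @ [(1, us, f, vs)])"
    unfolding well_append using assms b u v by auto
  have "\<beta> (tens vs) E \<cdot> (f \<otimes> \<one> E) = (\<one> E \<otimes> f) \<cdot> \<beta> (tens us) E"
    using assms by (auto simp: is_braiding_def is_box_def id_hom)
  then show ?thesis
    unfolding deq_def val_append[OF wl(1)] val_append[OF wl(2)]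
    using wl u v b assms(3) unfolding tgt_append
    by (auto simp: arrow_simps tens_obj tens_append)
qed

lemma slide_under:
  assumes "is_braiding \<beta>" "is_box (us, f, vs)" "E \<in> Obj C"
  shows "E # us \<turnstile> [(1, us, f, vs)] @ under \<beta> E vs \<approx> under \<beta> E us @ [(0, us, f, vs)]"
proof -
  note b = is_boxD[OF assms(2)]
  note u = under_val[OF assms(1) b(1) assms(3)] and v = under_val[OF assms(1) b(2) assms(3)]
  have wl: "well_formed (E # us) ([(1, us, f, vs)] @ under \<beta> E vs)"
    "well_formed (E # us) (under \<beta> E us @ [(0, us, f, vs)])"
    unfolding well_append using assms b u v by auto
  have "\<beta> E (tens vs) \<cdot> (\<one> E \<otimes> f) = (f \<otimes> \<one> E) \<cdot> \<beta> E (tens us)"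
    using assms by (auto simp: is_braiding_def is_box_def id_hom)
  then show ?thesis
    unfolding deq_def val_append[OF wl(1)] val_append[OF wl(2)]
    using wl u v b assms(3) unfolding tgt_append
    by (auto simp: arrow_simps tens_obj tens_append)
qed

end

context strict_braided_monoidal_category
begin

lemma braid_arr:
  assumes "A \<in> Obj C" "B \<in> Obj C"
  shows "\<tau> A B \<in> Arr C" "Dom C (\<tau> A B) = A \<odot> B" "Cod C (\<tau> A B) = B \<odot> A"
  using braid_hom[OF assms] by (auto simp: hom_iff)

definition inv_braid :: "'a \<Rightarrow> 'a \<Rightarrow> 'b" where
  "inv_braid A B = inverse_arr C (\<tau> B A)"

lemma inv_braid_arr:
  assumes "A \<in> Obj C" "B \<in> Obj C"
  shows "inv_braid A B \<in> Arr C" "Dom C (inv_braid A B) = A \<odot> B" "Cod C (inv_braid A B) = B \<odot> A"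
    "inv_braid A B \<cdot> \<tau> B A = \<one> (B \<odot> A)" "\<tau> B A \<cdot> inv_braid A B = \<one> (A \<odot> B)"
  using is_inverse_inverse_arr[OF braid_invertible[OF assms(2,1)]] assms
  by (auto simp: inv_braid_def is_inverse_def hom_iff braid_arr)

lemma inv_braid_eqI:
  assumes "A \<in> Obj C" "B \<in> Obj C" "g \<in> Arr C" "Dom C g = A \<odot> B" "Cod C g = B \<odot> A"
    "g \<cdot> \<tau> B A = \<one> (B \<odot> A)" "\<tau> B A \<cdot> g = \<one> (A \<odot> B)"
  shows "inv_braid A B = g"
  unfolding inv_braid_def
  by (rule inverse_arr_eq) (use assms in \<open>auto simp: is_inverse_def hom_iff braid_arr\<close>)

text \<open>
  Used for the components of the braiding at the unit object, which the hexagon identities show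
  to be idempotent.
\<close>

lemma idempotent_invertible_id:
  assumes "invertible C f" "f \<cdot> f = f" "f \<in> hom C A A"
  shows "f = \<one> A"
proof -
  obtain g where g: "is_inverse C f g" using assms(1) by (auto simp: invertible_def)
  have "f = (g \<cdot> f) \<cdot> f" using g assms(3) by (simp add: is_inverse_def hom_iff comp_id_arr)
  also have "\<dots> = g \<cdot> (f \<cdot> f)"
    by (rule comp_assoc_arr) (use g assms(3) in \<open>auto simp: is_inverse_def hom_iff\<close>)
  also have "\<dots> = \<one> A" using g assms by (simp add: is_inverse_def hom_iff)
  finally show ?thesis .
qed

lemma braid_unit:
  assumes "A \<in> Obj C"
  shows "\<tau> A \<I> = \<one> A" "\<tau> \<I> A = \<one> A"
proof -
  have "\<tau> A \<I> \<cdot> \<tau> A \<I> = \<tau> A \<I>"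
    using hexagon_right[OF assms unit_obj unit_obj] assms
    by (simp add: arrow_simps braid_arr)
  then show "\<tau> A \<I> = \<one> A"
    using idempotent_invertible_id[of "\<tau> A \<I>" A] braid_invertible[OF assms unit_obj] assms unit_obj
    by (auto simp: hom_iff braid_arr arrow_simps)
  have "\<tau> \<I> A \<cdot> \<tau> \<I> A = \<tau> \<I> A"
    using hexagon_left[OF unit_obj unit_obj assms] assms
    by (simp add: arrow_simps braid_arr)
  then show "\<tau> \<I> A = \<one> A"
    using idempotent_invertible_id[of "\<tau> \<I> A" A] braid_invertible[OF unit_obj assms] assms unit_obj
    by (auto simp: hom_iff braid_arr arrow_simps)
qed

lemma is_braiding_braid: "is_braiding \<tau>"
  unfolding is_braiding_def
  using braid_hom braid_unit braid_natural hexagon_left hexagon_right by blast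

lemma inv_braid_natural:
  assumes "f \<in> hom C A B" "g \<in> hom C A' B'"
  shows "inv_braid B B' \<cdot> (f \<otimes> g) = (g \<otimes> f) \<cdot> inv_braid A A'"
proof -
  have obj: "A \<in> Obj C" "B \<in> Obj C" "A' \<in> Obj C" "B' \<in> Obj C"
    using assms dom_obj cod_obj by (auto simp: hom_iff)
  note t = assms[unfolded hom_iff] obj braid_arr inv_braid_arr arrow_simps
  have "inv_braid B B' \<cdot> (f \<otimes> g) = inv_braid B B' \<cdot> ((f \<otimes> g) \<cdot> (\<tau> A' A \<cdot> inv_braid A A'))"
    using t by simp
  also have "\<dots> = inv_braid B B' \<cdot> (((f \<otimes> g) \<cdot> \<tau> A' A) \<cdot> inv_braid A A')"
    using t by (subst comp_assoc_arr) auto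
  also have "(f \<otimes> g) \<cdot> \<tau> A' A = \<tau> B' B \<cdot> (g \<otimes> f)"
    using braid_natural[OF assms(2,1)] by simp
  also have "inv_braid B B' \<cdot> ((\<tau> B' B \<cdot> (g \<otimes> f)) \<cdot> inv_braid A A') =
      (inv_braid B B' \<cdot> \<tau> B' B) \<cdot> ((g \<otimes> f) \<cdot> inv_braid A A')"
    using assms[unfolded hom_iff] obj braid_arr inv_braid_arr(1-3) arr_tensor arr_comp
    by (simp add: comp_assoc_arr)
  also have "\<dots> = (g \<otimes> f) \<cdot> inv_braid A A'"
    using t by simp
  finally show ?thesis .
qed

lemma inv_braid_hexagon_left:
  assumes "A \<in> Obj C" "B \<in> Obj C" "E \<in> Obj C"
  shows "inv_braid (A \<odot> B) E = (inv_braid A E \<otimes> \<one> B) \<cdot> (\<one> A \<otimes> inv_braid B E)"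
proof (rule inv_braid_eqI)
  have t: "\<tau> E (A \<odot> B) = (\<one> A \<otimes> \<tau> E B) \<cdot> (\<tau> E A \<otimes> \<one> B)" using hexagon_right assms by blast
  note ty = assms braid_arr inv_braid_arr arr_tensor arr_comp arr_id tensor_obj tensor_assoc_obj
  have "((inv_braid A E \<otimes> \<one> B) \<cdot> (\<one> A \<otimes> inv_braid B E)) \<cdot> \<tau> E (A \<odot> B) =
    (inv_braid A E \<otimes> \<one> B) \<cdot> (((\<one> A \<otimes> inv_braid B E) \<cdot> (\<one> A \<otimes> \<tau> E B)) \<cdot> (\<tau> E A \<otimes> \<one> B))"
    unfolding t using ty(1-9) ty(12-) by (simp add: comp_assoc_arr)
  also have "\<dots> = \<one> (E \<odot> (A \<odot> B))"
    using ty by (simp add: interchange_arr tensor_id arrow_simps)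
  finally show "((inv_braid A E \<otimes> \<one> B) \<cdot> (\<one> A \<otimes> inv_braid B E)) \<cdot> \<tau> E (A \<odot> B) = \<one> (E \<odot> (A \<odot> B))" .
  have "\<tau> E (A \<odot> B) \<cdot> ((inv_braid A E \<otimes> \<one> B) \<cdot> (\<one> A \<otimes> inv_braid B E)) =
    (\<one> A \<otimes> \<tau> E B) \<cdot> (((\<tau> E A \<otimes> \<one> B) \<cdot> (inv_braid A E \<otimes> \<one> B)) \<cdot> (\<one> A \<otimes> inv_braid B E))"
    unfolding t using ty(1-9) ty(12-) by (simp add: comp_assoc_arr)
  also have "\<dots> = \<one> ((A \<odot> B) \<odot> E)"
    using ty by (simp add: interchange_arr tensor_id arrow_simps)
  finally show "\<tau> E (A \<odot> B) \<cdot> ((inv_braid A E \<otimes> \<one> B) \<cdot> (\<one> A \<otimes> inv_braid B E)) = \<one> ((A \<odot> B) \<odot> E)" .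
qed (use assms in \<open>auto simp: braid_arr inv_braid_arr arr_tensor arr_comp arr_id tensor_obj tensor_assoc_obj\<close>)

lemma inv_braid_hexagon_right:
  assumes "A \<in> Obj C" "B \<in> Obj C" "E \<in> Obj C"
  shows "inv_braid A (B \<odot> E) = (\<one> B \<otimes> inv_braid A E) \<cdot> (inv_braid A B \<otimes> \<one> E)"
proof (rule inv_braid_eqI)
  have t: "\<tau> (B \<odot> E) A = (\<tau> B A \<otimes> \<one> E) \<cdot> (\<one> B \<otimes> \<tau> E A)" using hexagon_left assms by blast
  note ty = assms braid_arr inv_braid_arr arr_tensor arr_comp arr_id tensor_obj tensor_assoc_obj
  have "((\<one> B \<otimes> inv_braid A E) \<cdot> (inv_braid A B \<otimes> \<one> E)) \<cdot> \<tau> (B \<odot> E) A =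
    (\<one> B \<otimes> inv_braid A E) \<cdot> (((inv_braid A B \<otimes> \<one> E) \<cdot> (\<tau> B A \<otimes> \<one> E)) \<cdot> (\<one> B \<otimes> \<tau> E A))"
    unfolding t using ty(1-9) ty(12-) by (simp add: comp_assoc_arr)
  also have "\<dots> = \<one> ((B \<odot> E) \<odot> A)"
    using ty by (simp add: interchange_arr tensor_id arrow_simps)
  finally show "((\<one> B \<otimes> inv_braid A E) \<cdot> (inv_braid A B \<otimes> \<one> E)) \<cdot> \<tau> (B \<odot> E) A = \<one> ((B \<odot> E) \<odot> A)" .
  have "\<tau> (B \<odot> E) A \<cdot> ((\<one> B \<otimes> inv_braid A E) \<cdot> (inv_braid A B \<otimes> \<one> E)) =
    (\<tau> B A \<otimes> \<one> E) \<cdot> (((\<one> B \<otimes> \<tau> E A) \<cdot> (\<one> B \<otimes> inv_braid A E)) \<cdot> (inv_braid A B \<otimes> \<one> E))"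
    unfolding t using ty(1-9) ty(12-) by (simp add: comp_assoc_arr)
  also have "\<dots> = \<one> (A \<odot> (B \<odot> E))"
    using ty by (simp add: interchange_arr tensor_id arrow_simps)
  finally show "\<tau> (B \<odot> E) A \<cdot> ((\<one> B \<otimes> inv_braid A E) \<cdot> (inv_braid A B \<otimes> \<one> E)) = \<one> (A \<odot> (B \<odot> E))" .
qed (use assms in \<open>auto simp: braid_arr inv_braid_arr arr_tensor arr_comp arr_id tensor_obj tensor_assoc_obj\<close>)

lemma is_braiding_inv_braid: "is_braiding inv_braid"
proof -
  have "inv_braid A \<I> = \<one> A" "inv_braid \<I> A = \<one> A" if "A \<in> Obj C" for A
    by (rule inv_braid_eqI; use that in \<open>simp add: arrow_simps braid_unit\<close>)+
  moreover have "inv_braid A B \<in> hom C (A \<odot> B) (B \<odot> A)" if "A \<in> Obj C" "B \<in> Obj C" for A B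
    using inv_braid_arr that by (simp add: hom_iff)
  ultimately show ?thesis
    unfolding is_braiding_def
    using inv_braid_natural inv_braid_hexagon_left inv_braid_hexagon_right by blast
qed

text \<open>
  The inverse crossing \<open>X' A B\<close> has the same source and target as \<open>X A B\<close>; its inverse is \<open>X B A\<close>.
\<close>

abbreviation X :: "'a \<Rightarrow> 'a \<Rightarrow> ('a, 'b) box" where
  "X A B \<equiv> ([A, B], \<tau> A B, [B, A])"

abbreviation X' :: "'a \<Rightarrow> 'a \<Rightarrow> ('a, 'b) box" where
  "X' A B \<equiv> ([A, B], inv_braid A B, [B, A])"

lemma is_box_X:
  "A \<in> Obj C \<Longrightarrow> B \<in> Obj C \<Longrightarrow> is_box (X A B)"
  "A \<in> Obj C \<Longrightarrow> B \<in> Obj C \<Longrightarrow> is_box (X' A B)"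
  using is_box_braiding is_braiding_braid is_braiding_inv_braid by blast+

lemma X_X':
  assumes "A \<in> Obj C" "B \<in> Obj C"
  shows "[A, B] \<turnstile> [(0, X A B), (0, X' B A)] \<approx> []" "[A, B] \<turnstile> [(0, X' A B), (0, X B A)] \<approx> []"
  using assms is_box_X by (auto simp: deq_def inv_braid_arr braid_arr arrow_simps)

lemmas over_X = slide_over[OF is_braiding_braid]
lemmas over_X' = slide_over[OF is_braiding_inv_braid]
lemmas under_X = slide_under[OF is_braiding_braid]
lemmas under_X' = slide_under[OF is_braiding_inv_braid]

lemmas diagram_simps = numeral_eq_Suc is_box_X

section \<open>Coactions and crossings\<close>

text \<open>
  Letting the wire \<open>H\<close> of a left coaction \<open>K\<close> cross to the right by the inverse braiding gives a
  right coaction of the coopposite coalgebra, whose coproduct is \<open>W\<close> followed by the inverse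
  crossing. With the inverse braiding, this crossing cancels one that arises in \<open>crossing_factor\<close>.
\<close>

lemma right_coaction_coassoc:
  fixes H Y k w
  defines "K \<equiv> ([Y], k, [H, Y])" and "W \<equiv> ([H], w, [H, H])"
  assumes bx: "H \<in> Obj C" "Y \<in> Obj C" "is_box K" "is_box W"
    and coassoc: "[Y] \<turnstile> [(0, K), (1, K)] \<approx> [(0, K), (0, W)]"
  shows "[Y] \<turnstile> [(0, K), (0, X' H Y), (0, K), (0, X' H Y)] \<approx> [(0, K), (0, X' H Y), (1, W), (1, X' H H)]"
proof -
  note [simp] = diagram_simps bx[unfolded K_def W_def] K_def W_def
  have "[Y] \<turnstile> [(0, K), (0, X' H Y), (0, K), (0, X' H Y)] \<approx>
     [(0, K), (1, K), (0, X' H H), (1, X' H Y), (0, X' H Y)]"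
    by (rule rewrite[OF under_X'[OF bx(3)[unfolded K_def] bx(1), THEN deq_sym], where i=1 and n=0]) simp_all
  also have "[Y] \<turnstile> \<dots> \<approx> [(0, K), (0, W), (0, X' H H), (1, X' H Y), (0, X' H Y)]"
    by (rule rewrite[OF coassoc, where i=0 and n=0]) simp_all
  also have "[Y] \<turnstile> \<dots> \<approx> [(0, K), (0, W), (1, X' H Y), (0, X' H Y), (1, X' H H)]"
    by (rule rewrite[OF over_X'[OF is_box_X(2)[OF bx(1,1)] bx(2)], where i=2 and n=0]) simp_all
  also have "[Y] \<turnstile> \<dots> \<approx> [(0, K), (0, X' H Y), (1, W), (1, X' H H)]"
    by (rule rewrite[OF over_X'[OF bx(4)[unfolded W_def] bx(2)], where i=1 and n=0]) simp_all
  finally show ?thesis .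
qed

lemma right_coaction_counit:
  fixes H Y k e
  defines "K \<equiv> ([Y], k, [H, Y])" and "E \<equiv> ([H], e, [])"
  assumes bx: "H \<in> Obj C" "Y \<in> Obj C" "is_box K" "is_box E"
    and counit: "[Y] \<turnstile> [(0, K), (0, E)] \<approx> []"
  shows "[Y] \<turnstile> [(0, K), (0, X' H Y), (1, E)] \<approx> []"
proof -
  note [simp] = diagram_simps bx[unfolded K_def E_def] K_def E_def
  have "[Y] \<turnstile> [(0, K), (0, X' H Y), (1, E)] \<approx> [(0, K), (0, E)]"
    by (rule rewrite[OF over_X'[OF bx(4)[unfolded E_def] bx(2), THEN deq_sym], where i=1 and n=0]) simp_all
  also note counit
  finally show ?thesis .
qed

text \<open>
  In elements, the first arrow sends \<open>y \<otimes> a\<close> to \<open>y\<^sub>0 \<otimes> F (y\<^sub>1 \<otimes> a)\<close> for the right coaction derived from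
  \<open>K\<close>. By coassociativity the composite with the second such arrow is given by the convolution of
  \<open>F\<close> and \<open>G\<close>, here assumed to be the counit.
\<close>

lemma left_convolution:
  fixes H Y A k w e f g
  defines "K \<equiv> ([Y], k, [H, Y])" and "W \<equiv> ([H], w, [H, H])" and "E \<equiv> ([H], e, [])"
    and "F \<equiv> ([H, A], f, [A])" and "G \<equiv> ([H, A], g, [A])"
  assumes bx: "H \<in> Obj C" "Y \<in> Obj C" "A \<in> Obj C" "is_box K" "is_box W" "is_box E" "is_box F" "is_box G"
    and coassoc: "[Y] \<turnstile> [(0, K), (1, K)] \<approx> [(0, K), (0, W)]"
    and counit: "[Y] \<turnstile> [(0, K), (0, E)] \<approx> []"
    and conv: "[H, A] \<turnstile> [(0, W), (0, X' H H), (1, F), (0, G)] \<approx> [(0, E)]"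
  shows "[Y, A] \<turnstile> [(0, K), (0, X' H Y), (1, F), (0, K), (0, X' H Y), (1, G)] \<approx> []"
proof -
  note [simp] = diagram_simps bx[unfolded K_def W_def E_def F_def G_def] K_def W_def E_def F_def G_def
  note coassoc' = right_coaction_coassoc[OF bx(1,2,4,5)[unfolded K_def W_def] coassoc[unfolded K_def W_def]]
  note counit' = right_coaction_counit[OF bx(1,2,4,6)[unfolded K_def E_def] counit[unfolded K_def E_def]]
  have "[Y, A] \<turnstile> [(0, K), (0, X' H Y), (1, F), (0, K), (0, X' H Y), (1, G)] \<approx>
      [(0, K), (0, X' H Y), (0, K), (0, X' H Y), (2, F), (1, G)]"
    by (rule interchange) simp_all
  also have "[Y, A] \<turnstile> \<dots> \<approx> [(0, K), (0, X' H Y), (1, W), (1, X' H H), (2, F), (1, G)]"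
    by (rule rewrite[OF coassoc', where i=0 and n=0]) simp_all
  also have "[Y, A] \<turnstile> \<dots> \<approx> [(0, K), (0, X' H Y), (1, E)]"
    by (rule rewrite[OF conv, where i=2 and n=1]) simp_all
  also have "[Y, A] \<turnstile> \<dots> \<approx> []"
    by (rule rewrite[OF counit', where i=0 and n=0]) simp_all
  finally show ?thesis .
qed

text \<open>
  The box \<open>F\<close> slides through the crossing of \<open>Y\<close> over its output; the crossing over \<open>H\<close> that this
  creates cancels the inverse crossing.
\<close>

lemma crossing_factor:
  fixes H Y A k f
  defines "K \<equiv> ([Y], k, [H, Y])" and "F \<equiv> ([H, A], f, [A])"
  assumes bx: "H \<in> Obj C" "Y \<in> Obj C" "A \<in> Obj C" "is_box K" "is_box F"
  shows "[Y, A] \<turnstile> [(0, K), (1, X Y A), (0, F)] \<approx> [(0, K), (0, X' H Y), (1, F), (0, X Y A)]"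
proof -
  note [simp] = diagram_simps bx[unfolded K_def F_def] K_def F_def
  have "[Y, A] \<turnstile> [(0, K), (0, X' H Y), (1, F), (0, X Y A)] \<approx>
      [(0, K), (0, X' H Y), (0, X Y H), (1, X Y A), (0, F)]"
    by (rule rewrite[OF under_X[OF bx(5)[unfolded F_def] bx(2)], where i=2 and n=0]) simp_all
  also have "[Y, A] \<turnstile> \<dots> \<approx> [(0, K), (1, X Y A), (0, F)]"
    by (rule rewrite[OF X_X'(2)[OF bx(1,2)], where i=1 and n=0]) simp_all
  finally show ?thesis by (rule deq_sym)
qed

text \<open>
  The coproduct \<open>W\<close> is an arbitrary box because the lemma is applied both to the coproduct of a
  Hopf algebra and to the coopposite one, which coacts on the dual of a module.
\<close>

lemma crossing_inverse:
  fixes H Y A k w e f g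
  defines "K \<equiv> ([Y], k, [H, Y])" and "W \<equiv> ([H], w, [H, H])" and "E \<equiv> ([H], e, [])"
    and "F \<equiv> ([H, A], f, [A])" and "G \<equiv> ([H, A], g, [A])"
  assumes bx: "H \<in> Obj C" "Y \<in> Obj C" "A \<in> Obj C" "is_box K" "is_box W" "is_box E" "is_box F" "is_box G"
    and coassoc: "[Y] \<turnstile> [(0, K), (1, K)] \<approx> [(0, K), (0, W)]"
    and counit: "[Y] \<turnstile> [(0, K), (0, E)] \<approx> []"
    and FG: "[H, A] \<turnstile> [(0, W), (0, X' H H), (1, F), (0, G)] \<approx> [(0, E)]"
    and GF: "[H, A] \<turnstile> [(0, W), (0, X' H H), (1, G), (0, F)] \<approx> [(0, E)]"
  shows "is_inverse C (val [Y, A] [(0, K), (1, X Y A), (0, F)])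
      (val [A, Y] [(0, X' A Y), (0, K), (0, X' H Y), (1, G)])"
proof -
  note defs = K_def W_def E_def F_def G_def
  note [simp] = diagram_simps bx[unfolded defs] defs
  note factor = crossing_factor[OF bx(1-4,7)[unfolded defs]]
  note FG' = left_convolution[OF bx[unfolded defs] coassoc[unfolded defs] counit[unfolded defs] FG[unfolded defs]]
  note GF' = left_convolution[OF bx(1-6,8,7)[unfolded defs] coassoc[unfolded defs] counit[unfolded defs] GF[unfolded defs]]
  have "[Y, A] \<turnstile> [(0, K), (1, X Y A), (0, F), (0, X' A Y), (0, K), (0, X' H Y), (1, G)] \<approx>
      [(0, K), (0, X' H Y), (1, F), (0, X Y A), (0, X' A Y), (0, K), (0, X' H Y), (1, G)]"
    by (rule rewrite[OF factor, where i=0 and n=0]) simp_all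
  also have "[Y, A] \<turnstile> \<dots> \<approx> [(0, K), (0, X' H Y), (1, F), (0, K), (0, X' H Y), (1, G)]"
    by (rule rewrite[OF X_X'(1)[OF bx(2,3)], where i=3 and n=0]) simp_all
  also have "[Y, A] \<turnstile> \<dots> \<approx> []" using FG' by simp
  finally have 1: "[Y, A] \<turnstile> [(0, K), (1, X Y A), (0, F)] @ [(0, X' A Y), (0, K), (0, X' H Y), (1, G)] \<approx> []"
    by simp
  have "[A, Y] \<turnstile> [(0, X' A Y), (0, K), (0, X' H Y), (1, G), (0, K), (1, X Y A), (0, F)] \<approx>
      [(0, X' A Y), (0, K), (0, X' H Y), (1, G), (0, K), (0, X' H Y), (1, F), (0, X Y A)]"
    by (rule rewrite[OF factor, where i=4 and n=0]) simp_all
  also have "[A, Y] \<turnstile> \<dots> \<approx> [(0, X' A Y), (0, X Y A)]"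
    by (rule rewrite[OF GF', where i=1 and n=0]) simp_all
  also have "[A, Y] \<turnstile> \<dots> \<approx> []" using X_X'(2)[OF bx(3,2)] by simp
  finally have 2: "[A, Y] \<turnstile> [(0, X' A Y), (0, K), (0, X' H Y), (1, G)] @ [(0, K), (1, X Y A), (0, F)] \<approx> []"
    by simp
  show ?thesis
    using is_inverse_val[OF 1] 2 by simp
qed

end

section \<open>The antipode of a braided Hopf algebra\<close>

locale hopf_algebra = strict_braided_monoidal_category C
  for C :: "('o, 'm) bm_cat" (structure) +
  fixes H :: 'o and \<mu> \<eta> \<Delta> \<epsilon> S :: 'm
  assumes hopf: "hopf_object C H \<mu> \<eta> \<Delta> \<epsilon> S"
begin

abbreviation "mul \<equiv> ([H, H], \<mu>, [H])"
abbreviation "unt \<equiv> ([] :: 'o list, \<eta>, [H])"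
abbreviation "cop \<equiv> ([H], \<Delta>, [H, H])"
abbreviation "cou \<equiv> ([H], \<epsilon>, [] :: 'o list)"
abbreviation "ant \<equiv> ([H], S, [H])"
abbreviation "ant' \<equiv> ([H], inverse_arr C S, [H])"

lemma hopf_arr:
  "H \<in> Obj C"
  "\<mu> \<in> Arr C" "Dom C \<mu> = H \<odot> H" "Cod C \<mu> = H"
  "\<eta> \<in> Arr C" "Dom C \<eta> = \<I>" "Cod C \<eta> = H"
  "\<Delta> \<in> Arr C" "Dom C \<Delta> = H" "Cod C \<Delta> = H \<odot> H"
  "\<epsilon> \<in> Arr C" "Dom C \<epsilon> = H" "Cod C \<epsilon> = \<I>"
  "S \<in> Arr C" "Dom C S = H" "Cod C S = H"
  using hopf by (auto simp: hopf_object_def algebra_object_def coalgebra_object_def hom_iff)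

lemma ant_inv_arr:
  "inverse_arr C S \<in> Arr C" "Dom C (inverse_arr C S) = H" "Cod C (inverse_arr C S) = H"
  "inverse_arr C S \<cdot> S = \<one> H" "S \<cdot> inverse_arr C S = \<one> H"
  using is_inverse_inverse_arr[of S] hopf
  by (auto simp: hopf_object_def is_inverse_def hom_iff hopf_arr)

lemma is_box_hopf [simp]:
  "is_box mul" "is_box unt" "is_box cop" "is_box cou" "is_box ant" "is_box ant'"
  by (auto simp: is_box_def hom_iff hopf_arr ant_inv_arr unit_right_obj unit_obj)

lemmas hopf_simps = deq_def hopf_arr ant_inv_arr braid_arr arrow_simps tensor_id tensor_assoc_obj
  tensor_assoc_arr

lemma assoc: "[H, H, H] \<turnstile> [(0, mul), (0, mul)] \<approx> [(1, mul), (0, mul)]"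
  using hopf by (simp add: hopf_simps hopf_object_def algebra_object_def)

lemma unit_l: "[H] \<turnstile> [(0, unt), (0, mul)] \<approx> []"
  using hopf by (simp add: hopf_simps hopf_object_def algebra_object_def)

lemma unit_r: "[H] \<turnstile> [(1, unt), (0, mul)] \<approx> []"
  using hopf by (simp add: hopf_simps hopf_object_def algebra_object_def)

lemma coassoc: "[H] \<turnstile> [(0, cop), (0, cop)] \<approx> [(0, cop), (1, cop)]"
  using hopf by (simp add: hopf_simps hopf_object_def coalgebra_object_def)

lemma counit_l: "[H] \<turnstile> [(0, cop), (0, cou)] \<approx> []"
  using hopf by (simp add: hopf_simps hopf_object_def coalgebra_object_def)

lemma counit_r: "[H] \<turnstile> [(0, cop), (1, cou)] \<approx> []"
  using hopf by (simp add: hopf_simps hopf_object_def coalgebra_object_def)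

text \<open>
  Writes a tensor product as two slices, the left factor first, which is the form that diagrams
  have.
\<close>

lemma tensor_slices:
  assumes "f \<in> Arr C" "g \<in> Arr C"
  shows "f \<otimes> g = (\<one> (Cod C f) \<otimes> g) \<cdot> (f \<otimes> \<one> (Dom C g))"
  using assms by (simp add: interchange_arr arrow_simps)

lemma bialgebra:
  "[H, H] \<turnstile> [(0, cop), (2, cop), (1, X H H), (0, mul), (1, mul)] \<approx> [(0, mul), (0, cop)]"
proof -
  have D: "\<Delta> \<otimes> \<Delta> = (\<one> H \<otimes> (\<one> H \<otimes> \<Delta>)) \<cdot> (\<Delta> \<otimes> \<one> H)"
    using tensor_slices[of \<Delta> \<Delta>] by (simp add: hopf_arr tensor_id[symmetric] tensor_assoc_arr arrow_simps)
  have M: "\<mu> \<otimes> \<mu> = (\<one> H \<otimes> \<mu>) \<cdot> (\<mu> \<otimes> (\<one> H \<otimes> \<one> H))"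
    using tensor_slices[of \<mu> \<mu>] by (simp add: hopf_arr tensor_id[symmetric])
  have "(\<mu> \<otimes> \<mu>) \<cdot> (\<one> H \<otimes> \<tau> H H \<otimes> \<one> H) \<cdot> (\<Delta> \<otimes> \<Delta>) = \<Delta> \<cdot> \<mu>"
    using hopf by (simp add: hopf_object_def)
  then show ?thesis
    unfolding D M
    by (simp add: hopf_simps numeral_eq_Suc is_box_X comp_assoc_arr tensor_id[symmetric] del: tensor_id)
qed

lemma counit_mul: "[H, H] \<turnstile> [(0, mul), (0, cou)] \<approx> [(0, cou), (0, cou)]"
proof -
  have "\<epsilon> \<otimes> \<epsilon> = \<epsilon> \<cdot> (\<epsilon> \<otimes> \<one> H)"
    using tensor_slices[of \<epsilon> \<epsilon>] by (simp add: hopf_arr arrow_simps)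
  moreover have "\<epsilon> \<cdot> \<mu> = \<epsilon> \<otimes> \<epsilon>" using hopf by (simp add: hopf_object_def)
  ultimately show ?thesis by (simp add: hopf_simps)
qed

lemma cop_unit: "[] \<turnstile> [(0, unt), (0, cop)] \<approx> [(0, unt), (1, unt)]"
proof -
  have "\<eta> \<otimes> \<eta> = (\<one> H \<otimes> \<eta>) \<cdot> \<eta>"
    using tensor_slices[of \<eta> \<eta>] by (simp add: hopf_arr arrow_simps)
  moreover have "\<Delta> \<cdot> \<eta> = \<eta> \<otimes> \<eta>" using hopf by (simp add: hopf_object_def)
  ultimately show ?thesis by (simp add: hopf_simps)
qed

lemma counit_unit: "[] \<turnstile> [(0, unt), (0, cou)] \<approx> []"
  using hopf by (simp add: hopf_simps hopf_object_def)

lemma antipode_l: "[H] \<turnstile> [(0, cop), (0, ant), (0, mul)] \<approx> [(0, cou), (0, unt)]"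
  using hopf by (simp add: hopf_simps hopf_object_def comp_assoc_arr)

lemma antipode_r: "[H] \<turnstile> [(0, cop), (1, ant), (0, mul)] \<approx> [(0, cou), (0, unt)]"
  using hopf by (simp add: hopf_simps hopf_object_def comp_assoc_arr)

lemma ant_ant': "[H] \<turnstile> [(0, ant), (0, ant')] \<approx> []" "[H] \<turnstile> [(0, ant'), (0, ant)] \<approx> []"
  by (simp_all add: hopf_simps)

declare diagram_simps [simp] hopf_arr(1) [simp]

text \<open>
  \<open>S \<eta> = \<mu> (S \<eta> \<otimes> \<eta>) = \<mu> (S \<otimes> \<one>) \<Delta> \<eta> = \<eta> \<epsilon> \<eta> = \<eta>\<close>.
\<close>

lemma antipode_unit: "[] \<turnstile> [(0, unt), (0, ant)] \<approx> [(0, unt)]"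
proof -
  have "[] \<turnstile> [(0, unt), (0, ant)] \<approx> [(0, unt), (1, unt), (0, ant), (0, mul)]"
    by (rule rewrite[OF unit_r[THEN deq_sym], where i=2 and n=0]) simp_all
  also have "[] \<turnstile> \<dots> \<approx> [(0, unt), (0, cop), (0, ant), (0, mul)]"
    by (rule rewrite[OF cop_unit[THEN deq_sym], where i=0 and n=0]) simp_all
  also have "[] \<turnstile> \<dots> \<approx> [(0, unt), (0, cou), (0, unt)]"
    by (rule rewrite[OF antipode_l, where i=1 and n=0]) simp_all
  also have "[] \<turnstile> \<dots> \<approx> [(0, unt)]"
    by (rule rewrite[OF counit_unit, where i=0 and n=0]) simp_all
  finally show ?thesis .
qed

text \<open>
  The first three boxes \<open>(0, cop), (2, cop), (1, X H H)\<close>, here and below, are the coproduct of the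
  coalgebra \<open>H \<odot> H\<close>. With respect to it \<open>S \<mu>\<close> is a left convolution inverse of \<open>\<mu>\<close>: the product is
  a coalgebra morphism, so the claim is the antipode law evaluated at a product.
\<close>

lemma convolution_antipode_left:
  "[H, H] \<turnstile> [(0, cop), (2, cop), (1, X H H), (0, mul), (0, ant), (1, mul), (0, mul)]
    \<approx> [(0, cou), (0, cou), (0, unt)]"
proof -
  have "[H, H] \<turnstile> [(0, cop), (2, cop), (1, X H H), (0, mul), (0, ant), (1, mul), (0, mul)] \<approx>
      [(0, cop), (2, cop), (1, X H H), (0, mul), (1, mul), (0, ant), (0, mul)]"
    by (rule interchange) simp_all
  also have "[H, H] \<turnstile> \<dots> \<approx> [(0, mul), (0, cop), (0, ant), (0, mul)]"
    by (rule rewrite[OF bialgebra, where i=0 and n=0]) simp_all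
  also have "[H, H] \<turnstile> \<dots> \<approx> [(0, mul), (0, cou), (0, unt)]"
    by (rule rewrite[OF antipode_l, where i=1 and n=0]) simp_all
  also have "[H, H] \<turnstile> \<dots> \<approx> [(0, cou), (0, cou), (0, unt)]"
    by (rule rewrite[OF counit_mul, where i=0 and n=0]) simp_all
  finally show ?thesis .
qed

text \<open>
  The opposite product of two antipodes is a right convolution inverse of \<open>\<mu>\<close>. In elements,
  \<open>h\<^sub>1 k\<^sub>1 S(k\<^sub>2) S(h\<^sub>2)\<close> collapses from the inside; in the braided setting \<open>h\<^sub>2\<close> is first made to cross
  over \<open>k\<close> before \<open>k\<close> is split.
\<close>

lemma convolution_antipode_right:
  "[H, H] \<turnstile> [(0, cop), (2, cop), (1, X H H), (0, mul), (1, ant), (2, ant), (1, X H H), (1, mul), (0, mul)]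
    \<approx> [(0, cou), (0, cou), (0, unt)]"
proof -
  note cop_under = under_X[OF is_box_hopf(3) hopf_arr(1)]
  note cou_under = under_X[OF is_box_hopf(4) hopf_arr(1), THEN deq_sym]
  note ant_under = under_X[OF is_box_hopf(5) hopf_arr(1)]
  note ant_over = over_X[OF is_box_hopf(5) hopf_arr(1)]
  have "[H, H] \<turnstile> [(0, cop), (2, cop), (1, X H H), (0, mul), (1, ant), (2, ant), (1, X H H), (1, mul), (0, mul)] \<approx>
     [(0, cop), (2, cop), (1, X H H), (2, ant), (3, ant), (2, X H H), (2, mul), (0, mul), (0, mul)]"
    by (rule interchange) simp_all
  also have "[H, H] \<turnstile> \<dots> \<approx>
     [(0, cop), (2, cop), (1, X H H), (2, ant), (2, X H H), (2, ant), (2, mul), (0, mul), (0, mul)]"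
    by (rule rewrite[OF ant_under, where i=4 and n=2]) simp_all
  also have "[H, H] \<turnstile> \<dots> \<approx>
     [(0, cop), (2, cop), (1, X H H), (2, X H H), (3, ant), (2, ant), (2, mul), (0, mul), (0, mul)]"
    by (rule rewrite[OF ant_over, where i=3 and n=2]) simp_all
  \<comment> \<open>the second factor of \<open>h\<close> crosses the undivided \<open>k\<close>\<close>
  also have "[H, H] \<turnstile> \<dots> \<approx>
     [(0, cop), (1, X H H), (1, cop), (3, ant), (2, ant), (0, mul), (1, mul), (0, mul)]"
    by (rule rewrite[OF cop_under, where i=1 and n=1]) simp_all
  also have "[H, H] \<turnstile> \<dots> \<approx>
     [(0, cop), (1, X H H), (1, cop), (3, ant), (2, ant), (0, mul), (0, mul), (0, mul)]"
    by (rule rewrite[OF assoc[THEN deq_sym], where i=6 and n=0]) simp_all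
  also have "[H, H] \<turnstile> \<dots> \<approx>
     [(0, cop), (1, X H H), (1, cop), (2, ant), (1, mul), (2, ant), (0, mul), (0, mul)]"
    by (rule rewrite[OF assoc, where i=5 and n=0]) simp_all
  also have "[H, H] \<turnstile> \<dots> \<approx>
     [(0, cop), (1, X H H), (1, cou), (1, unt), (0, mul), (1, ant), (0, mul)]"
    by (rule rewrite[OF antipode_r, where i=2 and n=1]) simp_all
  also have "[H, H] \<turnstile> \<dots> \<approx> [(0, cop), (1, X H H), (1, cou), (1, ant), (0, mul)]"
    by (rule rewrite[OF unit_r, where i=3 and n=0]) simp_all
  also have "[H, H] \<turnstile> \<dots> \<approx> [(0, cop), (1, ant), (0, mul), (1, cou)]"
    by (rule rewrite[OF cou_under, where i=1 and n=1]) simp_all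
  also have "[H, H] \<turnstile> \<dots> \<approx> [(0, cou), (0, cou), (0, unt)]"
    by (rule rewrite[OF antipode_r, where i=0 and n=0]) simp_all
  finally show ?thesis .
qed

text \<open>
  Coassociativity of the coalgebra \<open>H \<odot> H\<close>; all crossings are moved behind all coproducts.
\<close>

lemma coassoc_pair:
  "[H, H] \<turnstile> [(0, cop), (2, cop), (1, X H H), (0, cop), (2, cop), (1, X H H)] \<approx>
     [(0, cop), (2, cop), (1, X H H), (2, cop), (4, cop), (3, X H H)]"
proof -
  note cop_under = under_X[OF is_box_hopf(3) hopf_arr(1), THEN deq_sym]
  note cop_over = over_X[OF is_box_hopf(3) hopf_arr(1)]
  have "[H, H] \<turnstile> [(0, cop), (2, cop), (1, X H H), (0, cop), (2, cop), (1, X H H)] \<approx>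
      [(0, cop), (2, cop), (1, X H H), (1, cop), (0, cop), (1, X H H)]"
    by (rule interchange) simp_all
  also have "[H, H] \<turnstile> \<dots> \<approx> [(0, cop), (0, cop), (3, cop), (3, cop), (2, X H H), (3, X H H), (1, X H H)]"
    by (rule rewrite[OF cop_under, where i=2 and n=1]) simp_all
  also have "[H, H] \<turnstile> \<dots> \<approx> [(0, cop), (1, cop), (3, cop), (3, cop), (2, X H H), (3, X H H), (1, X H H)]"
    by (rule rewrite[OF coassoc, where i=0 and n=0]) simp_all
  also have "[H, H] \<turnstile> \<dots> \<approx> [(0, cop), (2, cop), (1, cop), (2, X H H), (1, X H H), (4, cop), (3, X H H)]"
    by (rule rewrite[OF coassoc, where i=2 and n=3]) simp_all
  also have "[H, H] \<turnstile> \<dots> \<approx> [(0, cop), (2, cop), (1, X H H), (2, cop), (4, cop), (3, X H H)]"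
    by (rule rewrite[OF cop_over, where i=2 and n=1]) simp_all
  finally show ?thesis .
qed

lemma counit_pair_l: "[H, H] \<turnstile> [(0, cop), (2, cop), (1, X H H), (0, cou), (0, cou)] \<approx> []"
proof -
  note cou_under = under_X[OF is_box_hopf(4) hopf_arr(1), THEN deq_sym]
  have "[H, H] \<turnstile> [(0, cop), (2, cop), (1, X H H), (0, cou), (0, cou)] \<approx>
      [(0, cop), (2, cop), (1, X H H), (1, cou), (0, cou)]"
    by (rule interchange) simp_all
  also have "[H, H] \<turnstile> \<dots> \<approx> [(0, cop), (2, cop), (2, cou), (0, cou)]"
    by (rule rewrite[OF cou_under, where i=2 and n=1]) simp_all
  also have "[H, H] \<turnstile> \<dots> \<approx> [(0, cop), (0, cou)]"
    by (rule rewrite[OF counit_l, where i=1 and n=2]) simp_all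
  also have "[H, H] \<turnstile> \<dots> \<approx> []"
    by (rule rewrite[OF counit_l, where i=0 and n=0]) simp_all
  finally show ?thesis .
qed

lemma counit_pair_r: "[H, H] \<turnstile> [(0, cop), (2, cop), (1, X H H), (2, cou), (2, cou)] \<approx> []"
proof -
  note cou_over = over_X[OF is_box_hopf(4) hopf_arr(1), THEN deq_sym]
  have "[H, H] \<turnstile> [(0, cop), (2, cop), (1, X H H), (2, cou), (2, cou)] \<approx> [(0, cop), (1, cou), (1, cop), (2, cou)]"
    by (rule rewrite[OF cou_over, where i=2 and n=1]) simp_all
  also have "[H, H] \<turnstile> \<dots> \<approx> [(0, cop), (1, cou)]"
    by (rule rewrite[OF counit_r, where i=2 and n=1]) simp_all
  also have "[H, H] \<turnstile> \<dots> \<approx> []"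
    by (rule rewrite[OF counit_r, where i=0 and n=0]) simp_all
  finally show ?thesis .
qed

text \<open>
  \<open>S \<mu>\<close> is a left and the opposite product of antipodes a right convolution inverse of \<open>\<mu>\<close> in the
  convolution monoid of arrows from the coalgebra \<open>H \<odot> H\<close> to the algebra \<open>H\<close>, hence they agree. The
  calculation spells out the associativity argument.
\<close>

lemma antipode_antimultiplicative:
  "[H, H] \<turnstile> [(0, mul), (0, ant)] \<approx> [(0, ant), (1, ant), (0, X H H), (0, mul)]"
proof -
  \<comment> \<open>a convolution unit is inserted and expanded into \<open>S \<mu>\<close> convolved with \<open>\<mu>\<close>; re-associating then lets \<open>\<mu>\<close> cancel on the other side\<close>
  have "[H, H] \<turnstile> [(0, ant), (1, ant), (0, X H H), (0, mul)] \<approx>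
      [(0, cop), (2, cop), (1, X H H), (0, cou), (0, cou), (0, ant), (1, ant), (0, X H H), (0, mul)]"
    by (rule rewrite[OF counit_pair_l[THEN deq_sym], where i=0 and n=0]) simp_all
  also have "[H, H] \<turnstile> \<dots> \<approx>
      [(0, cop), (2, cop), (1, X H H), (0, cou), (0, cou), (0, unt), (1, ant), (2, ant), (1, X H H), (1, mul), (0, mul)]"
    by (rule rewrite[OF unit_l[THEN deq_sym], where i=9 and n=0]) simp_all
  also have "[H, H] \<turnstile> \<dots> \<approx>
      [(0, cop), (2, cop), (1, X H H), (0, cop), (2, cop), (1, X H H), (0, mul), (0, ant), (1, mul), (0, mul),
       (1, ant), (2, ant), (1, X H H), (1, mul), (0, mul)]"
    by (rule rewrite[OF convolution_antipode_left[THEN deq_sym], where i=3 and n=0]) simp_all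
  also have "[H, H] \<turnstile> \<dots> \<approx>
      [(0, cop), (2, cop), (1, X H H), (2, cop), (4, cop), (3, X H H), (0, mul), (0, ant), (1, mul),
       (2, ant), (3, ant), (2, X H H), (2, mul), (0, mul), (0, mul)]"
    by (rule rewrite[OF coassoc_pair, where i=0 and n=0]) simp_all
  also have "[H, H] \<turnstile> \<dots> \<approx>
      [(0, cop), (2, cop), (1, X H H), (0, mul), (0, ant), (1, cop), (3, cop), (2, X H H), (1, mul),
       (2, ant), (3, ant), (2, X H H), (2, mul), (1, mul), (0, mul)]"
    by (rule rewrite[OF assoc, where i=13 and n=0]) simp_all
  also have "[H, H] \<turnstile> \<dots> \<approx>
      [(0, cop), (2, cop), (1, X H H), (0, mul), (0, ant), (1, cou), (1, cou), (1, unt), (0, mul)]"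
    by (rule rewrite[OF convolution_antipode_right, where i=5 and n=1]) simp_all
  also have "[H, H] \<turnstile> \<dots> \<approx>
      [(0, cop), (2, cop), (1, X H H), (2, cou), (2, cou), (0, mul), (0, ant)]"
    by (rule rewrite[OF unit_r, where i=7 and n=0]) simp_all
  also have "[H, H] \<turnstile> \<dots> \<approx> [(0, mul), (0, ant)]"
    by (rule rewrite[OF counit_pair_r, where i=0 and n=0]) simp_all
  finally show ?thesis by (rule deq_sym)
qed

lemma inverse_antipode_antimultiplicative:
  "[H, H] \<turnstile> [(0, mul), (0, ant')] \<approx> [(0, ant'), (1, ant'), (0, X' H H), (0, mul)]"
proof -
  note ant_under = under_X'[OF is_box_hopf(5) hopf_arr(1), THEN deq_sym]
  note ant_over = over_X'[OF is_box_hopf(5) hopf_arr(1), THEN deq_sym]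
  have "[H, H] \<turnstile> [(0, ant'), (1, ant'), (0, X' H H), (0, mul)] \<approx>
     [(0, ant'), (1, ant'), (0, X' H H), (0, mul), (0, ant), (0, ant')]"
    by (rule rewrite[OF ant_ant'(1)[THEN deq_sym], where i=4 and n=0]) simp_all
  also have "[H, H] \<turnstile> \<dots> \<approx>
     [(0, ant'), (1, ant'), (0, X' H H), (0, ant), (1, ant), (0, X H H), (0, mul), (0, ant')]"
    by (rule rewrite[OF antipode_antimultiplicative, where i=3 and n=0]) simp_all
  also have "[H, H] \<turnstile> \<dots> \<approx>
     [(0, ant'), (1, ant'), (1, ant), (0, X' H H), (1, ant), (0, X H H), (0, mul), (0, ant')]"
    by (rule rewrite[OF ant_under, where i=2 and n=0]) simp_all
  also have "[H, H] \<turnstile> \<dots> \<approx>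
     [(0, ant'), (0, ant), (1, ant'), (1, ant), (0, X' H H), (0, X H H), (0, mul), (0, ant')]"
    by (rule rewrite[OF ant_over, where i=3 and n=0]) simp_all
  also have "[H, H] \<turnstile> \<dots> \<approx>
     [(1, ant'), (1, ant), (0, X' H H), (0, X H H), (0, mul), (0, ant')]"
    by (rule rewrite[OF ant_ant'(2), where i=0 and n=0]) simp_all
  also have "[H, H] \<turnstile> \<dots> \<approx> [(0, X' H H), (0, X H H), (0, mul), (0, ant')]"
    by (rule rewrite[OF ant_ant'(2), where i=0 and n=1]) simp_all
  also have "[H, H] \<turnstile> \<dots> \<approx> [(0, mul), (0, ant')]"
    by (rule rewrite[OF X_X'(2), where i=0 and n=0]) simp_all
  finally show ?thesis by (rule deq_sym)
qed

lemma inverse_antipode_unit: "[] \<turnstile> [(0, unt), (0, ant')] \<approx> [(0, unt)]"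
proof -
  have "[] \<turnstile> [(0, unt), (0, ant')] \<approx> [(0, unt), (0, ant), (0, ant')]"
    by (rule rewrite[OF antipode_unit[THEN deq_sym], where i=0 and n=0]) simp_all
  also have "[] \<turnstile> \<dots> \<approx> [(0, unt)]"
    by (rule rewrite[OF ant_ant'(1), where i=1 and n=0]) simp_all
  finally show ?thesis .
qed

text \<open>
  If a diagram followed by the product is the convolution unit, then composing with the inverse of
  \<open>S\<close> moves this inverse to the two factors and exchanges them by the inverse crossing. Starting
  from the antipode laws this yields the convolution inverses with respect to the coopposite
  coproduct and, when iterated, with respect to the coproduct twisted twice.
\<close>

lemma convolution_skew:
  assumes "[H] \<turnstile> d @ [(0, mul)] \<approx> [(0, cou), (0, unt)]" "tgt [H] d = [H, H]"
  shows "[H] \<turnstile> d @ [(0, ant'), (1, ant'), (0, X' H H), (0, mul)] \<approx> [(0, cou), (0, unt)]"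
proof -
  have d: "[H] \<turnstile> d \<approx> d" using assms(1) by (auto simp: deq_def well_append)
  have "[H] \<turnstile> d @ [(0, ant'), (1, ant'), (0, X' H H), (0, mul)] \<approx> d @ [(0, mul), (0, ant')]"
    by (rule deq_append[OF d]) (use inverse_antipode_antimultiplicative[THEN deq_sym] in \<open>simp add: assms(2)\<close>)
  also have "[H] \<turnstile> d @ [(0, mul), (0, ant')] \<approx> [(0, cou), (0, unt), (0, ant')]"
    using deq_append[OF assms(1) deq_refl, of "[(0, ant')]"] assms(2) by (simp add: tgt_append)
  also have "[H] \<turnstile> \<dots> \<approx> [(0, cou), (0, unt)]"
    by (rule rewrite[OF inverse_antipode_unit, where i=1 and n=0]) simp_all
  finally show ?thesis .
qed

text \<open>
  The inverse of \<open>S\<close> is an antipode for the coopposite coproduct.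
\<close>

lemma skew_antipode_l: "[H] \<turnstile> [(0, cop), (0, X' H H), (0, ant'), (0, mul)] \<approx> [(0, cou), (0, unt)]"
proof -
  note ant_under = under_X'[OF is_box_hopf(6) hopf_arr(1), THEN deq_sym]
  have "[H] \<turnstile> [(0, cop), (0, X' H H), (0, ant'), (0, mul)] \<approx> [(0, cop), (1, ant'), (0, X' H H), (0, mul)]"
    by (rule rewrite[OF ant_under, where i=1 and n=0]) simp_all
  also have "[H] \<turnstile> \<dots> \<approx> [(0, cop), (0, ant), (0, ant'), (1, ant'), (0, X' H H), (0, mul)]"
    by (rule rewrite[OF ant_ant'(1)[THEN deq_sym], where i=1 and n=0]) simp_all
  also have "[H] \<turnstile> \<dots> \<approx> [(0, cou), (0, unt)]"
    using convolution_skew[of "[(0, cop), (0, ant)]"] antipode_l by simp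
  finally show ?thesis .
qed

lemma skew_antipode_r: "[H] \<turnstile> [(0, cop), (0, X' H H), (1, ant'), (0, mul)] \<approx> [(0, cou), (0, unt)]"
proof -
  note ant_over = over_X'[OF is_box_hopf(6) hopf_arr(1), THEN deq_sym]
  have "[H] \<turnstile> [(0, cop), (0, X' H H), (1, ant'), (0, mul)] \<approx> [(0, cop), (0, ant'), (0, X' H H), (0, mul)]"
    by (rule rewrite[OF ant_over, where i=1 and n=0]) simp_all
  also have "[H] \<turnstile> \<dots> \<approx> [(0, cop), (1, ant), (0, ant'), (1, ant'), (0, X' H H), (0, mul)]"
    by (rule rewrite[OF ant_ant'(1)[THEN deq_sym], where i=1 and n=1]) simp_all
  also have "[H] \<turnstile> \<dots> \<approx> [(0, cou), (0, unt)]"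
    using convolution_skew[of "[(0, cop), (1, ant)]"] antipode_r by simp
  finally show ?thesis .
qed

text \<open>
  For the coproduct twisted twice the inverse and the squared inverse of \<open>S\<close> are mutually
  convolution inverse.
\<close>

lemma skew2_antipode_l:
  "[H] \<turnstile> [(0, cop), (0, X' H H), (0, X' H H), (1, ant'), (1, ant'), (0, ant'), (0, mul)] \<approx> [(0, cou), (0, unt)]"
proof -
  note ant_under = under_X'[OF is_box_hopf(6) hopf_arr(1)]
  note ant_over = over_X'[OF is_box_hopf(6) hopf_arr(1)]
  have "[H] \<turnstile> [(0, cop), (0, X' H H), (0, ant'), (0, ant'), (1, ant'), (0, X' H H), (0, mul)] \<approx>
      [(0, cop), (0, X' H H), (0, ant'), (0, ant'), (0, X' H H), (0, ant'), (0, mul)]"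
    by (rule rewrite[OF ant_under, where i=4 and n=0]) simp_all
  also have "[H] \<turnstile> \<dots> \<approx> [(0, cop), (0, X' H H), (0, ant'), (0, X' H H), (1, ant'), (0, ant'), (0, mul)]"
    by (rule rewrite[OF ant_over, where i=3 and n=0]) simp_all
  also have "[H] \<turnstile> \<dots> \<approx> [(0, cop), (0, X' H H), (0, X' H H), (1, ant'), (1, ant'), (0, ant'), (0, mul)]"
    by (rule rewrite[OF ant_over, where i=2 and n=0]) simp_all
  finally show ?thesis
    using convolution_skew[of "[(0, cop), (0, X' H H), (0, ant')]"] skew_antipode_l
    by (auto intro: deq_trans deq_sym)
qed

lemma skew2_antipode_r:
  "[H] \<turnstile> [(0, cop), (0, X' H H), (0, X' H H), (1, ant'), (0, ant'), (0, ant'), (0, mul)] \<approx> [(0, cou), (0, unt)]"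
proof -
  note ant_under = under_X'[OF is_box_hopf(6) hopf_arr(1)]
  note ant_over = over_X'[OF is_box_hopf(6) hopf_arr(1)]
  have "[H] \<turnstile> [(0, cop), (0, X' H H), (1, ant'), (0, ant'), (1, ant'), (0, X' H H), (0, mul)] \<approx>
      [(0, cop), (0, X' H H), (0, ant'), (1, ant'), (0, X' H H), (0, ant'), (0, mul)]"
    by (rule rewrite[OF ant_under, where i=4 and n=0]) simp_all
  also have "[H] \<turnstile> \<dots> \<approx> [(0, cop), (0, X' H H), (0, ant'), (0, X' H H), (0, ant'), (0, ant'), (0, mul)]"
    by (rule rewrite[OF ant_under, where i=3 and n=0]) simp_all
  also have "[H] \<turnstile> \<dots> \<approx> [(0, cop), (0, X' H H), (0, X' H H), (1, ant'), (0, ant'), (0, ant'), (0, mul)]"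
    by (rule rewrite[OF ant_over, where i=2 and n=0]) simp_all
  finally show ?thesis
    using convolution_skew[of "[(0, cop), (0, X' H H), (1, ant')]"] skew_antipode_r
    by (auto intro: deq_trans deq_sym)
qed

end

section \<open>Yetter-Drinfel'd modules and the braid relation\<close>

text \<open>
  The compatibility of the twist with the action and the coaction is abstracted from \<open>f\<close>-objects,
  where it expresses that the two structure maps are morphisms of \<open>f\<close>-objects.
\<close>

locale yetter_drinfeld_module = hopf_algebra C H \<mu> \<eta> \<Delta> \<epsilon> S
  for C :: "('o, 'm) bm_cat" (structure) and H \<mu> \<eta> \<Delta> \<epsilon> S +
  fixes \<phi> :: "'o \<Rightarrow> 'm" and Y :: 'o and \<alpha> \<delta> :: 'm
  assumes yd: "left_yetter_drinfeld C \<phi> H \<mu> \<eta> \<Delta> \<epsilon> Y \<alpha> \<delta>"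
    and phi_hom: "\<phi> H \<in> hom C H H" "\<phi> Y \<in> hom C Y Y"
    and phi_invertible: "invertible C (\<phi> Y)"
    and phi_action: "\<phi> Y \<cdot> \<alpha> = \<alpha> \<cdot> (\<phi> H \<otimes> \<phi> Y)"
    and phi_coaction: "\<delta> \<cdot> \<phi> Y = (\<phi> H \<otimes> \<phi> Y) \<cdot> \<delta>"
begin

abbreviation "act \<equiv> ([H, Y], \<alpha>, [Y])"
abbreviation "coa \<equiv> ([Y], \<delta>, [H, Y])"
abbreviation "phH \<equiv> ([H], \<phi> H, [H])"
abbreviation "phY \<equiv> ([Y], \<phi> Y, [Y])"
abbreviation "phY' \<equiv> ([Y], inverse_arr C (\<phi> Y), [Y])"

lemma yd_arr:
  "Y \<in> Obj C"
  "\<alpha> \<in> Arr C" "Dom C \<alpha> = H \<odot> Y" "Cod C \<alpha> = Y"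
  "\<delta> \<in> Arr C" "Dom C \<delta> = Y" "Cod C \<delta> = H \<odot> Y"
  "\<phi> H \<in> Arr C" "Dom C (\<phi> H) = H" "Cod C (\<phi> H) = H"
  "\<phi> Y \<in> Arr C" "Dom C (\<phi> Y) = Y" "Cod C (\<phi> Y) = Y"
  using yd phi_hom by (auto simp: left_yetter_drinfeld_def left_module_def left_comodule_def hom_iff)

lemma phi_inv_arr:
  "inverse_arr C (\<phi> Y) \<in> Arr C" "Dom C (inverse_arr C (\<phi> Y)) = Y" "Cod C (inverse_arr C (\<phi> Y)) = Y"
  "inverse_arr C (\<phi> Y) \<cdot> \<phi> Y = \<one> Y" "\<phi> Y \<cdot> inverse_arr C (\<phi> Y) = \<one> Y"
  using is_inverse_inverse_arr[OF phi_invertible]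
  by (auto simp: is_inverse_def hom_iff yd_arr)

lemma is_box_yd [simp]:
  "is_box act" "is_box coa" "is_box phH" "is_box phY" "is_box phY'"
  by (auto simp: is_box_def hom_iff hopf_arr yd_arr phi_inv_arr unit_right_obj unit_obj)

lemmas yd_simps = hopf_simps yd_arr phi_inv_arr

declare yd_arr(1) [simp]

lemma action_assoc: "[H, H, Y] \<turnstile> [(0, mul), (0, act)] \<approx> [(1, act), (0, act)]"
  using yd by (simp add: yd_simps left_yetter_drinfeld_def left_module_def)

lemma action_unit: "[Y] \<turnstile> [(0, unt), (0, act)] \<approx> []"
  using yd by (simp add: yd_simps left_yetter_drinfeld_def left_module_def)

lemma coaction_coassoc: "[Y] \<turnstile> [(0, coa), (1, coa)] \<approx> [(0, coa), (0, cop)]"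
  using yd by (simp add: yd_simps left_yetter_drinfeld_def left_comodule_def)

lemma coaction_counit: "[Y] \<turnstile> [(0, coa), (0, cou)] \<approx> []"
  using yd by (simp add: yd_simps left_yetter_drinfeld_def left_comodule_def)

lemma phY_phY': "[Y] \<turnstile> [(0, phY), (0, phY')] \<approx> []" "[Y] \<turnstile> [(0, phY'), (0, phY)] \<approx> []"
  by (simp_all add: yd_simps)

lemma action_phi: "[H, Y] \<turnstile> [(0, act), (0, phY)] \<approx> [(0, phH), (1, phY), (0, act)]"
proof -
  have "\<phi> H \<otimes> \<phi> Y = (\<one> H \<otimes> \<phi> Y) \<cdot> (\<phi> H \<otimes> \<one> Y)"
    using tensor_slices[of "\<phi> H" "\<phi> Y"] by (simp add: yd_arr)
  with phi_action show ?thesis by (simp add: yd_simps comp_assoc_arr)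
qed

lemma coaction_phi: "[Y] \<turnstile> [(0, phY), (0, coa)] \<approx> [(0, coa), (0, phH), (1, phY)]"
proof -
  have "\<phi> H \<otimes> \<phi> Y = (\<one> H \<otimes> \<phi> Y) \<cdot> (\<phi> H \<otimes> \<one> Y)"
    using tensor_slices[of "\<phi> H" "\<phi> Y"] by (simp add: yd_arr)
  with phi_coaction show ?thesis by (simp add: yd_simps comp_assoc_arr)
qed

lemma yetter_drinfeld:
  "[H, Y] \<turnstile> [(0, cop), (1, X H Y), (0, act), (0, coa), (2, phH), (1, X Y H), (0, mul)] \<approx>
     [(0, cop), (2, coa), (1, X H H), (0, mul), (1, act)]"
proof -
  have L: "\<delta> \<cdot> \<alpha> \<otimes> \<phi> H = (\<one> H \<otimes> (\<one> Y \<otimes> \<phi> H)) \<cdot> ((\<delta> \<otimes> \<one> H) \<cdot> (\<alpha> \<otimes> \<one> H))"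
    using tensor_slices[of "\<delta> \<cdot> \<alpha>" "\<phi> H"]
    by (simp add: yd_arr hopf_arr interchange_arr arrow_simps tensor_id[symmetric] tensor_assoc_arr)
  have D: "\<Delta> \<otimes> \<delta> = (\<one> H \<otimes> (\<one> H \<otimes> \<delta>)) \<cdot> (\<Delta> \<otimes> \<one> Y)"
    using tensor_slices[of \<Delta> \<delta>]
    by (simp add: yd_arr hopf_arr tensor_id[symmetric] tensor_assoc_arr arrow_simps)
  have M: "\<mu> \<otimes> \<alpha> = (\<one> H \<otimes> \<alpha>) \<cdot> (\<mu> \<otimes> (\<one> H \<otimes> \<one> Y))"
    using tensor_slices[of \<mu> \<alpha>] by (simp add: yd_arr hopf_arr tensor_id[symmetric])
  have "(\<mu> \<otimes> \<one> Y) \<cdot> (\<one> H \<otimes> \<tau> Y H) \<cdot> (\<delta> \<cdot> \<alpha> \<otimes> \<phi> H) \<cdot> (\<one> H \<otimes> \<tau> H Y) \<cdot> (\<Delta> \<otimes> \<one> Y) =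
     (\<mu> \<otimes> \<alpha>) \<cdot> (\<one> H \<otimes> \<tau> H H \<otimes> \<one> Y) \<cdot> (\<Delta> \<otimes> \<delta>)"
    using yd by (simp add: left_yetter_drinfeld_def)
  then show ?thesis
    unfolding L D M
    by (simp add: yd_simps comp_assoc_arr tensor_id[symmetric] del: tensor_id)
qed

abbreviation "rho \<equiv> rho_L C \<phi> H Y \<alpha> \<delta>"
abbreviation "R \<equiv> ([Y, Y], rho, [Y, Y])"

lemma rho_val: "rho = val [Y, Y] [(0, coa), (2, phY), (1, X Y Y), (0, act)]"
proof -
  have D: "\<delta> \<otimes> \<phi> Y = (\<one> (H \<odot> Y) \<otimes> \<phi> Y) \<cdot> (\<delta> \<otimes> \<one> Y)"
    using tensor_slices[of \<delta> "\<phi> Y"] by (simp add: yd_arr)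
  show ?thesis
    unfolding rho_L_def D by (simp add: yd_simps comp_assoc_arr)
qed

lemma R_diagram:
  "is_box R" "[Y, Y] \<turnstile> [(0, R)] \<approx> [(0, coa), (2, phY), (1, X Y Y), (0, act)]"
  using box_of_diagram[of "[Y, Y]" "[(0, coa), (2, phY), (1, X Y Y), (0, act)]"]
  unfolding rho_val[symmetric] by simp_all

declare R_diagram(1) [simp]

lemma R_phi: "[Y, Y] \<turnstile> [(0, phY), (1, phY), (0, R)] \<approx> [(0, R), (0, phY), (1, phY)]"
proof -
  note phi_under = under_X[OF is_box_yd(4) yd_arr(1), THEN deq_sym]
  note phi_over = over_X[OF is_box_yd(4) yd_arr(1), THEN deq_sym]
  have "[Y, Y] \<turnstile> [(0, R), (0, phY), (1, phY)] \<approx>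
      [(0, coa), (2, phY), (1, X Y Y), (0, act), (0, phY), (1, phY)]"
    by (rule rewrite[OF R_diagram(2), where i=0 and n=0]) simp_all
  also have "[Y, Y] \<turnstile> \<dots> \<approx> [(0, coa), (2, phY), (0, phH), (1, X Y Y), (1, phY), (2, phY), (0, act)]"
    by (rule rewrite[OF action_phi, where i=3 and n=0]) simp_all
  also have "[Y, Y] \<turnstile> \<dots> \<approx> [(0, coa), (2, phY), (0, phH), (2, phY), (1, X Y Y), (2, phY), (0, act)]"
    by (rule rewrite[OF phi_under, where i=3 and n=1]) simp_all
  also have "[Y, Y] \<turnstile> \<dots> \<approx> [(0, coa), (0, phH), (1, phY), (2, phY), (2, phY), (1, X Y Y), (0, act)]"
    by (rule rewrite[OF phi_over, where i=4 and n=1]) simp_all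
  also have "[Y, Y] \<turnstile> \<dots> \<approx> [(0, phY), (1, phY), (0, coa), (2, phY), (1, X Y Y), (0, act)]"
    by (rule rewrite[OF coaction_phi[THEN deq_sym], where i=0 and n=0]) simp_all
  also have "[Y, Y] \<turnstile> \<dots> \<approx> [(0, phY), (1, phY), (0, R)]"
    by (rule rewrite[OF R_diagram(2)[THEN deq_sym], where i=2 and n=0]) simp_all
  finally show ?thesis by (rule deq_sym)
qed

text \<open>
  \<open>\<rho>\<close> is \<open>H\<close>-linear for the diagonal action on \<open>Y \<odot> Y\<close>. In elements, \<open>\<rho>\<close> sends \<open>h\<^sub>1 a \<otimes> h\<^sub>2 b\<close> to
  \<open>(h\<^sub>1 a)\<^sub>-\<^sub>1 \<phi>(h\<^sub>2) \<phi>(b) \<otimes> (h\<^sub>1 a)\<^sub>0\<close>, and the factor in front of \<open>\<phi>(b)\<close> together with \<open>(h\<^sub>1 a)\<^sub>0\<close> is one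
  side of the Yetter-Drinfel'd condition.
\<close>

lemma R_module_map:
  "[H, Y, Y] \<turnstile> [(0, cop), (1, X H Y), (0, act), (1, act), (0, R)] \<approx>
     [(1, R), (0, cop), (1, X H Y), (0, act), (1, act)]"
proof -
  note act_under = under_X[OF is_box_yd(1)]
  note act_over = over_X[OF is_box_yd(1)]
  have "[H, Y, Y] \<turnstile> [(0, cop), (1, X H Y), (0, act), (1, act), (0, R)] \<approx>
      [(0, cop), (1, X H Y), (0, act), (0, coa), (2, act), (2, phY), (1, X Y Y), (0, act)]"
    by (rule rewrite[OF R_diagram(2), where i=4 and n=0]) simp_all
  also have "[H, Y, Y] \<turnstile> \<dots> \<approx>
      [(0, cop), (1, X H Y), (0, act), (0, coa), (2, phH), (3, phY), (2, act), (1, X Y Y), (0, act)]"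
    by (rule rewrite[OF action_phi, where i=4 and n=2]) simp_all
  also have "[H, Y, Y] \<turnstile> \<dots> \<approx>
      [(0, cop), (1, X H Y), (0, act), (0, coa), (2, phH), (3, phY), (1, X Y H), (2, X Y Y), (1, act), (0, act)]"
    by (rule rewrite[OF act_under[OF yd_arr(1)], where i=6 and n=1]) simp_all
  also have "[H, Y, Y] \<turnstile> \<dots> \<approx>
      [(0, cop), (1, X H Y), (0, act), (0, coa), (2, phH), (1, X Y H), (0, mul), (2, phY), (1, X Y Y), (0, act)]"
    by (rule rewrite[OF action_assoc[THEN deq_sym], where i=8 and n=0]) simp_all
  also have "[H, Y, Y] \<turnstile> \<dots> \<approx>
      [(0, cop), (2, coa), (1, X H H), (0, mul), (3, phY), (1, act), (1, X Y Y), (0, act)]"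
    by (rule rewrite[OF yetter_drinfeld, where i=0 and n=0]) simp_all
  also have "[H, Y, Y] \<turnstile> \<dots> \<approx>
      [(0, cop), (2, coa), (1, X H H), (4, phY), (3, X Y Y), (2, X H Y), (3, act), (0, mul), (0, act)]"
    by (rule rewrite[OF act_over[OF yd_arr(1)], where i=5 and n=1]) simp_all
  also have "[H, Y, Y] \<turnstile> \<dots> \<approx>
      [(1, coa), (3, phY), (2, X Y Y), (0, cop), (1, X H H), (2, X H Y), (1, act), (0, act), (1, act)]"
    by (rule rewrite[OF action_assoc, where i=7 and n=0]) simp_all
  also have "[H, Y, Y] \<turnstile> \<dots> \<approx>
      [(1, coa), (3, phY), (2, X Y Y), (1, act), (0, cop), (1, X H Y), (0, act), (1, act)]"
    by (rule rewrite[OF act_under[OF hopf_arr(1), THEN deq_sym], where i=4 and n=1]) simp_all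
  also have "[H, Y, Y] \<turnstile> \<dots> \<approx> [(1, R), (0, cop), (1, X H Y), (0, act), (1, act)]"
    by (rule rewrite[OF R_diagram(2)[THEN deq_sym], where i=0 and n=1]) simp_all
  finally show ?thesis .
qed

text \<open>
  Two copies of \<open>\<rho>\<close> amount to one coaction, a crossing over two wires and the diagonal action,
  because splitting off twice from \<open>Y\<close> is the same as splitting off once and applying \<open>\<Delta>\<close>.
\<close>

lemma R_hexagon:
  "[Y, Y, Y] \<turnstile> [(0, R), (1, R)] \<approx>
     [(0, coa), (2, phY), (3, phY), (1, X Y Y), (2, X Y Y), (0, cop), (1, X H Y), (0, act), (1, act)]"
proof -
  note coa_over = over_X[OF is_box_yd(2) yd_arr(1), THEN deq_sym]
  have "[Y, Y, Y] \<turnstile> [(0, R), (1, R)] \<approx> [(0, coa), (2, phY), (1, X Y Y), (0, act), (1, R)]"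
    by (rule rewrite[OF R_diagram(2), where i=0 and n=0]) simp_all
  also have "[Y, Y, Y] \<turnstile> \<dots> \<approx>
      [(0, coa), (2, phY), (1, X Y Y), (2, coa), (4, phY), (3, X Y Y), (0, act), (1, act)]"
    by (rule rewrite[OF R_diagram(2), where i=4 and n=1]) simp_all
  also have "[Y, Y, Y] \<turnstile> \<dots> \<approx>
      [(0, coa), (1, coa), (3, phY), (4, phY), (2, X Y Y), (3, X Y Y), (1, X H Y), (0, act), (1, act)]"
    by (rule rewrite[OF coa_over, where i=2 and n=1]) simp_all
  also have "[Y, Y, Y] \<turnstile> \<dots> \<approx>
     [(0, coa), (2, phY), (3, phY), (1, X Y Y), (2, X Y Y), (0, cop), (1, X H Y), (0, act), (1, act)]"
    by (rule rewrite[OF coaction_coassoc, where i=0 and n=0]) simp_all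
  finally show ?thesis .
qed

text \<open>
  The composite described by \<open>R_hexagon\<close> commutes with \<open>\<rho>\<close> step by step: with the diagonal action
  by \<open>R_module_map\<close>, with the crossings by naturality, and with the twists by \<open>R_phi\<close>.
\<close>

lemma R_braid_relation: "[Y, Y, Y] \<turnstile> [(0, R), (1, R), (0, R)] \<approx> [(1, R), (0, R), (1, R)]"
proof -
  note R_under = under_X[OF R_diagram(1) yd_arr(1), THEN deq_sym]
  have "[Y, Y, Y] \<turnstile> [(0, R), (1, R), (0, R)] \<approx>
      [(0, coa), (2, phY), (3, phY), (1, X Y Y), (2, X Y Y), (0, cop), (1, X H Y), (0, act), (1, act), (0, R)]"
    by (rule rewrite[OF R_hexagon, where i=0 and n=0]) simp_all
  also have "[Y, Y, Y] \<turnstile> \<dots> \<approx>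
      [(0, coa), (2, phY), (3, phY), (1, X Y Y), (2, X Y Y), (1, R), (0, cop), (1, X H Y), (0, act), (1, act)]"
    by (rule rewrite[OF R_module_map, where i=5 and n=0]) simp_all
  also have "[Y, Y, Y] \<turnstile> \<dots> \<approx>
      [(0, coa), (2, phY), (3, phY), (2, R), (1, X Y Y), (2, X Y Y), (0, cop), (1, X H Y), (0, act), (1, act)]"
    by (rule rewrite[OF R_under, where i=3 and n=1]) simp_all
  also have "[Y, Y, Y] \<turnstile> \<dots> \<approx>
      [(1, R), (0, coa), (2, phY), (3, phY), (1, X Y Y), (2, X Y Y), (0, cop), (1, X H Y), (0, act), (1, act)]"
    by (rule rewrite[OF R_phi, where i=1 and n=2]) simp_all
  also have "[Y, Y, Y] \<turnstile> \<dots> \<approx> [(1, R), (0, R), (1, R)]"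
    by (rule rewrite[OF R_hexagon[THEN deq_sym], where i=1 and n=0]) simp_all
  finally show ?thesis .
qed

lemma shift_0: "shift 0 d = d"
  by (induction "0 :: nat" d rule: shift.induct) auto

text \<open>
  Convolution identities of arrows from \<open>H\<close> to \<open>H\<close> carry over to the actions through these arrows.
\<close>

lemma action_convolution:
  assumes "[H] \<turnstile> d @ [(0, mul)] \<approx> [(0, cou), (0, unt)]" "tgt [H] d = [H, H]"
  shows "[H, Y] \<turnstile> d @ [(1, act), (0, act)] \<approx> [(0, cou)]"
proof -
  have "well_formed [H] d" using assms(1) by (auto simp: deq_def well_append)
  with shift_context[of "[]" "[Y]" "[H]" d] assms(2)
  have d: "[H, Y] \<turnstile> d \<approx> d" "tgt [H, Y] d = [H, H, Y]" by (auto simp: shift_0 deq_def)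
  have "[H, Y] \<turnstile> d @ [(1, act), (0, act)] \<approx> d @ [(0, mul), (0, act)]"
    by (rule deq_append[OF d(1)]) (use action_assoc[THEN deq_sym] in \<open>simp add: d(2)\<close>)
  also have "[H, Y] \<turnstile> d @ [(0, mul), (0, act)] \<approx> [(0, cou), (0, unt), (0, act)]"
    using deq_append[OF deq_shift[OF assms(1), of "[]" "[Y]" 0] deq_refl, of "[(0, act)]"] d(2)
    by (simp add: tgt_append shift_0)
  also have "[H, Y] \<turnstile> \<dots> \<approx> [(0, cou)]"
    by (rule rewrite[OF action_unit, where i=1 and n=0]) simp_all
  finally show ?thesis .
qed

text \<open>
  The first of these actions absorbs the twist of \<open>\<rho>\<close>, so that \<open>\<rho>\<close> takes the form treated in
  \<open>crossing_inverse\<close>. The second is its convolution inverse for the coopposite coproduct; the twist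
  is undone last, after the element of \<open>H\<close> has acted.
\<close>

definition "phi_act_arr = val [H, Y] [(1, phY), (0, act)]"
abbreviation "phi_act \<equiv> ([H, Y], phi_act_arr, [Y])"

definition "phi_act_skew_arr = val [H, Y] [(0, ant'), (0, act), (0, phY')]"

abbreviation "phi_act_skew \<equiv> ([H, Y], phi_act_skew_arr, [Y])"

lemma phi_act:
  "is_box phi_act" "[H, Y] \<turnstile> [(0, phi_act)] \<approx> [(1, phY), (0, act)]"
  "is_box phi_act_skew" "[H, Y] \<turnstile> [(0, phi_act_skew)] \<approx> [(0, ant'), (0, act), (0, phY')]"
  using box_of_diagram[of "[H, Y]" "[(1, phY), (0, act)]"]
    box_of_diagram[of "[H, Y]" "[(0, ant'), (0, act), (0, phY')]"]
  unfolding phi_act_arr_def phi_act_skew_arr_def by simp_all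

\<comment> \<open>values of diagrams stay folded from here on: the remaining arrows are compared by rewriting diagrams\<close>
declare phi_act(1,3) [simp] val.simps [simp del]

lemma phi_act_skew_convolution_l:
  "[H, Y] \<turnstile> [(0, cop), (0, X' H H), (1, phi_act), (0, phi_act_skew)] \<approx> [(0, cou)]"
proof -
  have "[H, Y] \<turnstile> [(0, cop), (0, X' H H), (1, phi_act), (0, phi_act_skew)] \<approx>
     [(0, cop), (0, X' H H), (2, phY), (1, act), (0, phi_act_skew)]"
    by (rule rewrite[OF phi_act(2), where i=2 and n=1]) simp_all
  also have "[H, Y] \<turnstile> \<dots> \<approx>
     [(1, phY), (0, cop), (0, X' H H), (0, ant'), (1, act), (0, act), (0, phY')]"
    by (rule rewrite[OF phi_act(4), where i=4 and n=0]) simp_all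
  also have "[H, Y] \<turnstile> \<dots> \<approx> [(0, cou), (0, phY), (0, phY')]"
    by (rule rewrite[OF action_convolution[of "[(0, cop), (0, X' H H), (0, ant')]"], where i=1 and n=0])
      (use skew_antipode_l in simp_all)
  also have "[H, Y] \<turnstile> \<dots> \<approx> [(0, cou)]"
    by (rule rewrite[OF phY_phY'(1), where i=1 and n=0]) simp_all
  finally show ?thesis .
qed

lemma phi_act_skew_convolution_r:
  "[H, Y] \<turnstile> [(0, cop), (0, X' H H), (1, phi_act_skew), (0, phi_act)] \<approx> [(0, cou)]"
proof -
  have "[H, Y] \<turnstile> [(0, cop), (0, X' H H), (1, phi_act_skew), (0, phi_act)] \<approx>
     [(0, cop), (0, X' H H), (1, ant'), (1, act), (1, phY'), (0, phi_act)]"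
    by (rule rewrite[OF phi_act(4), where i=2 and n=1]) simp_all
  also have "[H, Y] \<turnstile> \<dots> \<approx>
     [(0, cop), (0, X' H H), (1, ant'), (1, act), (1, phY'), (1, phY), (0, act)]"
    by (rule rewrite[OF phi_act(2), where i=5 and n=0]) simp_all
  also have "[H, Y] \<turnstile> \<dots> \<approx> [(0, cop), (0, X' H H), (1, ant'), (1, act), (0, act)]"
    by (rule rewrite[OF phY_phY'(2), where i=4 and n=1]) simp_all
  also have "[H, Y] \<turnstile> \<dots> \<approx> [(0, cou)]"
    by (rule rewrite[OF action_convolution[of "[(0, cop), (0, X' H H), (1, ant')]"], where i=0 and n=0])
      (use skew_antipode_r in simp_all)
  finally show ?thesis .
qed

lemma R_crossing: "[Y, Y] \<turnstile> [(0, R)] \<approx> [(0, coa), (1, X Y Y), (0, phi_act)]"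
proof -
  note phi_under = under_X[OF is_box_yd(4) yd_arr(1)]
  have "[Y, Y] \<turnstile> [(0, R)] \<approx> [(0, coa), (2, phY), (1, X Y Y), (0, act)]"
    by (rule R_diagram(2))
  also have "[Y, Y] \<turnstile> \<dots> \<approx> [(0, coa), (1, X Y Y), (1, phY), (0, act)]"
    by (rule rewrite[OF phi_under, where i=1 and n=1]) simp_all
  also have "[Y, Y] \<turnstile> \<dots> \<approx> [(0, coa), (1, X Y Y), (0, phi_act)]"
    by (rule rewrite[OF phi_act(2)[THEN deq_sym], where i=2 and n=0]) simp_all
  finally show ?thesis .
qed

lemma rho_arr: "rho \<in> hom C (Y \<odot> Y) (Y \<odot> Y)"
  using is_boxD[OF R_diagram(1)] by (simp add: hom_iff unit_right_obj)

lemma rho_crossing: "rho = val [Y, Y] [(0, coa), (1, X Y Y), (0, phi_act)]"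
proof -
  have "rho = val [Y, Y] [(0, R)]"
    using rho_arr by (simp add: val.simps hom_iff arrow_simps)
  then show ?thesis using R_crossing by (simp add: deq_def)
qed

lemma rho_inverse:
  "is_inverse C rho (val [Y, Y] [(0, X' Y Y), (0, coa), (0, X' H Y), (1, phi_act_skew)])"
  unfolding rho_crossing
  by (rule crossing_inverse[OF hopf_arr(1) yd_arr(1) yd_arr(1) is_box_yd(2) is_box_hopf(3) is_box_hopf(4)
        phi_act(1) phi_act(3) coaction_coassoc coaction_counit phi_act_skew_convolution_l phi_act_skew_convolution_r])

theorem r_matrix_rho: "r_matrix C Y rho"
proof -
  have "(rho \<otimes> \<one> Y) \<cdot> (\<one> Y \<otimes> rho) \<cdot> (rho \<otimes> \<one> Y) = (\<one> Y \<otimes> rho) \<cdot> (rho \<otimes> \<one> Y) \<cdot> (\<one> Y \<otimes> rho)"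
    using R_braid_relation rho_arr
    by (simp add: deq_def val.simps hom_iff arrow_simps tensor_id comp_assoc_arr tensor_assoc_obj)
  then show ?thesis
    using rho_arr rho_inverse by (auto simp: r_matrix_def invertible_def)
qed

end

section \<open>Partial transposes\<close>

locale dual_yetter_drinfeld_module = yetter_drinfeld_module C H \<mu> \<eta> \<Delta> \<epsilon> S \<phi> Y \<alpha> \<delta>
  for C :: "('o, 'm) bm_cat" (structure) and H \<mu> \<eta> \<Delta> \<epsilon> S \<phi> Y \<alpha> \<delta> +
  fixes V :: 'o and e c :: 'm
  assumes dual: "is_dual C Y V e c"
begin

abbreviation "ev \<equiv> ([V, Y], e, [] :: 'o list)"
abbreviation "co \<equiv> ([] :: 'o list, c, [Y, V])"

lemma dual_arr:
  "V \<in> Obj C"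
  "e \<in> Arr C" "Dom C e = V \<odot> Y" "Cod C e = \<I>"
  "c \<in> Arr C" "Dom C c = \<I>" "Cod C c = Y \<odot> V"
  using dual by (auto simp: is_dual_def hom_iff)

lemma is_box_dual [simp]: "is_box ev" "is_box co"
  by (auto simp: is_box_def hom_iff yd_arr dual_arr unit_right_obj unit_obj)

declare dual_arr(1) [simp]

lemmas dual_simps = yd_simps dual_arr val.simps

lemma zigzag_Y: "[Y] \<turnstile> [(0, co), (1, ev)] \<approx> []"
  using dual by (simp add: dual_simps is_dual_def)

lemma zigzag_V: "[V] \<turnstile> [(1, co), (0, ev)] \<approx> []"
  using dual by (simp add: dual_simps is_dual_def)

lemma partial_transpose_val:
  assumes "is_box ([Y, Y], f, [Y, Y])"
  shows "partial_transpose C Y V e c f = val [V, Y] [(2, co), (1, [Y, Y], f, [Y, Y]), (0, ev)]"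
  using is_boxD[OF assms]
  by (simp add: partial_transpose_def dual_simps comp_assoc_arr)

text \<open>
  A wire that crosses over one leg of the coevaluation may instead cross the other leg by the
  inverse braiding, since crossing both legs is the same as passing the coevaluation on the other side.
\<close>

lemma coevaluation_over:
  assumes "Q \<in> Obj C"
  shows "[Q] \<turnstile> [(1, co), (0, X Q Y)] \<approx> [(0, co), (1, X' V Q)]"
proof -
  note [simp] = assms
  have "[Q] \<turnstile> [(1, co), (0, X Q Y)] \<approx> [(1, co), (0, X Q Y), (1, X Q V), (1, X' V Q)]"
    by (rule rewrite[OF X_X'(1)[THEN deq_sym, of Q V], where i=2 and n=1]) simp_all
  also have "[Q] \<turnstile> \<dots> \<approx> [(0, co), (1, X' V Q)]"
    by (rule rewrite[OF under_X[OF is_box_dual(2) assms], where i=0 and n=0]) simp_all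
  finally show ?thesis .
qed

lemma coevaluation_under:
  assumes "Q \<in> Obj C"
  shows "[Q] \<turnstile> [(1, co), (0, X' Q Y)] \<approx> [(0, co), (1, X V Q)]"
proof -
  note [simp] = assms
  have "[Q] \<turnstile> [(0, co), (1, X V Q)] \<approx> [(0, co), (1, X V Q), (0, X Y Q), (0, X' Q Y)]"
    by (rule rewrite[OF X_X'(1)[THEN deq_sym, of Y Q], where i=2 and n=0]) simp_all
  also have "[Q] \<turnstile> \<dots> \<approx> [(1, co), (0, X' Q Y)]"
    by (rule rewrite[OF over_X[OF is_box_dual(2) assms], where i=0 and n=0]) simp_all
  finally show ?thesis by (rule deq_sym)
qed

text \<open>
  Bending the wire on which \<open>F\<close> acts yields a right action of \<open>H\<close> on the dual. Composition reverses
  the order, so that now the untwisted coproduct occurs in the convolution.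
\<close>

lemma transposed_action_convolution:
  fixes f g
  defines "F \<equiv> ([H, Y], f, [Y])" and "G \<equiv> ([H, Y], g, [Y])"
  assumes bx: "is_box F" "is_box G"
    and conv: "[H, Y] \<turnstile> [(0, cop), (1, G), (0, F)] \<approx> [(0, cou)]"
  shows "[V, Y] \<turnstile> [(1, coa), (2, co), (1, F), (0, ev), (1, coa), (2, co), (1, G), (0, ev)] \<approx> []"
proof -
  note [simp] = bx[unfolded F_def G_def] F_def G_def
  \<comment> \<open>the two bent wires are joined: the evaluation of the second factor meets the coevaluation of the first\<close>
  have "[V, Y] \<turnstile> [(1, coa), (2, co), (1, F), (0, ev), (1, coa), (2, co), (1, G), (0, ev)] \<approx>
     [(1, coa), (2, coa), (3, co), (2, G), (2, co), (3, ev), (1, F), (0, ev)]"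
    by (rule interchange) simp_all
  also have "[V, Y] \<turnstile> \<dots> \<approx> [(1, coa), (2, coa), (3, co), (2, G), (1, F), (0, ev)]"
    by (rule rewrite[OF zigzag_Y, where i=4 and n=2]) simp_all
  also have "[V, Y] \<turnstile> \<dots> \<approx> [(1, coa), (2, co), (1, cop), (2, G), (1, F), (0, ev)]"
    by (rule rewrite[OF coaction_coassoc, where i=0 and n=1]) simp_all
  also have "[V, Y] \<turnstile> \<dots> \<approx> [(1, coa), (2, co), (1, cou), (0, ev)]"
    by (rule rewrite[OF conv, where i=2 and n=1]) simp_all
  also have "[V, Y] \<turnstile> \<dots> \<approx> [(1, coa), (1, cou), (1, co), (0, ev)]"
    \<comment> \<open>evaluating \<open>nf\<close> slides the coevaluation to the place where the wire \<open>H\<close> ended\<close>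
    using nf_sound[of "[V, Y]" "[(1, coa), (2, co), (1, cou), (0, ev)]"] by simp
  also have "[V, Y] \<turnstile> \<dots> \<approx> [(1, co), (0, ev)]"
    by (rule rewrite[OF coaction_counit, where i=0 and n=1]) simp_all
  also have "[V, Y] \<turnstile> \<dots> \<approx> []"
    by (rule rewrite[OF zigzag_V, where i=0 and n=0]) simp_all
  finally show ?thesis .
qed

text \<open>
  The convolution inverse of \<open>phi_act\<close> with respect to \<open>\<Delta>\<close>.
\<close>

definition "phi_act_ant_arr = val [H, Y] [(0, ant), (0, act), (0, phY')]"

abbreviation "phi_act_ant \<equiv> ([H, Y], phi_act_ant_arr, [Y])"

lemma phi_act_ant: "is_box phi_act_ant" "[H, Y] \<turnstile> [(0, phi_act_ant)] \<approx> [(0, ant), (0, act), (0, phY')]"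
  using box_of_diagram[of "[H, Y]" "[(0, ant), (0, act), (0, phY')]"]
  unfolding phi_act_ant_arr_def by simp_all

declare phi_act_ant(1) [simp]

lemma phi_act_ant_convolution_l: "[H, Y] \<turnstile> [(0, cop), (1, phi_act), (0, phi_act_ant)] \<approx> [(0, cou)]"
proof -
  have "[H, Y] \<turnstile> [(0, cop), (1, phi_act), (0, phi_act_ant)] \<approx> [(0, cop), (2, phY), (1, act), (0, phi_act_ant)]"
    by (rule rewrite[OF phi_act(2), where i=1 and n=1]) simp_all
  also have "[H, Y] \<turnstile> \<dots> \<approx> [(1, phY), (0, cop), (0, ant), (1, act), (0, act), (0, phY')]"
    by (rule rewrite[OF phi_act_ant(2), where i=3 and n=0]) simp_all
  also have "[H, Y] \<turnstile> \<dots> \<approx> [(0, cou), (0, phY), (0, phY')]"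
    by (rule rewrite[OF action_convolution[of "[(0, cop), (0, ant)]"], where i=1 and n=0])
      (use antipode_l in simp_all)
  also have "[H, Y] \<turnstile> \<dots> \<approx> [(0, cou)]"
    by (rule rewrite[OF phY_phY'(1), where i=1 and n=0]) simp_all
  finally show ?thesis .
qed

lemma phi_act_ant_convolution_r: "[H, Y] \<turnstile> [(0, cop), (1, phi_act_ant), (0, phi_act)] \<approx> [(0, cou)]"
proof -
  have "[H, Y] \<turnstile> [(0, cop), (1, phi_act_ant), (0, phi_act)] \<approx> [(0, cop), (1, ant), (1, act), (1, phY'), (0, phi_act)]"
    by (rule rewrite[OF phi_act_ant(2), where i=1 and n=1]) simp_all
  also have "[H, Y] \<turnstile> \<dots> \<approx> [(0, cop), (1, ant), (1, act), (1, phY'), (1, phY), (0, act)]"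
    by (rule rewrite[OF phi_act(2), where i=4 and n=0]) simp_all
  also have "[H, Y] \<turnstile> \<dots> \<approx> [(0, cop), (1, ant), (1, act), (0, act)]"
    by (rule rewrite[OF phY_phY'(2), where i=3 and n=1]) simp_all
  also have "[H, Y] \<turnstile> \<dots> \<approx> [(0, cou)]"
    by (rule rewrite[OF action_convolution[of "[(0, cop), (1, ant)]"], where i=0 and n=0])
      (use antipode_r in simp_all)
  finally show ?thesis .
qed

text \<open>
  The crossing over the strand that is bent upwards becomes an inverse crossing over the dual.
\<close>

lemma transposed_rho:
  "[V, Y] \<turnstile> [(2, co), (1, R), (0, ev)] \<approx> [(1, coa), (2, co), (1, phi_act), (0, ev), (0, X' V Y)]"
proof -
  have "[V, Y] \<turnstile> [(2, co), (1, R), (0, ev)] \<approx> [(1, coa), (3, co), (2, X Y Y), (1, phi_act), (0, ev)]"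
    by (rule rewrite[OF R_crossing, where i=1 and n=1]) simp_all
  also have "[V, Y] \<turnstile> \<dots> \<approx> [(1, coa), (2, co), (1, phi_act), (0, ev), (0, X' V Y)]"
    by (rule rewrite[OF coevaluation_over[OF yd_arr(1)], where i=1 and n=2]) simp_all
  finally show ?thesis .
qed

lemma transposed_rho_invertible: "invertible C (partial_transpose C Y V e c rho)"
proof -
  let ?d = "[(1, coa), (2, co), (1, phi_act), (0, ev), (0, X' V Y)]"
  let ?d' = "[(0, X Y V), (1, coa), (2, co), (1, phi_act_ant), (0, ev)]"
  have "[V, Y] \<turnstile> ?d @ ?d' \<approx> [(1, coa), (2, co), (1, phi_act), (0, ev), (1, coa), (2, co), (1, phi_act_ant), (0, ev)]"
    by (rule rewrite[OF X_X'(2)[of V Y], where i=4 and n=0]) simp_all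
  also have "[V, Y] \<turnstile> \<dots> \<approx> []"
    by (rule transposed_action_convolution[OF phi_act(1) phi_act_ant(1) phi_act_ant_convolution_r])
  finally have 1: "[V, Y] \<turnstile> ?d @ ?d' \<approx> []" .
  have "[Y, V] \<turnstile> ?d' @ ?d \<approx> [(0, X Y V), (0, X' V Y)]"
    by (rule rewrite[OF transposed_action_convolution[OF phi_act_ant(1) phi_act(1) phi_act_ant_convolution_l], where i=1 and n=0]) simp_all
  also have "[Y, V] \<turnstile> \<dots> \<approx> []" by (rule X_X'(1)) simp_all
  finally have 2: "[Y, V] \<turnstile> ?d' @ ?d \<approx> []" .
  have "is_inverse C (val [V, Y] ?d) (val [Y, V] ?d')"
    using is_inverse_val[OF 1] 2 by simp
  moreover have "partial_transpose C Y V e c rho = val [V, Y] ?d"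
    unfolding partial_transpose_val[OF R_diagram(1)] using transposed_rho by (simp add: deq_def)
  ultimately show ?thesis by (auto simp: invertible_def)
qed

text \<open>
  Besides the inverse of \<open>\<rho>\<close>: the coopposite coproduct \<open>cop'\<close>, its coaction \<open>coa'\<close> on the dual of \<open>Y\<close>,
  which is the transpose of the right coaction on \<open>Y\<close>, and the action through the squared inverse
  of \<open>S\<close>.
\<close>

definition "rho_inv = val [Y, Y] [(0, X' Y Y), (0, coa), (0, X' H Y), (1, phi_act_skew)]"

abbreviation "R' \<equiv> ([Y, Y], rho_inv, [Y, Y])"
definition "cop_arr = val [H] [(0, cop), (0, X' H H)]"

abbreviation "cop' \<equiv> ([H], cop_arr, [H, H])"
definition "coa_arr = val [V] [(1, co), (1, coa), (1, X' H Y), (0, ev)]"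

abbreviation "coa' \<equiv> ([V], coa_arr, [H, V])"
definition "phi_act_skew2_arr = val [H, Y] [(1, phY), (0, ant'), (0, ant'), (0, act)]"

abbreviation "phi_act_skew2 \<equiv> ([H, Y], phi_act_skew2_arr, [Y])"

lemma transpose_boxes:
  "is_box R'" "[Y, Y] \<turnstile> [(0, R')] \<approx> [(0, X' Y Y), (0, coa), (0, X' H Y), (1, phi_act_skew)]"
  "is_box cop'" "[H] \<turnstile> [(0, cop')] \<approx> [(0, cop), (0, X' H H)]"
  "is_box coa'" "[V] \<turnstile> [(0, coa')] \<approx> [(1, co), (1, coa), (1, X' H Y), (0, ev)]"
  "is_box phi_act_skew2" "[H, Y] \<turnstile> [(0, phi_act_skew2)] \<approx> [(1, phY), (0, ant'), (0, ant'), (0, act)]"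
  using box_of_diagram[of "[Y, Y]" "[(0, X' Y Y), (0, coa), (0, X' H Y), (1, phi_act_skew)]"]
    box_of_diagram[of "[H]" "[(0, cop), (0, X' H H)]"]
    box_of_diagram[of "[V]" "[(1, co), (1, coa), (1, X' H Y), (0, ev)]"]
    box_of_diagram[of "[H, Y]" "[(1, phY), (0, ant'), (0, ant'), (0, act)]"]
  unfolding rho_inv_def cop_arr_def coa_arr_def phi_act_skew2_arr_def by simp_all

declare transpose_boxes(1,3,5,7) [simp]

text \<open>
  The partial transpose of the inverse of \<open>\<rho>\<close> is a coaction on the dual followed by a crossing and
  an action, and thus an instance of \<open>crossing_inverse\<close>.
\<close>

lemma transposed_inverse_rho:
  "[V, Y] \<turnstile> [(2, co), (1, R'), (0, ev)] \<approx> [(0, coa'), (1, X V Y), (0, phi_act_skew)]"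
proof -
  have "[V, Y] \<turnstile> [(2, co), (1, R'), (0, ev)] \<approx>
      [(2, co), (1, X' Y Y), (1, coa), (1, X' H Y), (2, phi_act_skew), (0, ev)]"
    by (rule rewrite[OF transpose_boxes(2), where i=1 and n=1]) simp_all
  also have "[V, Y] \<turnstile> \<dots> \<approx> [(1, co), (1, coa), (1, X' H Y), (0, ev), (1, X V Y), (0, phi_act_skew)]"
    by (rule rewrite[OF coevaluation_under[OF yd_arr(1)], where i=0 and n=1]) simp_all
  also have "[V, Y] \<turnstile> \<dots> \<approx> [(0, coa'), (1, X V Y), (0, phi_act_skew)]"
    by (rule rewrite[OF transpose_boxes(6)[THEN deq_sym], where i=0 and n=0]) simp_all
  finally show ?thesis .
qed

text \<open>
  A zigzag joins the two transposes into the transpose of the iterated right coaction of \<open>Y\<close>, whose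
  coassociativity involves the coopposite coproduct.
\<close>

lemma dual_coaction_coassoc: "[V] \<turnstile> [(0, coa'), (1, coa')] \<approx> [(0, coa'), (0, cop')]"
proof -
  note coassoc' = right_coaction_coassoc[OF hopf_arr(1) yd_arr(1) is_box_yd(2) is_box_hopf(3) coaction_coassoc]
  have "[V] \<turnstile> [(0, coa'), (1, coa')] \<approx> [(1, co), (1, coa), (1, X' H Y), (0, ev), (1, coa')]"
    by (rule rewrite[OF transpose_boxes(6), where i=0 and n=0]) simp_all
  also have "[V] \<turnstile> \<dots> \<approx>
      [(1, co), (1, coa), (1, X' H Y), (1, co), (2, ev), (1, coa), (1, X' H Y), (0, ev)]"
    by (rule rewrite[OF transpose_boxes(6), where i=4 and n=1]) simp_all
  also have "[V] \<turnstile> \<dots> \<approx> [(1, co), (1, coa), (1, X' H Y), (1, coa), (1, X' H Y), (0, ev)]"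
    by (rule rewrite[OF zigzag_Y, where i=3 and n=1]) simp_all
  also have "[V] \<turnstile> \<dots> \<approx> [(1, co), (1, coa), (1, X' H Y), (0, ev), (0, cop), (0, X' H H)]"
    by (rule rewrite[OF coassoc', where i=1 and n=1]) simp_all
  also have "[V] \<turnstile> \<dots> \<approx> [(0, coa'), (0, cop), (0, X' H H)]"
    by (rule rewrite[OF transpose_boxes(6)[THEN deq_sym], where i=0 and n=0]) simp_all
  also have "[V] \<turnstile> \<dots> \<approx> [(0, coa'), (0, cop')]"
    by (rule rewrite[OF transpose_boxes(4)[THEN deq_sym], where i=1 and n=0]) simp_all
  finally show ?thesis .
qed

lemma dual_coaction_counit: "[V] \<turnstile> [(0, coa'), (0, cou)] \<approx> []"
proof -
  note counit' = right_coaction_counit[OF hopf_arr(1) yd_arr(1) is_box_yd(2) is_box_hopf(4) coaction_counit]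
  have "[V] \<turnstile> [(0, coa'), (0, cou)] \<approx> [(1, co), (1, coa), (1, X' H Y), (2, cou), (0, ev)]"
    by (rule rewrite[OF transpose_boxes(6), where i=0 and n=0]) simp_all
  also have "[V] \<turnstile> \<dots> \<approx> [(1, co), (0, ev)]"
    by (rule rewrite[OF counit', where i=1 and n=1]) simp_all
  also note zigzag_V
  finally show ?thesis .
qed

lemma phi_act_skew2_convolution_l:
  "[H, Y] \<turnstile> [(0, cop'), (0, X' H H), (1, phi_act_skew), (0, phi_act_skew2)] \<approx> [(0, cou)]"
proof -
  have "[H, Y] \<turnstile> [(0, cop'), (0, X' H H), (1, phi_act_skew), (0, phi_act_skew2)] \<approx>
     [(0, cop), (0, X' H H), (0, X' H H), (1, phi_act_skew), (0, phi_act_skew2)]"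
    by (rule rewrite[OF transpose_boxes(4), where i=0 and n=0]) simp_all
  also have "[H, Y] \<turnstile> \<dots> \<approx>
     [(0, cop), (0, X' H H), (0, X' H H), (1, ant'), (1, act), (1, phY'), (0, phi_act_skew2)]"
    by (rule rewrite[OF phi_act(4), where i=3 and n=1]) simp_all
  also have "[H, Y] \<turnstile> \<dots> \<approx>
     [(0, cop), (0, X' H H), (0, X' H H), (1, ant'), (1, act), (1, phY'), (1, phY), (0, ant'), (0, ant'), (0, act)]"
    by (rule rewrite[OF transpose_boxes(8), where i=6 and n=0]) simp_all
  also have "[H, Y] \<turnstile> \<dots> \<approx>
     [(0, cop), (0, X' H H), (0, X' H H), (1, ant'), (0, ant'), (0, ant'), (1, act), (0, act)]"
    by (rule rewrite[OF phY_phY'(2), where i=5 and n=1]) simp_all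
  also have "[H, Y] \<turnstile> \<dots> \<approx> [(0, cou)]"
    by (rule rewrite[OF action_convolution[of "[(0, cop), (0, X' H H), (0, X' H H), (1, ant'), (0, ant'), (0, ant')]"],
          where i=0 and n=0])
      (use skew2_antipode_r in simp_all)
  finally show ?thesis .
qed

lemma phi_act_skew2_convolution_r:
  "[H, Y] \<turnstile> [(0, cop'), (0, X' H H), (1, phi_act_skew2), (0, phi_act_skew)] \<approx> [(0, cou)]"
proof -
  have "[H, Y] \<turnstile> [(0, cop'), (0, X' H H), (1, phi_act_skew2), (0, phi_act_skew)] \<approx>
     [(0, cop), (0, X' H H), (0, X' H H), (1, phi_act_skew2), (0, phi_act_skew)]"
    by (rule rewrite[OF transpose_boxes(4), where i=0 and n=0]) simp_all
  also have "[H, Y] \<turnstile> \<dots> \<approx>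
     [(0, cop), (0, X' H H), (0, X' H H), (2, phY), (1, ant'), (1, ant'), (1, act), (0, phi_act_skew)]"
    by (rule rewrite[OF transpose_boxes(8), where i=3 and n=1]) simp_all
  also have "[H, Y] \<turnstile> \<dots> \<approx>
     [(1, phY), (0, cop), (0, X' H H), (0, X' H H), (1, ant'), (1, ant'), (0, ant'), (1, act), (0, act), (0, phY')]"
    by (rule rewrite[OF phi_act(4), where i=7 and n=0]) simp_all
  also have "[H, Y] \<turnstile> \<dots> \<approx> [(0, cou), (0, phY), (0, phY')]"
    by (rule rewrite[OF action_convolution[of "[(0, cop), (0, X' H H), (0, X' H H), (1, ant'), (1, ant'), (0, ant')]"],
          where i=1 and n=0])
      (use skew2_antipode_l in simp_all)
  also have "[H, Y] \<turnstile> \<dots> \<approx> [(0, cou)]"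
    by (rule rewrite[OF phY_phY'(1), where i=1 and n=0]) simp_all
  finally show ?thesis .
qed

lemma transposed_inverse_rho_invertible:
  "invertible C (partial_transpose C Y V e c (inverse_arr C rho))"
proof -
  note inv = crossing_inverse[OF hopf_arr(1) dual_arr(1) yd_arr(1) transpose_boxes(5) transpose_boxes(3) is_box_hopf(4)
        phi_act(3) transpose_boxes(7) dual_coaction_coassoc dual_coaction_counit phi_act_skew2_convolution_l phi_act_skew2_convolution_r]
  have "partial_transpose C Y V e c (inverse_arr C rho) = val [V, Y] [(0, coa'), (1, X V Y), (0, phi_act_skew)]"
    unfolding inverse_arr_eq[OF rho_inverse] rho_inv_def[symmetric] partial_transpose_val[OF transpose_boxes(1)]
    using transposed_inverse_rho by (simp add: deq_def)
  with inv show ?thesis by (auto simp: invertible_def)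
qed

end

context yetter_drinfeld_module
begin

theorem rigid_r_matrix_rho:
  assumes "rigid_object C Y"
  shows "rigid_r_matrix C Y rho"
proof -
  have "invertible C (partial_transpose C Y V e c rho) \<and>
      invertible C (partial_transpose C Y V e c (inverse_arr C rho))"
    if "is_dual C Y V e c" for V e c
  proof -
    interpret dual_yetter_drinfeld_module C H \<mu> \<eta> \<Delta> \<epsilon> S \<phi> Y \<alpha> \<delta> V e c
      by unfold_locales (rule that)
    show ?thesis using transposed_rho_invertible transposed_inverse_rho_invertible by blast
  qed
  with assms r_matrix_rho show ?thesis by (simp add: rigid_r_matrix_def)
qed

end

section \<open>Rotating diagrams by a half turn\<close>

text \<open>
  The braiding is kept: turning a crossing by a half turn does not change which strand is on top.
\<close>

definition half_turn :: "('o, 'm) bm_cat \<Rightarrow> ('o, 'm) bm_cat" where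
  "half_turn C = \<lparr>Obj = Obj C, Arr = Arr C, Dom = Cod C, Cod = Dom C, Id = Id C,
     Comp = (\<lambda>g f. Comp C f g), Tobj = (\<lambda>A B. Tobj C B A), Tarr = (\<lambda>f g. Tarr C g f),
     Unit = Unit C, Braid = Braid C\<rparr>"

lemma half_turn_simps [simp]:
  "Obj (half_turn C) = Obj C" "Arr (half_turn C) = Arr C" "Dom (half_turn C) = Cod C" "Cod (half_turn C) = Dom C"
  "Id (half_turn C) = Id C" "Comp (half_turn C) g f = Comp C f g" "Tobj (half_turn C) A B = Tobj C B A"
  "Tarr (half_turn C) f' g' = Tarr C g' f'" "Unit (half_turn C) = Unit C" "Braid (half_turn C) = Braid C"
  by (simp_all add: half_turn_def)

lemma hom_half_turn [simp]: "hom (half_turn C) A B = hom C B A"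
  by (auto simp: hom_def)

lemma is_inverse_half_turn [simp]: "is_inverse (half_turn C) f g \<longleftrightarrow> is_inverse C f g"
  by (auto simp: is_inverse_def hom_def)

lemma invertible_half_turn [simp]: "invertible (half_turn C) f \<longleftrightarrow> invertible C f"
  by (simp add: invertible_def)

lemma inverse_arr_half_turn [simp]: "inverse_arr (half_turn C) f = inverse_arr C f"
  by (simp add: inverse_arr_def)

context strict_braided_monoidal_category
begin

lemma strict_braided_monoidal_half_turn: "strict_braided_monoidal_category (half_turn C)"
proof unfold_locales
  fix A B E f g h A' B' E' f' g' F
  show "f \<in> Arr (half_turn C) \<Longrightarrow> Dom (half_turn C) f \<in> Obj (half_turn C)"
    "f \<in> Arr (half_turn C) \<Longrightarrow> Cod (half_turn C) f \<in> Obj (half_turn C)"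
    by (simp_all add: dom_obj cod_obj)
qed (auto simp: id_hom comp_hom comp_id_left comp_id_right comp_assoc unit_obj tensor_obj tensor_hom
    tensor_id tensor_comp tensor_assoc_obj tensor_assoc_arr unit_left_obj unit_right_obj
    unit_left_arr unit_right_arr braid_hom braid_invertible braid_natural hexagon_left hexagon_right)

lemma is_dual_half_turn: "is_dual (half_turn C) Y V e c \<longleftrightarrow> is_dual C Y V c e"
  by (auto simp: is_dual_def)

lemma rigid_object_half_turn: "rigid_object (half_turn C) Y \<longleftrightarrow> rigid_object C Y"
  by (auto simp: rigid_object_def is_dual_half_turn)

lemma r_matrix_half_turn:
  assumes "Y \<in> Obj C"
  shows "r_matrix (half_turn C) Y \<rho> \<longleftrightarrow> r_matrix C Y \<rho>"
  using assms
  by (auto simp: r_matrix_def hom_iff arrow_simps comp_assoc_arr tensor_assoc_obj)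

lemma partial_transpose_half_turn:
  assumes "is_dual C Y V c e" "f \<in> hom C (Y \<odot> Y) (Y \<odot> Y)"
  shows "partial_transpose (half_turn C) Y V e c f = partial_transpose C Y V c e f"
  using assms
  by (simp add: partial_transpose_def is_dual_def hom_iff arrow_simps comp_assoc_arr
      tensor_assoc_obj tensor_assoc_arr)

lemma rigid_r_matrix_half_turn:
  assumes "Y \<in> Obj C"
  shows "rigid_r_matrix (half_turn C) Y \<rho> \<longleftrightarrow> rigid_r_matrix C Y \<rho>"
proof -
  have "inverse_arr C \<rho> \<in> hom C (Y \<odot> Y) (Y \<odot> Y)" if "r_matrix C Y \<rho>"
    using that is_inverse_inverse_arr[of \<rho>] by (auto simp: r_matrix_def is_inverse_def hom_iff)
  moreover have "\<rho> \<in> hom C (Y \<odot> Y) (Y \<odot> Y)" if "r_matrix C Y \<rho>"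
    using that by (simp add: r_matrix_def)
  ultimately show ?thesis
    unfolding rigid_r_matrix_def r_matrix_half_turn[OF assms] rigid_object_half_turn is_dual_half_turn
    by (auto simp: partial_transpose_half_turn)
qed

end

context hopf_algebra
begin

lemma hopf_object_half_turn: "hopf_object (half_turn C) H \<Delta> \<epsilon> \<mu> \<eta> S"
  using hopf
  by (auto simp: hopf_object_def algebra_object_def coalgebra_object_def hom_iff arrow_simps
      braid_arr comp_assoc_arr tensor_assoc_obj tensor_assoc_arr)

text \<open>
  The left-handed results hold for the turned category, where \<open>\<delta>\<close> is the action and \<open>\<alpha>\<close> the
  coaction.
\<close>

theorem right_yetter_drinfeld_r_matrix:
  fixes \<phi> :: "'o \<Rightarrow> 'm"
  assumes yd: "right_yetter_drinfeld C \<phi> H \<mu> \<eta> \<Delta> \<epsilon> Y \<alpha> \<delta>"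
    and phi: "\<phi> H \<in> hom C H H" "\<phi> Y \<in> hom C Y Y" "invertible C (\<phi> Y)"
      "\<phi> Y \<cdot> \<alpha> = \<alpha> \<cdot> (\<phi> Y \<otimes> \<phi> H)" "\<delta> \<cdot> \<phi> Y = (\<phi> Y \<otimes> \<phi> H) \<cdot> \<delta>"
  shows "r_matrix C Y (rho_R C \<phi> H Y \<alpha> \<delta>)"
    "rigid_object C Y \<Longrightarrow> rigid_r_matrix C Y (rho_R C \<phi> H Y \<alpha> \<delta>)"
proof -
  have Y: "Y \<in> Obj C" and m: "\<alpha> \<in> hom C (Y \<odot> H) Y" "\<delta> \<in> hom C Y (Y \<odot> H)"
    using yd by (auto simp: right_yetter_drinfeld_def right_module_def right_comodule_def)
  note arr = hopf_arr m[unfolded hom_iff] phi(1,2)[unfolded hom_iff] Y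
  interpret turned: strict_braided_monoidal_category "half_turn C"
    by (rule strict_braided_monoidal_half_turn)
  have L: "left_yetter_drinfeld (half_turn C) \<phi> H \<Delta> \<epsilon> \<mu> \<eta> Y \<delta> \<alpha>"
    using yd arr
    by (auto simp: right_yetter_drinfeld_def right_module_def right_comodule_def
        left_yetter_drinfeld_def left_module_def left_comodule_def hom_iff arrow_simps
        braid_arr comp_assoc_arr tensor_assoc_obj tensor_assoc_arr)
  interpret turned: yetter_drinfeld_module "half_turn C" H \<Delta> \<epsilon> \<mu> \<eta> S \<phi> Y \<delta> \<alpha>
    by unfold_locales (use hopf_object_half_turn L phi in simp_all)
  have rho: "rho_L (half_turn C) \<phi> H Y \<delta> \<alpha> = rho_R C \<phi> H Y \<alpha> \<delta>"
    using arr by (simp add: rho_L_def rho_R_def arrow_simps braid_arr comp_assoc_arr tensor_assoc_obj)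
  show "r_matrix C Y (rho_R C \<phi> H Y \<alpha> \<delta>)"
    using turned.r_matrix_rho unfolding rho r_matrix_half_turn[OF Y] .
  show "rigid_r_matrix C Y (rho_R C \<phi> H Y \<alpha> \<delta>)" if "rigid_object C Y"
    using turned.rigid_r_matrix_rho that unfolding rho rigid_object_half_turn rigid_r_matrix_half_turn[OF Y] by blast
qed

end

section \<open>f-objects\<close>

text \<open>
  Products and sources of arrows are folded back into the object operations of the category of
  \<open>f\<close>-objects, so that later proofs compare whole \<open>f\<close>-objects instead of their components.
\<close>

lemma f_category_simps:
  "Obj (f_category C) = {F. is_f_object C F}"
  "Dom (f_category C) (F, f, G) = F" "Cod (f_category C) (F, f, G) = G"
  "Id (f_category C) F = (F, Id C (fst F), F)"
  "Comp (f_category C) (G', g, K) (F, f, G) = (F, Comp C g f, K)"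
  "Tobj (f_category C) F K = (Tobj C (fst F) (fst K), \<lambda>n. Tarr C (snd F n) (snd K n))"
  "Tarr (f_category C) (F, f, G) (F', g, G') =
     (Tobj (f_category C) F F', Tarr C f g, Tobj (f_category C) G G')"
  "Unit (f_category C) = (Unit C, \<lambda>n. Id C (Unit C))"
  "Braid (f_category C) F G =
     (Tobj (f_category C) F G, Braid C (fst F) (fst G), Tobj (f_category C) G F)"
  by (simp_all add: f_category_def)

definition natural :: "('o, 'm) bm_cat \<Rightarrow> ('o, 'm) f_obj \<Rightarrow> 'm \<Rightarrow> ('o, 'm) f_obj \<Rightarrow> bool" where
  "natural C F f G \<longleftrightarrow> is_f_object C F \<and> is_f_object C G \<and> f \<in> hom C (fst F) (fst G) \<and>
     (\<forall>n. Comp C (snd G n) f = Comp C f (snd F n))"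

lemma f_hom_iff: "x \<in> hom (f_category C) F G \<longleftrightarrow> (\<exists>f. x = (F, f, G) \<and> natural C F f G)"
  by (cases x, cases F, cases G) (auto simp: hom_def f_category_def natural_def)

lemma f_arr_iff: "x \<in> Arr (f_category C) \<longleftrightarrow> (\<exists>F f G. x = (F, f, G) \<and> natural C F f G)"
  by (auto simp: f_category_def natural_def)

context strict_monoidal_category
begin

lemma f_objectD:
  assumes "is_f_object C F"
  shows "fst F \<in> Obj C" "snd F n \<in> Arr C" "Dom C (snd F n) = fst F" "Cod C (snd F n) = fst F"
    "snd F 0 = \<one> (fst F)" "snd F (i + j) = snd F i \<cdot> snd F j"
  using assms by (auto simp: is_f_object_def hom_iff)

lemma naturalD:
  assumes "natural C F f G"
  shows "is_f_object C F" "is_f_object C G" "f \<in> Arr C" "Dom C f = fst F" "Cod C f = fst G"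
    "snd G n \<cdot> f = f \<cdot> snd F n"
  using assms by (auto simp: natural_def hom_iff)

lemma f_object_tensor:
  assumes "is_f_object C F" "is_f_object C G"
  shows "is_f_object C (Tobj (f_category C) F G)"
  using f_objectD[OF assms(1)] f_objectD[OF assms(2)]
  by (auto simp: is_f_object_def f_category_simps hom_iff arrow_simps tensor_id interchange_arr)

lemma f_object_unit: "is_f_object C (Unit (f_category C))"
  by (auto simp: is_f_object_def f_category_simps hom_iff arrow_simps)

lemma natural_id: "is_f_object C F \<Longrightarrow> natural C F (\<one> (fst F)) F"
  using f_objectD[of F] by (auto simp: natural_def hom_iff arrow_simps)

lemma natural_comp:
  assumes "natural C F f G" "natural C G g K"
  shows "natural C F (g \<cdot> f) K"
proof -
  note d = naturalD[OF assms(1)] naturalD[OF assms(2)]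
  note o = f_objectD[OF d(1)] f_objectD[OF d(2)] f_objectD[OF d(8)]
  have "snd K n \<cdot> (g \<cdot> f) = (g \<cdot> f) \<cdot> snd F n" for n
  proof -
    have "snd K n \<cdot> (g \<cdot> f) = (snd K n \<cdot> g) \<cdot> f"
      by (rule comp_assoc_arr[symmetric]) (use d o in auto)
    also have "\<dots> = (g \<cdot> snd G n) \<cdot> f" using d(12) by simp
    also have "\<dots> = g \<cdot> (snd G n \<cdot> f)" by (rule comp_assoc_arr) (use d o in auto)
    also have "\<dots> = g \<cdot> (f \<cdot> snd F n)" using d(6) by simp
    also have "\<dots> = (g \<cdot> f) \<cdot> snd F n" by (rule comp_assoc_arr[symmetric]) (use d o in auto)
    finally show ?thesis .
  qed
  then show ?thesis using d by (auto simp: natural_def hom_iff arrow_simps)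
qed

lemma natural_tensor:
  assumes "natural C F f G" "natural C F' f' G'"
  shows "natural C (Tobj (f_category C) F F') (f \<otimes> f') (Tobj (f_category C) G G')"
proof -
  note d = naturalD[OF assms(1)] naturalD[OF assms(2)]
  note o = f_objectD[OF d(1)] f_objectD[OF d(2)] f_objectD[OF d(7)] f_objectD[OF d(8)]
  show ?thesis
    using d o f_object_tensor
    by (auto simp: natural_def hom_iff arrow_simps f_category_simps(6) interchange_arr)
qed

lemma natural_inverse:
  assumes "natural C F f G" "is_inverse C f g"
  shows "natural C G g F"
proof -
  note d = naturalD[OF assms(1)]
  note o = f_objectD[OF d(1)] f_objectD[OF d(2)]
  have g: "g \<in> Arr C" "Dom C g = fst G" "Cod C g = fst F" "g \<cdot> f = \<one> (fst F)" "f \<cdot> g = \<one> (fst G)"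
    using assms(2) d by (auto simp: is_inverse_def hom_iff)
  have "snd F n \<cdot> g = g \<cdot> snd G n" for n
  proof -
    have "snd F n \<cdot> g = (g \<cdot> f) \<cdot> (snd F n \<cdot> g)"
      using d o g by (simp add: arrow_simps)
    also have "\<dots> = g \<cdot> ((f \<cdot> snd F n) \<cdot> g)"
      using d(1-5) o(1-4) o(7-10) g(1-3) by (simp add: comp_assoc_arr arr_comp)
    also have "\<dots> = g \<cdot> ((snd G n \<cdot> f) \<cdot> g)" using d(6) by simp
    also have "\<dots> = g \<cdot> (snd G n \<cdot> (f \<cdot> g))"
      using d(1-5) o(1-4) o(7-10) g(1-3) by (simp add: comp_assoc_arr arr_comp)
    also have "\<dots> = g \<cdot> snd G n"
      using d o g by (simp add: arrow_simps)
    finally show ?thesis .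
  qed
  then show ?thesis using d g by (auto simp: natural_def hom_iff)
qed

end

context strict_braided_monoidal_category
begin

lemma natural_braid:
  assumes "is_f_object C F" "is_f_object C G"
  shows "natural C (Tobj (f_category C) F G) (\<tau> (fst F) (fst G)) (Tobj (f_category C) G F)"
  using f_objectD[OF assms(1)] f_objectD[OF assms(2)] f_object_tensor assms
  by (auto simp: natural_def f_category_simps(6) hom_iff braid_arr braid_natural)

lemma natural_hom: "natural C F f G \<Longrightarrow> f \<in> hom C (fst F) (fst G)"
  by (simp add: natural_def)

lemma f_object_obj: "is_f_object C F \<Longrightarrow> fst F \<in> Obj C"
  by (simp add: is_f_object_def)

lemma f_object_tensor_assoc:
  assumes "is_f_object C F" "is_f_object C G" "is_f_object C K"
  shows "Tobj (f_category C) (Tobj (f_category C) F G) K = Tobj (f_category C) F (Tobj (f_category C) G K)"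
  using f_objectD[OF assms(1)] f_objectD[OF assms(2)] f_objectD[OF assms(3)]
  by (simp add: f_category_simps(6) tensor_assoc_obj tensor_assoc_arr)

lemma f_object_tensor_unit:
  assumes "is_f_object C F"
  shows "Tobj (f_category C) (Unit (f_category C)) F = F" "Tobj (f_category C) F (Unit (f_category C)) = F"
  using f_objectD[OF assms]
  by (simp_all add: f_category_simps unit_left_obj unit_right_obj unit_left_arr unit_right_arr)

lemma fst_f_tensor: "fst (Tobj (f_category C) F G) = fst F \<odot> fst G"
  by (simp add: f_category_simps)

lemma f_category_braided: "strict_braided_monoidal_category (f_category C)"
proof unfold_locales
  let ?D = "f_category C"
  note s = f_hom_iff f_arr_iff f_category_simps(1-5,7) fst_f_tensor
  show "f \<in> Arr ?D \<Longrightarrow> Dom ?D f \<in> Obj ?D" "f \<in> Arr ?D \<Longrightarrow> Cod ?D f \<in> Obj ?D" for f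
    by (auto simp: s dest: naturalD)
  show "A \<in> Obj ?D \<Longrightarrow> Id ?D A \<in> hom ?D A A" for A
    by (simp add: s natural_id)
  show "Comp ?D g f \<in> hom ?D A E" if "f \<in> hom ?D A B" "g \<in> hom ?D B E" for f g A B E
    using that by (auto simp: s intro: natural_comp)
  show "Comp ?D (Id ?D B) f = f" if "f \<in> hom ?D A B" for f A B
    using that by (auto simp: s dest!: natural_hom intro: comp_id_left)
  show "Comp ?D f (Id ?D A) = f" if "f \<in> hom ?D A B" for f A B
    using that by (auto simp: s dest!: natural_hom intro: comp_id_right)
  show "Comp ?D (Comp ?D h g) f = Comp ?D h (Comp ?D g f)"
    if "f \<in> hom ?D A B" "g \<in> hom ?D B E" "h \<in> hom ?D E F" for f g h A B E F
    using that by (auto simp: s dest!: natural_hom intro: comp_assoc)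
  show "Unit ?D \<in> Obj ?D" by (simp add: s f_object_unit)
  show "Tobj ?D A B \<in> Obj ?D" if "A \<in> Obj ?D" "B \<in> Obj ?D" for A B
    using that by (simp add: s f_object_tensor)
  show "Tarr ?D f g \<in> hom ?D (Tobj ?D A A') (Tobj ?D B B')"
    if "f \<in> hom ?D A B" "g \<in> hom ?D A' B'" for f g A A' B B'
    using that by (auto simp: s intro: natural_tensor)
  show "Tarr ?D (Id ?D A) (Id ?D B) = Id ?D (Tobj ?D A B)" if "A \<in> Obj ?D" "B \<in> Obj ?D" for A B
    using that by (simp add: s tensor_id f_object_obj)
  show "Tarr ?D (Comp ?D g f) (Comp ?D g' f') = Comp ?D (Tarr ?D g g') (Tarr ?D f f')"
    if "f \<in> hom ?D A B" "g \<in> hom ?D B E" "f' \<in> hom ?D A' B'" "g' \<in> hom ?D B' E'"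
    for f g f' g' A B E A' B' E'
    using that by (auto simp: s dest!: natural_hom intro: tensor_comp)
  show "Tobj ?D (Tobj ?D A B) E = Tobj ?D A (Tobj ?D B E)"
    if "A \<in> Obj ?D" "B \<in> Obj ?D" "E \<in> Obj ?D" for A B E
    using that by (simp add: s f_object_tensor_assoc)
  show "Tarr ?D (Tarr ?D f g) h = Tarr ?D f (Tarr ?D g h)"
    if "f \<in> Arr ?D" "g \<in> Arr ?D" "h \<in> Arr ?D" for f g h
    using that by (auto simp: s f_object_tensor_assoc naturalD(1,2) intro!: tensor_assoc_arr naturalD(3))
  show "Tobj ?D (Unit ?D) A = A" "Tobj ?D A (Unit ?D) = A" if "A \<in> Obj ?D" for A
    using that by (simp_all add: s f_object_tensor_unit)
  have u: "Id ?D (Unit ?D) = (Unit ?D, \<one> \<I>, Unit ?D)" by (simp add: f_category_simps)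
  show "Tarr ?D (Id ?D (Unit ?D)) f = f" "Tarr ?D f (Id ?D (Unit ?D)) = f" if "f \<in> Arr ?D" for f
    using that unfolding u
    by (auto simp: s intro!: f_object_tensor_unit unit_left_arr unit_right_arr intro: naturalD(1-3))
  show "Braid ?D A B \<in> hom ?D (Tobj ?D A B) (Tobj ?D B A)" if "A \<in> Obj ?D" "B \<in> Obj ?D" for A B
    using that by (simp add: s f_category_simps(9) natural_braid)
  show "invertible ?D (Braid ?D A B)" if "A \<in> Obj ?D" "B \<in> Obj ?D" for A B
  proof -
    have AB: "is_f_object C A" "is_f_object C B" using that by (auto simp: s)
    obtain g where g: "is_inverse C (\<tau> (fst A) (fst B)) g"
      using braid_invertible[OF f_object_obj[OF AB(1)] f_object_obj[OF AB(2)]]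
      unfolding invertible_def by blast
    have "is_inverse ?D (Braid ?D A B) (Tobj ?D B A, g, Tobj ?D A B)"
      using natural_braid[OF AB] natural_inverse[OF natural_braid[OF AB] g] g AB
      by (auto simp: is_inverse_def s f_category_simps(9) braid_arr f_object_obj)
    then show ?thesis unfolding invertible_def by (rule exI)
  qed
  show "Comp ?D (Braid ?D B B') (Tarr ?D f g) = Comp ?D (Tarr ?D g f) (Braid ?D A A')"
    if "f \<in> hom ?D A B" "g \<in> hom ?D A' B'" for f g A A' B B'
    using that by (auto simp: s f_category_simps(9) dest!: natural_hom intro: braid_natural)
  show "Braid ?D (Tobj ?D A B) E = Comp ?D (Tarr ?D (Braid ?D A E) (Id ?D B)) (Tarr ?D (Id ?D A) (Braid ?D B E))"
    if "A \<in> Obj ?D" "B \<in> Obj ?D" "E \<in> Obj ?D" for A B E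
    using that by (simp add: s f_category_simps(9) f_object_tensor_assoc hexagon_left f_object_obj)
  show "Braid ?D A (Tobj ?D B E) = Comp ?D (Tarr ?D (Id ?D B) (Braid ?D A E)) (Tarr ?D (Braid ?D A B) (Id ?D E))"
    if "A \<in> Obj ?D" "B \<in> Obj ?D" "E \<in> Obj ?D" for A B E
    using that by (simp add: s f_category_simps(9) f_object_tensor_assoc hexagon_right f_object_obj)
qed

lemma f_phi_natural:
  assumes "is_f_object C F"
  shows "f_phi F \<in> hom (f_category C) F F" "invertible (f_category C) (f_phi F)"
proof -
  note o = f_objectD[OF assms]
  have "snd F j \<cdot> snd F i = snd F i \<cdot> snd F j" for i j
    by (metis o(6) add.commute)
  then have n: "natural C F (snd F i) F" for i
    using assms o(1-4) by (simp add: natural_def hom_iff)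
  then show "f_phi F \<in> hom (f_category C) F F" by (auto simp: f_hom_iff f_phi_def)
  have "snd F (-1) \<cdot> snd F 1 = \<one> (fst F)" "snd F 1 \<cdot> snd F (-1) = \<one> (fst F)"
    using o(5) o(6)[of "-1" 1] o(6)[of 1 "-1"] by simp_all
  then have "is_inverse (f_category C) (f_phi F) (F, snd F (-1), F)"
    using n by (auto simp: is_inverse_def f_hom_iff f_arr_iff f_phi_def f_category_simps)
  then show "invertible (f_category C) (f_phi F)" unfolding invertible_def by (rule exI)
qed

text \<open>
  The twist is natural because every morphism of \<open>f\<close>-objects commutes with the image of \<open>1\<close>.
\<close>

lemma f_phi_commute:
  assumes "x \<in> hom (f_category C) F G"
  shows "Comp (f_category C) (f_phi G) x = Comp (f_category C) x (f_phi F)"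
  using assms by (auto simp: f_hom_iff f_phi_def f_category_simps dest: naturalD)

lemma f_phi_tensor:
  "f_phi (Tobj (f_category C) F G) = Tarr (f_category C) (f_phi F) (f_phi G)"
  by (simp add: f_phi_def f_category_simps)

end

theorem theorem3p6:
  fixes C :: "('o, 'm) bm_cat"
    and H Y :: "('o, 'm) f_obj"
    and \<mu> \<eta> \<Delta> \<epsilon> S act \<delta> :: "('o, 'm) f_arr"
  assumes "strict_braided_monoidal_category C"
    and "hopf_object (f_category C) H \<mu> \<eta> \<Delta> \<epsilon> S"
  shows
    "(left_yetter_drinfeld (f_category C) f_phi H \<mu> \<eta> \<Delta> \<epsilon> Y act \<delta> \<longrightarrow>
        r_matrix (f_category C) Y (rho_L (f_category C) f_phi H Y act \<delta>) \<and>
        (rigid_object (f_category C) Y \<longrightarrow>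
          rigid_r_matrix (f_category C) Y (rho_L (f_category C) f_phi H Y act \<delta>)))
     \<and>
     (right_yetter_drinfeld (f_category C) f_phi H \<mu> \<eta> \<Delta> \<epsilon> Y act \<delta> \<longrightarrow>
        r_matrix (f_category C) Y (rho_R (f_category C) f_phi H Y act \<delta>) \<and>
        (rigid_object (f_category C) Y \<longrightarrow>
          rigid_r_matrix (f_category C) Y (rho_R (f_category C) f_phi H Y act \<delta>)))"
proof -
  let ?D = "f_category C"
  interpret C: strict_braided_monoidal_category C by fact
  interpret D: strict_braided_monoidal_category ?D by (rule C.f_category_braided)
  interpret D: hopf_algebra ?D H \<mu> \<eta> \<Delta> \<epsilon> S by unfold_locales fact
  have obj: "is_f_object C F" if "F \<in> Obj ?D" for F
    using that by (simp add: f_category_simps)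
  note phi = C.f_phi_natural[OF obj]
  have "r_matrix ?D Y (rho_L ?D f_phi H Y act \<delta>) \<and>
      (rigid_object ?D Y \<longrightarrow> rigid_r_matrix ?D Y (rho_L ?D f_phi H Y act \<delta>))"
    if yd: "left_yetter_drinfeld ?D f_phi H \<mu> \<eta> \<Delta> \<epsilon> Y act \<delta>"
  proof -
    have h: "Y \<in> Obj ?D" "act \<in> hom ?D (Tobj ?D H Y) Y" "\<delta> \<in> hom ?D Y (Tobj ?D H Y)"
      using yd by (auto simp: left_yetter_drinfeld_def left_module_def left_comodule_def)
    interpret Y: yetter_drinfeld_module ?D H \<mu> \<eta> \<Delta> \<epsilon> S f_phi Y act \<delta>
      using yd phi[OF D.hopf_arr(1)] phi[OF h(1)] C.f_phi_commute[OF h(2)] C.f_phi_commute[OF h(3)]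
      by unfold_locales (simp_all add: C.f_phi_tensor)
    show ?thesis using Y.r_matrix_rho Y.rigid_r_matrix_rho by blast
  qed
  moreover have "r_matrix ?D Y (rho_R ?D f_phi H Y act \<delta>) \<and>
      (rigid_object ?D Y \<longrightarrow> rigid_r_matrix ?D Y (rho_R ?D f_phi H Y act \<delta>))"
    if yd: "right_yetter_drinfeld ?D f_phi H \<mu> \<eta> \<Delta> \<epsilon> Y act \<delta>"
  proof -
    have h: "Y \<in> Obj ?D" "act \<in> hom ?D (Tobj ?D Y H) Y" "\<delta> \<in> hom ?D Y (Tobj ?D Y H)"
      using yd by (auto simp: right_yetter_drinfeld_def right_module_def right_comodule_def)
    show ?thesis
      using D.right_yetter_drinfeld_r_matrix[OF yd phi(1)[OF D.hopf_arr(1)] phi[OF h(1)]]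
        C.f_phi_commute[OF h(2)] C.f_phi_commute[OF h(3)]
      by (simp add: C.f_phi_tensor)
  qed
  ultimately show ?thesis by blast
qed

end
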